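(* Let $\psi(x)=\exp(-\|x\|^2)$, $x\in\mathbb{R}^d$. Let $\alpha\in(1,2)$, let $\nu_\alpha(du)=c_{\alpha,d}\|u\|^{-d-\alpha}du$ and let $\mu_\alpha$ be the associated rotationally invariant $\alpha$-stable distribution. Let $\beta\in(1,\alpha)$ and let $\mu$ be a centered probability measure on $\mathbb{R}^d$ with $\int_{\mathbb{R}^d}\|x\|^\beta\mu(dx)<+\infty$ and with $\mu*\nu_\alpha\ll\mu$. Let $\mathcal{E}_\mu$ be the closable, Markovian, symmetric, bilinear, non-negative definite form defined, for all $f,g\in\mathcal{S}(\mathbb{R}^d)$, by $$\mathcal{E}_\mu(f,g)=\int_{\mathbb{R}^d}\int_{\mathbb{R}^d}(f(x+u)-f(x))(g(x+u)-g(x))\nu_\alpha(du)\mu(dx),$$ with $\mathcal{D}(\mathcal{E}_\mu)$ the domain of its smallest closed extension. Moreover, assume that: (a) there exists $U_\mu>0$ such that, for all $f\in\mathcal{D}(\mathcal{E}_\mu)$ with $\int_{\mathbb{R}^d}f(x)\mu(dx)=0$, $$\int_{\mathbb{R}^d}|f(x)|^2\mu(dx)\le U_\mu\int_{\mathbb{R}^d}\int_{\mathbb{R}^d}|f(x+u)-f(x)|^2\nu_\alpha(du)\mu(dx);$$ (b) for $\tilde g_{R,j}(x)=x_j\psi(x/R)-\int_{\mathbb{R}^d}y_j\psi(y/R)\mu(dy)$, $x\in\mathbb{R}^d$, $R\ge1$, $j\in\{1,\dots,d\}$, $$\lim_{R\to+\infty}\Big(\mathcal{E}_\mu(U_\mu\tilde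 g_{R,j},\tilde g_{R,j})-\langle\tilde g_{R,j};\tilde g_{R,j}\rangle_{L^2(\mu)}\Big)=0.$$ Then $$d_{W_1}(\mu,\mu_\alpha)\le C_{\alpha,d}\Big(\int_{\|u\|\le1}\|u\|^2\nu_\alpha(du)+\int_{\|u\|\ge1}\|u\|\nu_\alpha(du)\Big)|U_\mu-1|,$$ for some $C_{\alpha,d}>0$ only depending on $\alpha$ and on $d$.
   Context: $\|\cdot\|$: Euclidean norm on $\mathbb{R}^d$; $\mathcal{S}(\mathbb{R}^d)$: Schwartz space of real-valued functions. $c_{\alpha,d}=\frac{-\alpha(\alpha-1)\Gamma((\alpha+d)/2)}{4\cos(\alpha\pi/2)\Gamma((\alpha+1)/2)\pi^{(d-1)/2}\Gamma(2-\alpha)}$ with $\Gamma$ Euler's Gamma function; $\mu_\alpha$ is the probability measure with characteristic function $\exp(-\|\xi\|^\alpha/2)$ (its Lévy measure is $\nu_\alpha$). Centered means $\int x\,\mu(dx)=0$. $\mu*\nu_\alpha\ll\mu$ means: $\mu(B)=0$ implies $\int\nu_\alpha(B-x)\mu(dx)=0$, for Borel $B$. Closed/closable/Markovian forms on $L^2(\mu)$ are in the sense of Fukushima–Oshima–Takeda (Markovian: the semigroup $(P_t)_{t>0}$ associated with the closed form satisfies $0\le P_tf\le1$ $\mu$-a.e. whenever $0\le f\le1$ $\mu$-a.e.); $\mathcal{E}_\mu$ also denotes the smallest closed extension. The distance is $d_{W_1}(\mu,\mu')=\sup_{h\in\mathcal{H}_1}|\int h\,d\mu-\int h\,d\mu'|$,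 where $\mathcal{H}_1$ is the set of bounded continuously differentiable functions $h:\mathbb{R}^d\to\mathbb{R}$ with $\sup_x|h(x)|\le1$ and $\sup_x\|\nabla h(x)\|\le1$. *)

theory Defs
  imports "HOL-Probability.Probability"
begin

section \<open>Schwartz functions\<close>

definition partial_deriv :: "'n::finite \<Rightarrow> (real^'n \<Rightarrow> real) \<Rightarrow> real^'n \<Rightarrow> real" where
  "partial_deriv j f x = frechet_derivative f (at x) (axis j 1)"

primrec iter_partial :: "'n::finite list \<Rightarrow> (real^'n \<Rightarrow> real) \<Rightarrow> real^'n \<Rightarrow> real" where
  "iter_partial [] f = f"
| "iter_partial (j # js) f = partial_deriv j (iter_partial js f)"

text \<open>Lists of coordinates play the role of multi-indices. Requiring every iterated partial
  derivative to be differentiable is smoothness, and it makes the Frechet derivatives above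
  meaningful.\<close>

definition schwartz :: "(real^'n::finite \<Rightarrow> real) set" where
  "schwartz = {f. \<forall>js. (\<forall>x. iter_partial js f differentiable (at x)) \<and>
     (\<forall>k::nat. \<exists>B. \<forall>x. norm x ^ k * \<bar>iter_partial js f x\<bar> \<le> B)}"

section \<open>Closed symmetric forms on \<open>L\<^sup>2\<close>\<close>

text \<open>Elements of \<open>L\<^sup>2(M)\<close> are represented by functions. A form is a pair of a domain \<open>D\<close> and a
  map \<open>E\<close>, of which only the values on \<open>D \<times> D\<close> matter; both are required to be invariant under
  modification on null sets, so that they descend to classes of functions.\<close>

definition L2 :: "'a measure \<Rightarrow> ('a \<Rightarrow> real) set" where
  "L2 M = {f \<in> borel_measurable M. integrable M (\<lambda>x. (f x)\<^sup>2)}"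

definition L2_inner :: "'a measure \<Rightarrow> ('a \<Rightarrow> real) \<Rightarrow> ('a \<Rightarrow> real) \<Rightarrow> real" where
  "L2_inner M f g = (LINT x|M. f x * g x)"

definition L2_norm :: "'a measure \<Rightarrow> ('a \<Rightarrow> real) \<Rightarrow> real" where
  "L2_norm M f = sqrt (L2_inner M f f)"

type_synonym 'a form = "('a \<Rightarrow> real) \<Rightarrow> ('a \<Rightarrow> real) \<Rightarrow> real"

definition symmetric_form :: "'a measure \<Rightarrow> ('a \<Rightarrow> real) set \<Rightarrow> 'a form \<Rightarrow> bool" where
  "symmetric_form M D E \<longleftrightarrow>
     D \<subseteq> L2 M \<and>
     (\<forall>f\<in>D. \<forall>g\<in>L2 M. (AE x in M. f x = g x) \<longrightarrow> g \<in> D \<and> (\<forall>h\<in>D. E f h = E g h)) \<and>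
     (\<lambda>_. 0) \<in> D \<and>
     (\<forall>f\<in>D. \<forall>g\<in>D. \<forall>a b. (\<lambda>x. a * f x + b * g x) \<in> D) \<and>
     (\<forall>f\<in>L2 M. \<forall>e>0. \<exists>g\<in>D. L2_norm M (\<lambda>x. f x - g x) < e) \<and>
     (\<forall>f\<in>D. \<forall>g\<in>D. E f g = E g f) \<and>
     (\<forall>f\<in>D. \<forall>g\<in>D. \<forall>h\<in>D. \<forall>a b. E (\<lambda>x. a * f x + b * g x) h = a * E f h + b * E g h) \<and>
     (\<forall>f\<in>D. 0 \<le> E f f)"

definition form_sq1 :: "'a measure \<Rightarrow> 'a form \<Rightarrow> ('a \<Rightarrow> real) \<Rightarrow> real" where
  "form_sq1 M E f = E f f + L2_inner M f f"

definition closed_form :: "'a measure \<Rightarrow> ('a \<Rightarrow> real) set \<Rightarrow> 'a form \<Rightarrow> bool" where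
  "closed_form M D E \<longleftrightarrow> symmetric_form M D E \<and>
     (\<forall>F :: nat \<Rightarrow> 'a \<Rightarrow> real. range F \<subseteq> D \<longrightarrow>
        (\<forall>e>0. \<exists>N. \<forall>m\<ge>N. \<forall>n\<ge>N. form_sq1 M E (\<lambda>x. F m x - F n x) < e) \<longrightarrow>
        (\<exists>f\<in>D. (\<lambda>n. form_sq1 M E (\<lambda>x. F n x - f x)) \<longlonglongrightarrow> 0))"

definition form_extends :: "('a \<Rightarrow> real) set \<Rightarrow> 'a form \<Rightarrow> ('a \<Rightarrow> real) set \<Rightarrow> 'a form \<Rightarrow> bool" where
  "form_extends D0 E0 D E \<longleftrightarrow> D0 \<subseteq> D \<and> (\<forall>f\<in>D0. \<forall>g\<in>D0. E f g = E0 f g)"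

text \<open>A form \<open>(D0, E0)\<close> has a smallest closed extension exactly if it is closable.\<close>

definition smallest_closed_extension ::
    "'a measure \<Rightarrow> ('a \<Rightarrow> real) set \<Rightarrow> 'a form \<Rightarrow> ('a \<Rightarrow> real) set \<Rightarrow> 'a form \<Rightarrow> bool" where
  "smallest_closed_extension M D0 E0 D E \<longleftrightarrow>
     closed_form M D E \<and> form_extends D0 E0 D E \<and>
     (\<forall>D' E'. closed_form M D' E' \<and> form_extends D0 E0 D' E' \<longrightarrow> form_extends D E D' E')"

text \<open>Strongly continuous semigroups of symmetric contractions on \<open>L\<^sup>2(M)\<close>, acting on
  representatives; \<open>P t\<close> is relevant only for \<open>t > 0\<close>.\<close>

definition L2_semigroup :: "'a measure \<Rightarrow> (real \<Rightarrow> ('a \<Rightarrow> real) \<Rightarrow> 'a \<Rightarrow> real) \<Rightarrow> bool" where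
  "L2_semigroup M P \<longleftrightarrow>
     (\<forall>t>0. \<forall>f\<in>L2 M. P t f \<in> L2 M \<and> L2_norm M (P t f) \<le> L2_norm M f) \<and>
     (\<forall>t>0. \<forall>f\<in>L2 M. \<forall>g\<in>L2 M. (AE x in M. f x = g x) \<longrightarrow> (AE x in M. P t f x = P t g x)) \<and>
     (\<forall>t>0. \<forall>f\<in>L2 M. \<forall>g\<in>L2 M. \<forall>a b.
        AE x in M. P t (\<lambda>y. a * f y + b * g y) x = a * P t f x + b * P t g x) \<and>
     (\<forall>t>0. \<forall>f\<in>L2 M. \<forall>g\<in>L2 M. L2_inner M (P t f) g = L2_inner M f (P t g)) \<and>
     (\<forall>s>0. \<forall>t>0. \<forall>f\<in>L2 M. AE x in M. P (s + t) f x = P s (P t f) x) \<and>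
     (\<forall>f\<in>L2 M. ((\<lambda>t. L2_norm M (\<lambda>x. P t f x - f x)) \<longlongrightarrow> 0) (at_right 0))"

text \<open>\<open>L2_generator M P f w\<close>: \<open>f\<close> lies in the domain of the generator \<open>A\<close> of \<open>P\<close>, and \<open>A f = w\<close>.\<close>

definition L2_generator ::
    "'a measure \<Rightarrow> (real \<Rightarrow> ('a \<Rightarrow> real) \<Rightarrow> 'a \<Rightarrow> real) \<Rightarrow> ('a \<Rightarrow> real) \<Rightarrow> ('a \<Rightarrow> real) \<Rightarrow> bool" where
  "L2_generator M P f w \<longleftrightarrow> f \<in> L2 M \<and> w \<in> L2 M \<and>
     ((\<lambda>t. L2_norm M (\<lambda>x. (P t f x - f x) / t - w x)) \<longlongrightarrow> 0) (at_right 0)"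

text \<open>The correspondence between closed forms and semigroups: the domain of the generator \<open>A\<close> is
  contained in \<open>D\<close>, and \<open>E(f, g) = \<langle>- A f, g\<rangle>\<close> for \<open>f\<close> in the domain of \<open>A\<close> and \<open>g \<in> D\<close>. For a
  closed form this determines the semigroup uniquely (Fukushima, Oshima and Takeda,
  Section 1.3).\<close>

definition form_semigroup ::
    "'a measure \<Rightarrow> ('a \<Rightarrow> real) set \<Rightarrow> 'a form \<Rightarrow> (real \<Rightarrow> ('a \<Rightarrow> real) \<Rightarrow> 'a \<Rightarrow> real) \<Rightarrow> bool" where
  "form_semigroup M D E P \<longleftrightarrow> L2_semigroup M P \<and>
     (\<forall>f w. L2_generator M P f w \<longrightarrow> f \<in> D \<and> (\<forall>g\<in>D. E f g = - L2_inner M w g))"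

definition markovian_form :: "'a measure \<Rightarrow> ('a \<Rightarrow> real) set \<Rightarrow> 'a form \<Rightarrow> bool" where
  "markovian_form M D E \<longleftrightarrow> (\<exists>P. form_semigroup M D E P \<and>
     (\<forall>t>0. \<forall>f\<in>L2 M. (AE x in M. 0 \<le> f x \<and> f x \<le> 1) \<longrightarrow>
        (AE x in M. 0 \<le> P t f x \<and> P t f x \<le> 1)))"

section \<open>The rotationally invariant stable law\<close>

definition stable_const :: "real \<Rightarrow> nat \<Rightarrow> real" where
  "stable_const \<alpha> d =
     (- \<alpha> * (\<alpha> - 1) * Gamma ((\<alpha> + real d) / 2)) /
     (4 * cos (\<alpha> * pi / 2) * Gamma ((\<alpha> + 1) / 2) * pi powr ((real d - 1) / 2) * Gamma (2 - \<alpha>))"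

definition levy_nu :: "real \<Rightarrow> (real^'n::finite) measure" where
  "levy_nu \<alpha> = density lborel
     (\<lambda>u. ennreal (stable_const \<alpha> CARD('n) * norm u powr (- real CARD('n) - \<alpha>)))"

definition borel_prob :: "'a::topological_space measure \<Rightarrow> bool" where
  "borel_prob M \<longleftrightarrow> prob_space M \<and> sets M = sets borel"

text \<open>The characteristic function determines the measure, so there is only one such \<open>M\<close>.\<close>

definition rot_stable :: "real \<Rightarrow> (real^'n::finite) measure \<Rightarrow> bool" where
  "rot_stable \<alpha> M \<longleftrightarrow> borel_prob M \<and>
     (\<forall>\<xi>. (LINT x|M. iexp (\<xi> \<bullet> x)) = complex_of_real (exp (- (norm \<xi> powr \<alpha>) / 2)))"

definition stable_form :: "real \<Rightarrow> (real^'n::finite) measure \<Rightarrow> (real^'n) form" where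
  "stable_form \<alpha> \<mu> f g =
     (LINT x|\<mu>. (LINT u|levy_nu \<alpha>. (f (x + u) - f x) * (g (x + u) - g x)))"

text \<open>\<open>\<mu> * \<nu> \<lless> \<mu>\<close>; the set \<open>{u. x + u \<in> B}\<close> is \<open>B - x\<close>.\<close>

definition conv_abs_cont :: "(real^'n::finite) measure \<Rightarrow> (real^'n) measure \<Rightarrow> bool" where
  "conv_abs_cont \<mu> \<nu> \<longleftrightarrow>
     (\<forall>B\<in>sets borel. emeasure \<mu> B = 0 \<longrightarrow> (\<integral>\<^sup>+x. emeasure \<nu> {u. x + u \<in> B} \<partial>\<mu>) = 0)"

section \<open>Truncated coordinates and the distance\<close>

definition gauss_cutoff :: "real^'n::finite \<Rightarrow> real" where
  "gauss_cutoff x = exp (- (norm x)\<^sup>2)"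

definition trunc_coord :: "(real^'n::finite) measure \<Rightarrow> real \<Rightarrow> 'n \<Rightarrow> real^'n \<Rightarrow> real" where
  "trunc_coord \<mu> R j x =
     x $ j * gauss_cutoff (x /\<^sub>R R) - (LINT y|\<mu>. y $ j * gauss_cutoff (y /\<^sub>R R))"

definition H1 :: "('a::real_inner \<Rightarrow> real) set" where
  "H1 = {h. (\<forall>x. \<bar>h x\<bar> \<le> 1) \<and>
     (\<exists>g. (\<forall>x. GDERIV h x :> g x) \<and> continuous_on UNIV g \<and> (\<forall>x. norm (g x) \<le> 1))}"

definition d_W1 :: "'a::real_inner measure \<Rightarrow> 'a measure \<Rightarrow> real" where
  "d_W1 M N = (SUP h\<in>H1. \<bar>(LINT x|M. h x) - (LINT x|N. h x)\<bar>)"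

end

theory Submission
  imports Defs
begin

text \<open>The Poincare inequality makes \<open>Q(f) = U E(f, f) - Var f\<close> a non-negative quadratic form, and (b)
  says that the truncated coordinates asymptotically minimize it. By Cauchy-Schwarz for \<open>Q\<close>, its
  polarization against them vanishes in the limit; tested with \<open>cos (\<xi> \<bullet> x + \<theta>)\<close>, cut off at the same
  scale, this is the Stein identity
  \<open>\<integral> x\<^sub>j f d\<mu> = U \<integral>\<integral> u\<^sub>j (f (x + u) - f x) \<nu>(du) \<mu>(dx)\<close>. Along each ray it is a linear differential
  equation for the characteristic function of \<open>\<mu>\<close>, whose solution is \<open>exp (- U |\<xi>|\<^sup>\<alpha> / 2)\<close>. So
  \<open>\<mu>\<close> is the law of \<open>U\<^sup>1\<^sup>/\<^sup>\<alpha> X\<close> with \<open>X\<close> distributed according to \<open>\<mu>\<^sub>\<alpha>\<close>, and the distance is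
  at most \<open>|U\<^sup>1\<^sup>/\<^sup>\<alpha> - 1| \<^bold>E |X| \<le> |U - 1| \<^bold>E |X|\<close>.\<close>

section \<open>Gaussian integrals\<close>

text \<open>The integral formula for the form is available on Schwartz functions, so coordinates and
  cosines both have to be cut off, and every bound must survive the removal of the cutoff. A cut off
  cosine has increments of order \<open>min 1 (norm u)\<close>, but those of a cut off coordinate
  are, uniformly in the cutoff, only of order \<open>norm u\<close>. Their product is at most a
  multiple of \<open>norm u * min 1 (norm u)\<close>, whose integrability against
  \<open>levy_nu \<alpha>\<close> rests on both \<open>1 < \<alpha>\<close> and
  \<open>\<alpha> < 2\<close>. The factor one half in the exponent comes from the value of
  \<open>stable_const\<close>. It is evaluated by writing the power density as a mixture of
  Gaussians, which replaces polar coordinates by Gaussian and Gamma integrals. The first moment of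
  \<open>X\<close> is never computed: a rescaled \<open>\<mu>\<close> is itself a law of
  \<open>X\<close> and inherits its moment from \<open>\<mu>\<close>. The truncated moments in the
  bound add up to a positive number fixed by \<open>\<alpha>\<close> and the dimension, so they can
  be absorbed into the constant.\<close>

lemma gaussian_fourier_real:
  fixes s t :: real
  assumes "0 < s"
  shows "integrable lborel (\<lambda>x. iexp (t * x) * complex_of_real (exp (- s * x\<^sup>2)))"
    and "(LINT x|lborel. iexp (t * x) * complex_of_real (exp (- s * x\<^sup>2))) =
      complex_of_real (sqrt (pi / s) * exp (- t\<^sup>2 / (4 * s)))"
proof -
  \<comment> \<open>Replacing \<open>x\<close> by \<open>c * x\<close> in the standard normal
    density produces the weight \<open>exp (- s * x\<^sup>2)\<close>, so the known characteristic
    function applies at \<open>t / c\<close>.\<close>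
  define c where "c = sqrt (2 * s)"
  have c: "0 < c" "c\<^sup>2 = 2 * s" using assms by (auto simp: c_def)
  have int: "integrable lborel (\<lambda>x. std_normal_density x *\<^sub>R iexp (t / c * x))"
    by (rule Bochner_Integration.integrable_bound[OF integrable_normal_density[of 1 0]]) auto
  have val: "(LINT x|lborel. std_normal_density x *\<^sub>R iexp (t / c * x)) = exp (- ((t / c)^2) / 2)"
    using fun_cong[OF char_std_normal_distribution, of "t / c"]
    unfolding char_def by (subst (asm) integral_density) auto
  have eq: "std_normal_density (0 + c * x) *\<^sub>R iexp (t / c * (0 + c * x)) =
     complex_of_real (1 / sqrt (2 * pi)) * (iexp (t * x) * complex_of_real (exp (- s * x\<^sup>2)))" for x
    using c by (simp add: std_normal_density_def scaleR_conv_of_real power_mult_distrib)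
  define g where "g x = iexp (t * x) * complex_of_real (exp (- s * x\<^sup>2))" for x
  define k where "k = complex_of_real (1 / sqrt (2 * pi))"
  have k: "k \<noteq> 0" "1 / k = complex_of_real (sqrt (2 * pi))" by (auto simp: k_def)
  from lborel_integrable_real_affine[OF int, of c 0] c
  have "integrable lborel (\<lambda>x. k * g x)"
    unfolding eq g_def k_def by simp
  from integrable_mult_right[OF this, of "1 / k"] k(1) have "integrable lborel g" by simp
  then show "integrable lborel (\<lambda>x. iexp (t * x) * complex_of_real (exp (- s * x\<^sup>2)))"
    unfolding g_def .
  have "exp (- ((t / c)^2) / 2) = c *\<^sub>R (complex_of_real (1 / sqrt (2 * pi)) * (LINT x|lborel. iexp (t * x) * complex_of_real (exp (- s * x\<^sup>2))))"
    unfolding val[symmetric] using c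
    by (subst lborel_integral_real_affine[of c _ 0]) (simp_all only: eq integral_mult_right_zero, auto)
  then have "(LINT x|lborel. iexp (t * x) * complex_of_real (exp (- s * x\<^sup>2))) =
     complex_of_real (sqrt (2 * pi) / c * exp (- ((t / c)^2) / 2))"
    using c by (simp add: scaleR_conv_of_real field_simps)
  also have "sqrt (2 * pi) / c = sqrt (pi / s)"
    using assms by (simp add: c_def real_sqrt_divide real_sqrt_mult)
  also have "- ((t / c)^2) / 2 = - t\<^sup>2 / (4 * s)"
    using c by (simp add: power_divide)
  finally show "(LINT x|lborel. iexp (t * x) * complex_of_real (exp (- s * x\<^sup>2))) =
      complex_of_real (sqrt (pi / s) * exp (- t\<^sup>2 / (4 * s)))" .
qed

lemma norm_sq_Basis: "(norm (x::'a::euclidean_space))\<^sup>2 = (\<Sum>b\<in>Basis. (x \<bullet> b)\<^sup>2)"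
  unfolding power2_norm_eq_inner by (subst euclidean_inner) (simp add: power2_eq_square)

text \<open>The integrand factors over the coordinates, and \<open>lborel\<close> is the image of a
  product of one-dimensional Lebesgue measures.\<close>

lemma gaussian_fourier:
  fixes \<xi> :: "'a::euclidean_space" and s :: real
  assumes "0 < s"
  shows "integrable lborel (\<lambda>x. iexp (\<xi> \<bullet> x) * complex_of_real (exp (- s * (norm x)\<^sup>2)))"
    and "(LINT x|lborel. iexp (\<xi> \<bullet> x) * complex_of_real (exp (- s * (norm x)\<^sup>2))) =
      complex_of_real ((pi / s) powr (DIM('a) / 2) * exp (- (norm \<xi>)\<^sup>2 / (4 * s)))"
proof -
  define f where "f b y = iexp ((\<xi> \<bullet> b) * y) * complex_of_real (exp (- s * y\<^sup>2))" for b y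
  interpret product_sigma_finite "\<lambda>_::'a. lborel :: real measure" ..
  have intf: "integrable lborel (f b)" for b
    unfolding f_def by (rule gaussian_fourier_real[OF assms])
  have eq: "iexp (\<xi> \<bullet> x) * complex_of_real (exp (- s * (norm x)\<^sup>2)) = (\<Prod>b\<in>Basis. f b (x \<bullet> b))" for x :: 'a
    unfolding f_def prod.distrib
    by (simp add: euclidean_inner[of \<xi> x] norm_sq_Basis sum_distrib_left exp_sum
        flip: sum_negf of_real_prod)
  have inner: "(\<Sum>b\<in>Basis. h b *\<^sub>R b) \<bullet> c = h c" if "c \<in> Basis" for h and c :: 'a
    using that by simp
  have meas: "(\<lambda>x. \<Prod>b\<in>Basis. f b (x \<bullet> b)) \<in> borel_measurable (borel :: 'a measure)"
    unfolding f_def by measurable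
  have pe: "(\<Prod>b\<in>Basis. f b ((\<Sum>b\<in>Basis. h b *\<^sub>R b) \<bullet> b)) = (\<Prod>b\<in>Basis. f b (h b))" for h :: "'a \<Rightarrow> real"
    by (intro prod.cong) auto
  show "integrable lborel (\<lambda>x. iexp (\<xi> \<bullet> x) * complex_of_real (exp (- s * (norm x)\<^sup>2)))"
    unfolding eq
    by (subst lborel_eq, subst integrable_distr_eq)
       (use meas product_integrable_prod[of Basis f] intf in \<open>auto simp: pe\<close>)
  have "(LINT x|lborel. iexp (\<xi> \<bullet> x) * complex_of_real (exp (- s * (norm x)\<^sup>2))) =
     (\<Prod>b\<in>Basis. LINT y|lborel. f b y)"
    unfolding eq
    by (subst lborel_eq, subst integral_distr)
       (use meas product_integral_prod[of Basis f] intf in \<open>auto simp: pe\<close>)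
  also have "\<dots> = (\<Prod>b\<in>(Basis::'a set). complex_of_real (sqrt (pi / s) * exp (- (\<xi> \<bullet> b)\<^sup>2 / (4 * s))))"
    unfolding f_def gaussian_fourier_real[OF assms] ..
  also have "\<dots> = complex_of_real (\<Prod>b\<in>(Basis::'a set). (sqrt (pi / s) * exp (- (\<xi> \<bullet> b)\<^sup>2 / (4 * s))))"
    by simp
  also have "(\<Prod>b\<in>(Basis::'a set). (sqrt (pi / s) * exp (- (\<xi> \<bullet> b)\<^sup>2 / (4 * s)))) =
      sqrt (pi / s) ^ DIM('a) * exp (- (norm \<xi>)\<^sup>2 / (4 * s))"
    by (simp add: prod.distrib exp_sum norm_sq_Basis sum_divide_distrib flip: sum_negf)
  also have "sqrt (pi / s) ^ DIM('a) = (pi / s) powr (DIM('a) / 2)"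
    using assms by (simp add: powr_half_sqrt[symmetric] powr_realpow[symmetric] powr_powr)
  finally show "(LINT x|lborel. iexp (\<xi> \<bullet> x) * complex_of_real (exp (- s * (norm x)\<^sup>2))) =
      complex_of_real ((pi / s) powr (DIM('a) / 2) * exp (- (norm \<xi>)\<^sup>2 / (4 * s)))" .
qed

lemma gaussian_cos_integral:
  fixes \<xi> :: "'a::euclidean_space" and s :: real
  assumes "0 < s"
  shows "integrable lborel (\<lambda>x. cos (\<xi> \<bullet> x) * exp (- s * (norm x)\<^sup>2))"
    and "(LINT x|lborel. cos (\<xi> \<bullet> x) * exp (- s * (norm x)\<^sup>2)) =
      (pi / s) powr (DIM('a) / 2) * exp (- (norm \<xi>)\<^sup>2 / (4 * s))"
proof -
  have eq: "cos (\<xi> \<bullet> x) * exp (- s * (norm x)\<^sup>2) =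
      Re (iexp (\<xi> \<bullet> x) * complex_of_real (exp (- s * (norm x)\<^sup>2)))" for x
    by (simp add: cis_conv_exp[symmetric] mult.commute)
  show "integrable lborel (\<lambda>x. cos (\<xi> \<bullet> x) * exp (- s * (norm x)\<^sup>2))"
    unfolding eq by (intro integrable_Re gaussian_fourier assms)
  show "(LINT x|lborel. cos (\<xi> \<bullet> x) * exp (- s * (norm x)\<^sup>2)) =
      (pi / s) powr (DIM('a) / 2) * exp (- (norm \<xi>)\<^sup>2 / (4 * s))"
    unfolding eq by (subst integral_Re) (simp_all only: gaussian_fourier[OF assms] Re_complex_of_real)
qed

lemma gaussian_integral:
  fixes s :: real
  assumes "0 < s"
  shows "integrable lborel (\<lambda>x::'a::euclidean_space. exp (- s * (norm x)\<^sup>2))"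
    and "(LINT x|lborel. exp (- s * (norm (x::'a))\<^sup>2)) = (pi / s) powr (DIM('a) / 2)"
  using gaussian_cos_integral[OF assms, of "0::'a"] by auto

section \<open>Normalization of the stable Levy measure\<close>

text \<open>Read from right to left, with \<open>r\<close> a squared norm, this expresses a negative
  power as a mixture of Gaussians. Nonnegative integrals are used so that orders of integration can
  be exchanged freely afterwards.\<close>

lemma nn_integral_Gamma_scaled:
  fixes a r :: real
  assumes "0 < a" "0 < r"
  shows "(\<integral>\<^sup>+t. ennreal (indicator {0<..} t * (t powr (a - 1) * exp (- r * t))) \<partial>lborel) =
    ennreal (Gamma a * r powr (- a))"
proof -
  have "ennreal (Gamma a) = (\<integral>\<^sup>+t. ennreal (indicator {0..} t * t powr (a - 1) / exp t) \<partial>lborel)"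
    by (rule Gamma_conv_nn_integral_real[OF assms(1)])
  also have "\<dots> = ennreal \<bar>r\<bar> * (\<integral>\<^sup>+t. ennreal (indicator {0..} (0 + r * t) * (0 + r * t) powr (a - 1) / exp (0 + r * t)) \<partial>lborel)"
    using assms by (intro nn_integral_real_affine) auto
  also have "(\<integral>\<^sup>+t. ennreal (indicator {0..} (0 + r * t) * (0 + r * t) powr (a - 1) / exp (0 + r * t)) \<partial>lborel) =
     (\<integral>\<^sup>+t. ennreal (r powr (a - 1)) * ennreal (indicator {0<..} t * (t powr (a - 1) * exp (- r * t))) \<partial>lborel)"
    using assms
    by (intro nn_integral_cong)
       (auto simp: indicator_def powr_mult exp_minus field_simps zero_le_mult_iff simp flip: ennreal_mult)
  also have "\<dots> = ennreal (r powr (a - 1)) * (\<integral>\<^sup>+t. ennreal (indicator {0<..} t * (t powr (a - 1) * exp (- r * t))) \<partial>lborel)"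
    by (intro nn_integral_cmult) auto
  finally have *: "ennreal (Gamma a) = ennreal (r powr a) * (\<integral>\<^sup>+t. ennreal (indicator {0<..} t * (t powr (a - 1) * exp (- r * t))) \<partial>lborel)"
    using assms by (simp add: powr_diff flip: mult.assoc ennreal_mult)
  have "ennreal (Gamma a * r powr (- a)) = ennreal (r powr (- a)) * ennreal (Gamma a)"
    using assms by (simp add: mult.commute flip: ennreal_mult)
  also have "\<dots> = ennreal (r powr (- a) * r powr a) * (\<integral>\<^sup>+t. ennreal (indicator {0<..} t * (t powr (a - 1) * exp (- r * t))) \<partial>lborel)"
    unfolding * by (simp add: ennreal_mult mult.assoc)
  finally show ?thesis using assms by (simp flip: powr_add)
qed

text \<open>The substitution \<open>t = 1 / s\<close> in the Gamma integral.\<close>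

lemma nn_integral_inverse_Gamma:
  fixes a r :: real
  assumes "0 < a" "0 < r"
  shows "(\<integral>\<^sup>+s. ennreal (indicator {0<..} s * (s powr (- a - 1) * exp (- r / s))) \<partial>lborel) =
    ennreal (Gamma a * r powr (- a))"
proof -
  define f where "f t = t powr (a - 1) * exp (- r * t)" for t
  have hbi: "has_bochner_integral lborel (\<lambda>t. indicator {0<..} t * f t) (Gamma a * r powr (- a))"
    using nn_integral_Gamma_scaled[OF assms] assms
    by (intro has_bochner_integral_nn_integral) (auto simp: f_def less_imp_le)
  then have si: "set_integrable lborel {0<..} f"
    by (auto simp: set_integrable_def has_bochner_integral_iff)
  have ai: "f absolutely_integrable_on {0<..}"
    using si by (simp add: set_integrable_def integrable_completion f_def)
  have "integral {0<..} f = Gamma a * r powr (- a)"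
    using set_borel_integral_eq_integral(2)[OF si] hbi
    by (simp add: set_lebesgue_integral_def has_bochner_integral_iff)
  moreover have img: "(\<lambda>s. 1 / s :: real) ` {0<..} = {0<..}"
    by (auto simp: image_iff intro!: bexI[of _ "1 / x" for x])
  moreover have "inj_on (\<lambda>s. 1 / s :: real) {0<..}" by (auto simp: inj_on_def)
  ultimately have "(\<lambda>s. \<bar>- (1 / s\<^sup>2)\<bar> * f (1 / s)) absolutely_integrable_on {0<..} \<and>
     integral {0<..} (\<lambda>s. \<bar>- (1 / s\<^sup>2)\<bar> * f (1 / s)) = Gamma a * r powr (- a)"
    using ai
    by (subst has_absolute_integral_change_of_variables_1'[where g="\<lambda>s. 1 / s"])
       (auto intro!: derivative_eq_intros simp: power2_eq_square)
  then have hi: "((\<lambda>s. \<bar>- (1 / s\<^sup>2)\<bar> * f (1 / s)) has_integral (Gamma a * r powr (- a))) {0<..}"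
    by (auto simp: has_integral_iff set_lebesgue_integral_eq_integral)
  have "(\<integral>\<^sup>+s. ennreal (indicator {0<..} s * (\<bar>- (1 / s\<^sup>2)\<bar> * f (1 / s))) \<partial>lborel) = ennreal (Gamma a * r powr (- a))"
    by (rule nn_integral_has_integral_lebesgue[OF _ hi]) (auto simp: f_def)
  moreover have "\<bar>- (1 / s\<^sup>2)\<bar> * f (1 / s) = s powr (- a - 1) * exp (- r / s)" if "0 < s" for s
  proof -
    have "(1 / s) powr (a - 1) = s powr (1 - a)"
      using that by (simp add: powr_def ln_div algebra_simps)
    moreover have "1 / s\<^sup>2 = s powr (- 2)"
      using that by (simp add: powr_minus powr_numeral inverse_eq_divide)
    moreover have "- 2 + (1 - a) = - a - 1" by simp
    then have "s powr (- 2) * s powr (1 - a) = s powr (- a - 1)"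
      by (simp only: powr_add[symmetric])
    ultimately show ?thesis by (simp add: f_def mult.assoc[symmetric])
  qed
  then have "indicator {0<..} s * (\<bar>- (1 / s\<^sup>2)\<bar> * f (1 / s)) = indicator {0<..} s * (s powr (- a - 1) * exp (- r / s))" for s
    by (auto simp: indicator_def)
  ultimately show ?thesis by simp
qed

text \<open>Write \<open>1 - exp (- b / s)\<close> as the integral of
  \<open>exp (- r / s) / s\<close> over \<open>r\<close> from 0 to \<open>b\<close> and exchange the
  integrals. The \<open>s\<close>-integral is then an inverse Gamma integral with parameter
  \<open>1 - a\<close>, and a power of \<open>r\<close> remains.\<close>

lemma nn_integral_powr_one_minus_exp:
  fixes a b :: real
  assumes "0 < a" "a < 1" "0 \<le> b"
  shows "(\<integral>\<^sup>+s. ennreal (indicator {0<..} s * (s powr (a - 1) * (1 - exp (- b / s)))) \<partial>lborel) =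
    ennreal (Gamma (1 - a) / a * b powr a)"
proof -
  define h where "h s r = ennreal (indicator {0<..} s * (s powr (- (1 - a) - 1) * exp (- r / s)))" for s r :: real
  have [measurable]: "case_prod h \<in> borel_measurable (lborel \<Otimes>\<^sub>M lborel)"
    unfolding h_def by measurable
  have inner: "ennreal (indicator {0<..} s * (s powr (a - 1) * (1 - exp (- b / s)))) =
     (\<integral>\<^sup>+r. h s r * indicator {0..b} r \<partial>lborel)" for s
  proof (cases "0 < s")
    case True
    have "(\<integral>\<^sup>+r. ennreal (s powr (a - 2) * exp (- r / s)) * indicator {0..b} r \<partial>lborel) =
       ennreal (- (s powr (a - 1) * exp (- b / s)) - - (s powr (a - 1) * exp (- 0 / s)))"
      using assms True
      by (intro nn_integral_FTC_Icc)
         (auto intro!: derivative_eq_intros simp: powr_diff power2_eq_square field_simps)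
    then show ?thesis using True by (simp add: h_def algebra_simps)
  qed (simp add: h_def)
  have "(\<integral>\<^sup>+s. ennreal (indicator {0<..} s * (s powr (a - 1) * (1 - exp (- b / s)))) \<partial>lborel) =
     (\<integral>\<^sup>+r. (\<integral>\<^sup>+s. h s r * indicator {0..b} r \<partial>lborel) \<partial>lborel)"
    unfolding inner by (rule lborel_pair.Fubini'[symmetric]) measurable
  also have "\<dots> = (\<integral>\<^sup>+r. ennreal (Gamma (1 - a)) * ennreal (indicator {0..b} r * r powr (a - 1)) \<partial>lborel)"
    \<comment> \<open>The inverse Gamma formula is for positive \<open>r\<close>; the endpoint 0 is
      a null set.\<close>
    using AE_lborel_singleton[of "0::real"]
  proof (intro nn_integral_cong_AE, eventually_elim)
    fix r :: real assume "r \<noteq> 0"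
    show "(\<integral>\<^sup>+s. h s r * indicator {0..b} r \<partial>lborel) = ennreal (Gamma (1 - a)) * ennreal (indicator {0..b} r * r powr (a - 1))"
    proof (cases "r \<in> {0..b}")
      case True
      then have "0 < r" using \<open>r \<noteq> 0\<close> by auto
      with nn_integral_inverse_Gamma[of "1 - a" r] assms True show ?thesis
        by (simp add: h_def ennreal_mult)
    qed simp
  qed
  also have "\<dots> = ennreal (Gamma (1 - a)) * (\<integral>\<^sup>+r. ennreal (indicator {0..b} r * r powr (a - 1)) \<partial>lborel)"
    by (intro nn_integral_cmult) auto
  also have "(\<integral>\<^sup>+r. ennreal (indicator {0..b} r * r powr (a - 1)) \<partial>lborel) = ennreal (b powr a / a)"
    using nn_integral_has_integral_lebesgue[OF _ has_integral_powr_from_0[of "a - 1" b]] assms by simp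
  finally show ?thesis using assms by (simp flip: ennreal_mult)
qed

section \<open>Gamma identities and the value of the stable constant\<close>

lemma Gamma_duplication_real:
  fixes x :: real
  assumes "0 < x"
  shows "Gamma x * Gamma (x + 1 / 2) = 2 powr (1 - 2 * x) * sqrt pi * Gamma (2 * x)"
proof -
  have "complex_of_real (Gamma x * Gamma (x + 1 / 2)) =
      Gamma (complex_of_real x) * Gamma (complex_of_real x + 1 / 2)"
    by (simp flip: Gamma_complex_of_real)
  also have "\<dots> = exp ((1 - 2 * complex_of_real x) * of_real (ln 2)) * of_real (sqrt pi) * Gamma (2 * complex_of_real x)"
    using assms by (intro Gamma_legendre_duplication) (auto elim!: nonpos_Ints_cases simp: complex_eq_iff)
  also have "\<dots> = complex_of_real (2 powr (1 - 2 * x) * sqrt pi * Gamma (2 * x))"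
    by (simp add: powr_def mult.commute flip: Gamma_complex_of_real exp_of_real)
  finally show ?thesis by (simp only: of_real_eq_iff)
qed

lemma Gamma_reflection_real:
  fixes x :: real
  shows "Gamma x * Gamma (1 - x) = pi / sin (pi * x)"
proof -
  have "complex_of_real (Gamma x * Gamma (1 - x)) = Gamma (complex_of_real x) * Gamma (1 - complex_of_real x)"
    by (simp flip: Gamma_complex_of_real)
  also have "\<dots> = complex_of_real (pi / sin (pi * x))"
    unfolding Gamma_reflection_complex by (simp flip: sin_of_real)
  finally show ?thesis by (simp only: of_real_eq_iff)
qed

lemma cos_half_pi_neg:
  assumes "1 < \<alpha>" "\<alpha> < 2"
  shows "cos (\<alpha> * pi / 2) < 0"
proof -
  have "0 < sin ((\<alpha> - 1) * pi / 2)"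
    using assms by (intro sin_gt_zero) auto
  also have "sin ((\<alpha> - 1) * pi / 2) = sin (\<alpha> * pi / 2 - pi / 2)"
    by (simp add: algebra_simps diff_divide_distrib)
  also have "\<dots> = - cos (\<alpha> * pi / 2)" by (simp add: sin_diff)
  finally show ?thesis by simp
qed

text \<open>The cosine in the denominator and \<open>- \<alpha> * (\<alpha> - 1)\<close> in the
  numerator are both negative.\<close>

lemma stable_const_pos:
  assumes "1 < \<alpha>" "\<alpha> < 2"
  shows "0 < stable_const \<alpha> d"
proof -
  have "0 < 4 * Gamma ((\<alpha> + 1) / 2) * pi powr ((real d - 1) / 2) * Gamma (2 - \<alpha>)"
    using assms by simp
  then have "4 * Gamma ((\<alpha> + 1) / 2) * pi powr ((real d - 1) / 2) * Gamma (2 - \<alpha>) * cos (\<alpha> * pi / 2) < 0"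
    using cos_half_pi_neg[OF assms] by (rule mult_pos_neg)
  moreover have "- \<alpha> * (\<alpha> - 1) * Gamma ((\<alpha> + real d) / 2) < 0"
    using assms by (simp add: mult_pos_pos)
  ultimately show ?thesis
    unfolding stable_const_def by (intro divide_neg_neg) (simp_all only: mult_ac)
qed

text \<open>The left side is what the computation of the Levy exponent leaves at a unit vector: the
  constant, the Gaussian integral over the Gamma factor of the mixture, the value of the integral
  over \<open>s\<close>, and a power of the \<open>1 / 4\<close> in the Fourier transform of a
  Gaussian. Reflection at \<open>(\<alpha> + 1) / 2\<close> and duplication at
  \<open>1 - \<alpha> / 2\<close> eliminate the Gamma functions.\<close>

lemma stable_const_normalization:
  assumes "1 < \<alpha>" "\<alpha> < 2"
  shows "stable_const \<alpha> d * (pi powr (d / 2) / Gamma ((\<alpha> + real d) / 2)) *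
      (Gamma (1 - \<alpha> / 2) / (\<alpha> / 2)) * (1 / 4) powr (\<alpha> / 2) = 1 / 2"
proof -
  define G1 G2 G3 G4 c where "G1 = Gamma ((\<alpha> + 1) / 2)" and "G2 = Gamma ((1 - \<alpha>) / 2)"
    and "G3 = Gamma (1 - \<alpha> / 2)" and "G4 = Gamma (2 - \<alpha>)" and "c = cos (\<alpha> * pi / 2)"
  have c: "c < 0" unfolding c_def by (rule cos_half_pi_neg[OF assms])
  have pos: "0 < G1" "0 < G3" "0 < G4" "0 < Gamma ((\<alpha> + real d) / 2)"
    using assms by (auto simp: G1_def G3_def G4_def)
  have refl: "G1 * G2 = pi / c"
  proof -
    have "sin (pi * ((\<alpha> + 1) / 2)) = sin (\<alpha> * pi / 2 + pi / 2)" by (simp add: field_simps)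
    also have "\<dots> = c" by (simp add: sin_add c_def)
    finally show ?thesis
      using Gamma_reflection_real[of "(\<alpha> + 1) / 2"] by (simp add: G1_def G2_def field_simps)
  qed
  have "Gamma (1 - \<alpha> / 2 + 1 / 2) = Gamma ((1 - \<alpha>) / 2 + 1)" by (simp add: field_simps)
  also have "\<dots> = (1 - \<alpha>) / 2 * G2"
    unfolding G2_def
  proof (rule Gamma_plus1)
    show "(1 - \<alpha>) / 2 \<notin> \<int>\<^sub>\<le>\<^sub>0"
    proof
      assume "(1 - \<alpha>) / 2 \<in> \<int>\<^sub>\<le>\<^sub>0"
      then obtain n where "(1 - \<alpha>) / 2 = of_int n" by (auto elim: nonpos_Ints_cases)
      then have "real_of_int n < 0" "- 1 < real_of_int n" using assms by auto
      then show False by simp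
    qed
  qed
  finally have G: "Gamma (1 - \<alpha> / 2 + 1 / 2) = (1 - \<alpha>) / 2 * G2" .
  have dup: "G3 * ((1 - \<alpha>) / 2 * G2) = 2 powr (\<alpha> - 1) * sqrt pi * G4"
    using Gamma_duplication_real[of "1 - \<alpha> / 2", unfolded G] assms
    by (simp add: G3_def G4_def algebra_simps)
  have p4: "(1 / 4 :: real) powr (\<alpha> / 2) = 2 powr (- \<alpha>)"
  proof -
    have "(1 / 4 :: real) = 2 powr (- 2)" by (simp add: powr_minus powr_numeral)
    then show ?thesis by (simp only: powr_powr) simp
  qed
  have ppi: "pi powr (real d / 2) = pi powr ((real d - 1) / 2) * sqrt pi"
    by (simp add: powr_half_sqrt[symmetric] diff_divide_distrib flip: powr_add)
  have p2: "2 powr (- \<alpha>) * 2 powr (\<alpha> - 1) = (1 / 2 :: real)"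
    by (simp flip: powr_add)
  \<comment> \<open>Multiplied by \<open>c * G1\<close>, the duplication formula meets the
    reflection formula: \<open>c * (G1 * G2)\<close> is \<open>pi\<close>, split as
    \<open>sqrt pi * sqrt pi\<close> so that one root cancels.\<close>
  have key: "(1 - \<alpha>) * sqrt pi * G3 * 2 powr (- \<alpha>) = c * G1 * G4"
  proof -
    have "c * G1 * (G3 * ((1 - \<alpha>) / 2 * G2)) * 2 powr (- \<alpha>) =
        c * G1 * (2 powr (\<alpha> - 1) * sqrt pi * G4) * 2 powr (- \<alpha>)" using dup by simp
    also have "\<dots> = c * G1 * G4 * sqrt pi * (2 powr (- \<alpha>) * 2 powr (\<alpha> - 1))" by simp
    also have "\<dots> = c * G1 * G4 * sqrt pi / 2" unfolding p2 by simp
    also have "c * G1 * (G3 * ((1 - \<alpha>) / 2 * G2)) * 2 powr (- \<alpha>) =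
        (c * (G1 * G2)) * (G3 * ((1 - \<alpha>) / 2)) * 2 powr (- \<alpha>)" by simp
    also have "c * (G1 * G2) = sqrt pi * sqrt pi" using refl c by simp
    finally have "sqrt pi * ((1 - \<alpha>) * sqrt pi * G3 * 2 powr (- \<alpha>)) = sqrt pi * (c * G1 * G4)"
      by algebra
    then show ?thesis by (simp only: mult_cancel_left) simp
  qed
  have "stable_const \<alpha> d * (pi powr (d / 2) / Gamma ((\<alpha> + real d) / 2)) *
      (Gamma (1 - \<alpha> / 2) / (\<alpha> / 2)) * (1 / 4) powr (\<alpha> / 2) =
      ((1 - \<alpha>) * sqrt pi * G3 * 2 powr (- \<alpha>)) / (2 * c * G1 * G4)"
  proof -
    \<comment> \<open>The factors that depend on the dimension, \<open>g\<close> and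
      \<open>P\<close>, drop out.\<close>
    have alg: "- \<alpha> * (\<alpha> - 1) * g / (4 * c * G1 * P * G4) * (P * r / g) * (G3 / (\<alpha> / 2)) * t =
        ((1 - \<alpha>) * r * G3 * t) / (2 * c * G1 * G4)" if "g \<noteq> 0" "P \<noteq> 0" for g P r t
      using that pos c assms by (simp add: divide_simps) (simp add: algebra_simps)
    show ?thesis
      using alg[of "Gamma ((\<alpha> + real d) / 2)" "pi powr ((real d - 1) / 2)"] pos(4)
      by (simp add: stable_const_def p4 ppi G1_def G3_def G4_def c_def)
  qed
  also have "\<dots> = 1 / 2" unfolding key using pos c by simp
  finally show ?thesis .
qed

text \<open>This is the minimum of \<open>norm u\<close> and its square. It dominates, up to
  constants, the product of an increment of a bounded Lipschitz function with one of a merely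
  Lipschitz function.\<close>

definition levy_weight :: "'a::real_normed_vector \<Rightarrow> real" where
  "levy_weight u = norm u * min 1 (norm u)"

lemma levy_weight_nonneg [simp]: "0 \<le> levy_weight u"
  by (simp add: levy_weight_def)

lemma borel_measurable_levy_weight [measurable]: "levy_weight \<in> borel_measurable borel"
  unfolding levy_weight_def by measurable

lemma power2_powr:
  fixes x :: real
  assumes "0 \<le> x"
  shows "x\<^sup>2 powr a = x powr (2 * a)"
  using assms powr_powr[of x 2 a] by (cases "x = 0") auto

lemma exp_mult_half_gaussian:
  "exp (- s * (norm u)\<^sup>2) * exp (s / 2 * (norm u)\<^sup>2) = exp (- (s / 2) * (norm u)\<^sup>2)"
  by (simp flip: exp_add)

text \<open>Half of the Gaussian absorbs the factor \<open>norm u\<close>: for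
  \<open>y = sqrt s * norm u\<close> one has
  \<open>y \<le> 1 + y\<^sup>2 / 2 \<le> exp (y\<^sup>2 / 2)\<close>.\<close>

lemma norm_gaussian_bound:
  assumes "0 < s"
  shows "norm u * exp (- s * (norm u)\<^sup>2) \<le> s powr (- 1 / 2) * exp (- (s / 2) * (norm u)\<^sup>2)"
proof -
  let ?y = "norm u"
  have "sqrt s * ?y \<le> 1 + (sqrt s * ?y)\<^sup>2 / 2"
    using zero_le_power2[of "sqrt s * ?y - 1"] by (simp add: power2_eq_square algebra_simps)
  also have "\<dots> = 1 + s / 2 * ?y\<^sup>2" using assms by (simp add: power_mult_distrib)
  also have "\<dots> \<le> exp (s / 2 * ?y\<^sup>2)" by (rule exp_ge_add_one_self)
  finally have "?y \<le> s powr (- 1 / 2) * exp (s / 2 * ?y\<^sup>2)"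
    using assms by (simp add: powr_minus powr_half_sqrt field_simps)
  then have "?y * exp (- s * ?y\<^sup>2) \<le> s powr (- 1 / 2) * exp (s / 2 * ?y\<^sup>2) * exp (- s * ?y\<^sup>2)"
    by (rule mult_right_mono) simp
  then show ?thesis
    unfolding exp_mult_half_gaussian[symmetric] by (simp add: mult_ac)
qed

lemma norm_sq_gaussian_bound:
  assumes "0 < s"
  shows "(norm u)\<^sup>2 * exp (- s * (norm u)\<^sup>2) \<le> 2 * s powr (- 1) * exp (- (s / 2) * (norm u)\<^sup>2)"
proof -
  let ?y = "norm u"
  have "?y\<^sup>2 * s = 2 * (s / 2 * ?y\<^sup>2)" by simp
  also have "\<dots> \<le> 2 * exp (s / 2 * ?y\<^sup>2)"
    using exp_ge_add_one_self[of "s / 2 * ?y\<^sup>2"] by linarith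
  finally have "?y\<^sup>2 * s \<le> 2 * exp (s / 2 * ?y\<^sup>2)" .
  then have "?y\<^sup>2 \<le> 2 * s powr (- 1) * exp (s / 2 * ?y\<^sup>2)"
    using assms by (simp add: powr_minus field_simps)
  then have "?y\<^sup>2 * exp (- s * ?y\<^sup>2) \<le> 2 * s powr (- 1) * exp (s / 2 * ?y\<^sup>2) * exp (- s * ?y\<^sup>2)"
    by (rule mult_right_mono) simp
  then show ?thesis
    unfolding exp_mult_half_gaussian[symmetric] by (simp add: mult_ac)
qed

section \<open>The Levy measure as a mixture of Gaussians\<close>

context
  fixes \<alpha> :: real
  assumes \<alpha>: "1 < \<alpha>" "\<alpha> < 2"
begin

lemma norm_powr_conv_gaussian_mixture:
  fixes u :: "'a::euclidean_space"
  assumes "u \<noteq> 0"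
  defines "p \<equiv> (\<alpha> + real DIM('a)) / 2"
  shows "ennreal (norm u powr (- real DIM('a) - \<alpha>)) =
    ennreal (1 / Gamma p) * (\<integral>\<^sup>+s. ennreal (indicator {0<..} s * (s powr (p - 1) * exp (- s * (norm u)\<^sup>2))) \<partial>lborel)"
proof -
  have p: "0 < p" using \<alpha> by (simp add: p_def)
  have "(norm u)\<^sup>2 powr (- p) = norm u powr (- real DIM('a) - \<alpha>)"
  proof -
    have "2 * - p = - real DIM('a) - \<alpha>" by (simp add: p_def field_simps)
    then show ?thesis by (simp only: power2_powr[OF norm_ge_zero])
  qed
  moreover have "0 < Gamma p" using p by simp
  ultimately show ?thesis
    using nn_integral_Gamma_scaled[OF p, of "(norm u)\<^sup>2"] assms(1)
    by (simp add: mult.commute[of "(norm u)\<^sup>2"] flip: ennreal_mult)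
qed

text \<open>Tonelli's theorem applied to the mixture representation of the density. Integrals
  against the Levy measure become Gaussian integrals, followed by an integral over the scale
  \<open>s\<close>.\<close>

lemma nn_integral_levy_nu:
  fixes f :: "real^'n::finite \<Rightarrow> ennreal"
  assumes [measurable]: "f \<in> borel_measurable borel"
  defines "p \<equiv> (\<alpha> + real CARD('n)) / 2"
  shows "(\<integral>\<^sup>+u. f u \<partial>levy_nu \<alpha>) = ennreal (stable_const \<alpha> CARD('n) / Gamma p) *
    (\<integral>\<^sup>+s. ennreal (indicator {0<..} s * s powr (p - 1)) *
       (\<integral>\<^sup>+u. f u * ennreal (exp (- s * (norm u)\<^sup>2)) \<partial>lborel) \<partial>lborel)"
proof -
  let ?c = "stable_const \<alpha> CARD('n)"
  let ?h = "\<lambda>s u. ennreal (indicator {0<..} s * s powr (p - 1)) * (f u * ennreal (exp (- s * (norm u)\<^sup>2)))"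
  have c: "0 < ?c" by (rule stable_const_pos[OF \<alpha>])
  have p: "0 < p" using \<alpha> by (simp add: p_def)
  have G: "0 < Gamma p" using p by simp
  have "(\<integral>\<^sup>+u. f u \<partial>levy_nu \<alpha>) = (\<integral>\<^sup>+u. ennreal (?c * norm u powr (- real CARD('n) - \<alpha>)) * f u \<partial>lborel)"
    unfolding levy_nu_def by (intro nn_integral_density) auto
  also have "\<dots> = (\<integral>\<^sup>+u. ennreal (?c / Gamma p) * (\<integral>\<^sup>+s. ?h s u \<partial>lborel) \<partial>lborel)"
    using AE_lborel_singleton[of "0::real^'n"]
  proof (intro nn_integral_cong_AE, eventually_elim)
    fix u :: "real^'n" assume u: "u \<noteq> 0"
    have "ennreal (?c * norm u powr (- real CARD('n) - \<alpha>)) * f u =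
      ennreal (?c / Gamma p) * ((\<integral>\<^sup>+s. ennreal (indicator {0<..} s * (s powr (p - 1) * exp (- s * (norm u)\<^sup>2))) \<partial>lborel) * f u)"
      using norm_powr_conv_gaussian_mixture[OF u] c G
      by (simp add: p_def[symmetric] ennreal_mult[of ?c] ennreal_mult[of ?c "1 / Gamma p", simplified] mult.assoc)
    also have "(\<integral>\<^sup>+s. ennreal (indicator {0<..} s * (s powr (p - 1) * exp (- s * (norm u)\<^sup>2))) \<partial>lborel) * f u =
       (\<integral>\<^sup>+s. ?h s u \<partial>lborel)"
      by (subst nn_integral_multc[symmetric]) (auto intro!: nn_integral_cong simp: ennreal_mult mult_ac indicator_def)
    finally show "ennreal (?c * norm u powr (- real CARD('n) - \<alpha>)) * f u = ennreal (?c / Gamma p) * (\<integral>\<^sup>+s. ?h s u \<partial>lborel)" .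
  qed
  also have "\<dots> = ennreal (?c / Gamma p) * (\<integral>\<^sup>+u. (\<integral>\<^sup>+s. ?h s u \<partial>lborel) \<partial>lborel)"
    by (intro nn_integral_cmult) measurable
  also have "(\<integral>\<^sup>+u. (\<integral>\<^sup>+s. ?h s u \<partial>lborel) \<partial>lborel) = (\<integral>\<^sup>+s. (\<integral>\<^sup>+u. ?h s u \<partial>lborel) \<partial>lborel)"
    by (rule lborel_pair.Fubini') measurable
  also have "\<dots> = (\<integral>\<^sup>+s. ennreal (indicator {0<..} s * s powr (p - 1)) *
       (\<integral>\<^sup>+u. f u * ennreal (exp (- s * (norm u)\<^sup>2)) \<partial>lborel) \<partial>lborel)"
    by (intro nn_integral_cong nn_integral_cmult) measurable
  finally show ?thesis .
qed

text \<open>For each scale the inner integral is the Fourier transform of a Gaussian at 0 minus its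
  value at \<open>\<xi>\<close>. The remaining integral over \<open>s\<close> is
  \<open>nn_integral_powr_one_minus_exp\<close> with \<open>a = \<alpha> / 2\<close> and
  \<open>b = (norm \<xi>)\<^sup>2 / 4\<close>.\<close>

lemma nn_integral_levy_nu_one_minus_cos:
  fixes \<xi> :: "real^'n::finite"
  shows "(\<integral>\<^sup>+u. ennreal (1 - cos (\<xi> \<bullet> u)) \<partial>levy_nu \<alpha>) = ennreal (norm \<xi> powr \<alpha> / 2)"
proof -
  let ?c = "stable_const \<alpha> CARD('n)"
  define d p b where "d = real CARD('n)" and "p = (\<alpha> + d) / 2" and "b = (norm \<xi>)\<^sup>2 / 4"
  have p: "0 < p" using \<alpha> by (simp add: p_def d_def)
  have G: "0 < Gamma p" using p by simp
  have inner: "ennreal (indicator {0<..} s * s powr (p - 1)) *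
       (\<integral>\<^sup>+u. ennreal (1 - cos (\<xi> \<bullet> u)) * ennreal (exp (- s * (norm u)\<^sup>2)) \<partial>lborel) =
     ennreal (pi powr (d / 2)) * ennreal (indicator {0<..} s * (s powr (\<alpha> / 2 - 1) * (1 - exp (- b / s))))" for s
  proof (cases "0 < s")
    case True
    have "has_bochner_integral lborel (\<lambda>u. exp (- s * (norm u)\<^sup>2) - cos (\<xi> \<bullet> u) * exp (- s * (norm u)\<^sup>2))
        ((pi / s) powr (d / 2) - (pi / s) powr (d / 2) * exp (- b / s))"
      using gaussian_cos_integral[OF True, of \<xi>] gaussian_integral[OF True, where 'a="real^'n"]
      by (intro has_bochner_integral_diff) (simp_all add: has_bochner_integral_iff d_def b_def)
    then have hb: "has_bochner_integral lborel (\<lambda>u. (1 - cos (\<xi> \<bullet> u)) * exp (- s * (norm u)\<^sup>2))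
        ((pi / s) powr (d / 2) * (1 - exp (- b / s)))"
      by (simp add: algebra_simps)
    have "(\<integral>\<^sup>+u. ennreal (1 - cos (\<xi> \<bullet> u)) * ennreal (exp (- s * (norm u)\<^sup>2)) \<partial>lborel) =
       ennreal ((pi / s) powr (d / 2) * (1 - exp (- b / s)))"
      using hb
      by (subst ennreal_mult[symmetric], simp, simp, subst nn_integral_eq_integral)
         (auto simp: has_bochner_integral_iff)
    moreover have "s powr (p - 1) * ((pi / s) powr (d / 2) * (1 - exp (- b / s))) =
       pi powr (d / 2) * (s powr (\<alpha> / 2 - 1) * (1 - exp (- b / s)))"
    proof -
      have "p - 1 = (\<alpha> / 2 - 1) + d / 2" by (simp add: p_def add_divide_distrib)
      then have "s powr (p - 1) = s powr (\<alpha> / 2 - 1) * s powr (d / 2)"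
        by (simp only: powr_add)
      with True show ?thesis by (simp add: powr_divide)
    qed
    moreover have "exp (- b / s) \<le> 1" using True by (simp add: b_def)
    ultimately show ?thesis using True by (simp flip: ennreal_mult)
  qed simp
  have "(\<integral>\<^sup>+u. ennreal (1 - cos (\<xi> \<bullet> u)) \<partial>levy_nu \<alpha>) = ennreal (?c / Gamma p) *
     (\<integral>\<^sup>+s. ennreal (pi powr (d / 2)) * ennreal (indicator {0<..} s * (s powr (\<alpha> / 2 - 1) * (1 - exp (- b / s)))) \<partial>lborel)"
    by (subst nn_integral_levy_nu) (simp_all only: inner[unfolded p_def d_def] p_def d_def, measurable)
  also have "\<dots> = ennreal (?c / Gamma p) * (ennreal (pi powr (d / 2)) * ennreal (Gamma (1 - \<alpha> / 2) / (\<alpha> / 2) * b powr (\<alpha> / 2)))"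
    using nn_integral_powr_one_minus_exp[of "\<alpha> / 2" b] \<alpha>
    by (subst nn_integral_cmult) (auto simp: b_def)
  also have "\<dots> = ennreal (?c / Gamma p * (pi powr (d / 2) * (Gamma (1 - \<alpha> / 2) / (\<alpha> / 2) * b powr (\<alpha> / 2))))"
    using stable_const_pos[OF \<alpha>, of "CARD('n)"] G \<alpha>
    by (simp add: ennreal_mult[symmetric])
  also have "b powr (\<alpha> / 2) = (1 / 4) powr (\<alpha> / 2) * norm \<xi> powr \<alpha>"
  proof -
    have "(norm \<xi>)\<^sup>2 powr (\<alpha> / 2) = norm \<xi> powr \<alpha>"
      by (simp add: power2_powr)
    then show ?thesis unfolding b_def using powr_mult[of "1/4" "(norm \<xi>)\<^sup>2" "\<alpha> / 2"] by simp
  qed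
  also have "?c / Gamma p * (pi powr (d / 2) * (Gamma (1 - \<alpha> / 2) / (\<alpha> / 2) * ((1 / 4) powr (\<alpha> / 2) * norm \<xi> powr \<alpha>))) =
      (?c * (pi powr (d / 2) / Gamma p) * (Gamma (1 - \<alpha> / 2) / (\<alpha> / 2)) * (1 / 4) powr (\<alpha> / 2)) * norm \<xi> powr \<alpha>"
    by simp
  also have "\<dots> = norm \<xi> powr \<alpha> / 2"
    unfolding p_def d_def stable_const_normalization[OF \<alpha>] by simp
  finally show ?thesis .
qed

lemma levy_weight_gaussian_bound:
  fixes u :: "'a::real_normed_vector"
  assumes "0 < s"
  shows "levy_weight u * exp (- s * (norm u)\<^sup>2) \<le> min (s powr (- 1 / 2)) (2 * s powr (- 1)) * exp (- (s / 2) * (norm u)\<^sup>2)"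
proof -
  let ?e = "exp (- s * (norm u)\<^sup>2)" and ?e2 = "exp (- (s / 2) * (norm u)\<^sup>2)"
  have "levy_weight u \<le> norm u" "levy_weight u \<le> (norm u)\<^sup>2"
    using mult_left_mono[of "min 1 (norm u)" 1 "norm u"] mult_left_mono[of "min 1 (norm u)" "norm u" "norm u"]
    by (auto simp: levy_weight_def power2_eq_square)
  then have "levy_weight u * ?e \<le> norm u * ?e" "levy_weight u * ?e \<le> (norm u)\<^sup>2 * ?e"
    by (auto intro: mult_right_mono)
  with norm_gaussian_bound[OF assms, of u] norm_sq_gaussian_bound[OF assms, of u]
  have "levy_weight u * ?e \<le> min (s powr (- 1 / 2) * ?e2) (2 * s powr (- 1) * ?e2)" by linarith
  also have "\<dots> = min (s powr (- 1 / 2)) (2 * s powr (- 1)) * ?e2"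
    by (simp add: min_mult_distrib_right)
  finally show ?thesis .
qed

text \<open>After Gaussian integration the scale \<open>s\<close> contributes at most a multiple of
  \<open>s powr (\<alpha> / 2 - 1) * min (s powr (- 1 / 2)) (2 * s powr (- 1))\<close>. The first
  bound in the minimum is integrable near 0 because \<open>1 < \<alpha>\<close>, the second near
  infinity because \<open>\<alpha> < 2\<close>; \<open>k\<close> joins the two at
  \<open>s = 1\<close>.\<close>

lemma integrable_levy_weight: "integrable (levy_nu \<alpha> :: (real^'n::finite) measure) levy_weight"
proof (rule integrableI_bounded)
  show "levy_weight \<in> borel_measurable (levy_nu \<alpha> :: (real^'n) measure)"
    unfolding levy_nu_def by simp
  define d p where "d = real CARD('n)" and "p = (\<alpha> + d) / 2"
  define k where "k s = indicator {0..1} s * s powr ((\<alpha> - 1) / 2 - 1) + 2 * (indicator {1..} s * s powr (\<alpha> / 2 - 1 - 1))" for s :: real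
  have i1: "integrable lborel (\<lambda>s. indicator {0..1} s * s powr ((\<alpha> - 1) / 2 - 1))"
  proof -
    have "((\<lambda>s. s powr ((\<alpha> - 1) / 2 - 1)) has_integral (1 powr ((\<alpha> - 1) / 2 - 1 + 1) / ((\<alpha> - 1) / 2 - 1 + 1))) {0..1}"
      using \<alpha> by (intro has_integral_powr_from_0) auto
    from nn_integral_has_integral_lebesgue[OF _ this] show ?thesis
      by (intro integrableI_nonneg) auto
  qed
  have i2: "integrable lborel (\<lambda>s. indicator {1..} s * s powr (\<alpha> / 2 - 1 - 1))"
  proof -
    have "((\<lambda>s. s powr (\<alpha> / 2 - 1 - 1)) has_integral - (1 powr (\<alpha> / 2 - 1 - 1 + 1)) / (\<alpha> / 2 - 1 - 1 + 1)) {1..}"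
      using \<alpha> by (intro has_integral_powr_to_inf) auto
    from nn_integral_has_integral_lebesgue[OF _ this] show ?thesis
      by (intro integrableI_nonneg) auto
  qed
  have ik: "integrable lborel k"
    unfolding k_def using i1 i2 by simp
  have inner: "ennreal (indicator {0<..} s * s powr (p - 1)) *
      (\<integral>\<^sup>+u. ennreal (norm (levy_weight (u::real^'n))) * ennreal (exp (- s * (norm u)\<^sup>2)) \<partial>lborel)
      \<le> ennreal ((2 * pi) powr (d / 2)) * ennreal (k s)" for s
  proof (cases "0 < s")
    case True
    define q where "q = min (s powr (- 1 / 2)) (2 * s powr (- 1))"
    have q: "0 \<le> q" by (simp add: q_def)
    have "(\<integral>\<^sup>+u. ennreal (norm (levy_weight (u::real^'n))) * ennreal (exp (- s * (norm u)\<^sup>2)) \<partial>lborel) \<le>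
       (\<integral>\<^sup>+u. ennreal (q * exp (- (s / 2) * (norm (u::real^'n))\<^sup>2)) \<partial>lborel)"
      using levy_weight_gaussian_bound[OF True]
      by (intro nn_integral_mono) (simp add: q_def ennreal_mult[symmetric] ennreal_leI)
    also have "\<dots> = ennreal (q * (pi / (s / 2)) powr (d / 2))"
      using gaussian_integral[of "s / 2", where 'a="real^'n"] True q
      by (subst nn_integral_eq_integral) (auto simp: d_def)
    finally have "ennreal (indicator {0<..} s * s powr (p - 1)) *
      (\<integral>\<^sup>+u. ennreal (norm (levy_weight (u::real^'n))) * ennreal (exp (- s * (norm u)\<^sup>2)) \<partial>lborel)
      \<le> ennreal (s powr (p - 1)) * ennreal (q * (pi / (s / 2)) powr (d / 2))"
      using True by (simp add: mult_left_mono)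
    also have "\<dots> = ennreal (s powr (p - 1) * (q * (pi / (s / 2)) powr (d / 2)))"
      using q by (simp add: ennreal_mult)
    also have "s powr (p - 1) * (q * (pi / (s / 2)) powr (d / 2)) = (2 * pi) powr (d / 2) * (s powr (\<alpha> / 2 - 1) * q)"
    proof -
      have "p - 1 = (\<alpha> / 2 - 1) + d / 2" by (simp add: p_def add_divide_distrib)
      then have "s powr (p - 1) = s powr (\<alpha> / 2 - 1) * s powr (d / 2)"
        by (simp only: powr_add)
      moreover have "(pi / (s / 2)) powr (d / 2) = (2 * pi) powr (d / 2) / s powr (d / 2)"
        using True by (simp add: powr_divide mult.commute)
      ultimately show ?thesis using True by simp
    qed
    also have "s powr (\<alpha> / 2 - 1) * q \<le> k s"
    proof (cases "s \<le> 1")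
      case le: True
      have "s powr (\<alpha> / 2 - 1) * q \<le> s powr (\<alpha> / 2 - 1) * s powr (- 1 / 2)"
        by (intro mult_left_mono) (auto simp: q_def)
      also have "\<dots> = s powr ((\<alpha> - 1) / 2 - 1)"
        by (simp add: diff_divide_distrib flip: powr_add)
      also have "\<dots> \<le> k s" using le True by (simp add: k_def)
      finally show ?thesis .
    next
      case False
      have "s powr (\<alpha> / 2 - 1) * q \<le> s powr (\<alpha> / 2 - 1) * (2 * s powr (- 1))"
        by (intro mult_left_mono) (auto simp: q_def)
      also have "\<dots> = 2 * s powr (\<alpha> / 2 - 1 - 1)"
        by (simp only: diff_conv_add_uminus powr_add mult_ac)
      also have "\<dots> \<le> k s" using False by (simp add: k_def)
      finally show ?thesis .
    qed
    finally show ?thesis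
      by (simp add: ennreal_mult' ennreal_leI mult_left_mono)
  qed simp
  have "(\<integral>\<^sup>+u. ennreal (norm (levy_weight (u::real^'n))) \<partial>levy_nu \<alpha>) \<le>
    ennreal (stable_const \<alpha> CARD('n) / Gamma p) * (\<integral>\<^sup>+s. ennreal ((2 * pi) powr (d / 2)) * ennreal (k s) \<partial>lborel)"
    using inner by (subst nn_integral_levy_nu) (auto simp: p_def d_def intro!: mult_left_mono nn_integral_mono)
  also have "(\<integral>\<^sup>+s. ennreal ((2 * pi) powr (d / 2)) * ennreal (k s) \<partial>lborel) =
     ennreal ((2 * pi) powr (d / 2)) * (\<integral>\<^sup>+s. ennreal (k s) \<partial>lborel)"
    by (intro nn_integral_cmult) (auto simp: k_def)
  also have "(\<integral>\<^sup>+s. ennreal (k s) \<partial>lborel) = ennreal (LINT s|lborel. k s)"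
    by (intro nn_integral_eq_integral ik) (auto simp: k_def)
  finally show "(\<integral>\<^sup>+u. ennreal (norm (levy_weight (u::real^'n))) \<partial>levy_nu \<alpha>) < \<infinity>"
    by (auto simp: ennreal_mult_less_top intro: le_less_trans)
qed

end

section \<open>Characteristic functions determine integrals of Lipschitz functions\<close>

text \<open>Dominated convergence for the difference quotients, which the mean value inequality
  bounds by \<open>w\<close>.\<close>

lemma has_real_derivative_integral:
  fixes f :: "real \<Rightarrow> 'a \<Rightarrow> real"
  assumes int: "\<And>t. integrable M (f t)"
    and deriv: "\<And>t x. ((\<lambda>t. f t x) has_real_derivative f' t x) (at t)"
    and bound: "\<And>t x. \<bar>t - t0\<bar> \<le> 1 \<Longrightarrow> \<bar>f' t x\<bar> \<le> w x"
    and w: "integrable M w"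
    and [measurable]: "f' t0 \<in> borel_measurable M"
  shows "((\<lambda>t. LINT x|M. f t x) has_real_derivative (LINT x|M. f' t0 x)) (at t0)"
  unfolding DERIV_def tendsto_at_iff_sequentially comp_def
proof (intro allI impI)
  fix X :: "nat \<Rightarrow> real"
  assume X0: "\<forall>n. X n \<in> UNIV - {0}" and X: "X \<longlonglongrightarrow> 0"
  have [measurable]: "f t \<in> borel_measurable M" for t using int by auto
  \<comment> \<open>The bound \<open>w\<close> is available within distance 1 of \<open>t0\<close>,
    so the sequence is shifted by \<open>N\<close> to be dominated from its first term on.\<close>
  obtain N where "\<And>n. N \<le> n \<Longrightarrow> \<bar>X n\<bar> < 1"
    using LIMSEQ_D[OF X, of 1] by auto
  then have N: "\<And>n. N \<le> n \<Longrightarrow> \<bar>X n\<bar> \<le> 1" by (simp add: less_imp_le)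
  define q where "q n x = (f (t0 + X (n + N)) x - f t0 x) / X (n + N)" for n x
  have "(\<lambda>n. LINT x|M. q n x) \<longlonglongrightarrow> (LINT x|M. f' t0 x)"
  proof (rule integral_dominated_convergence[OF _ _ w])
    show "AE x in M. (\<lambda>n. q n x) \<longlonglongrightarrow> f' t0 x"
    proof (rule AE_I2)
      fix x
      have "((\<lambda>h. (f (t0 + h) x - f t0 x) / h) \<longlongrightarrow> f' t0 x) (at 0)"
        using deriv[of x t0] by (simp add: DERIV_def)
      with X0 X have "(\<lambda>n. (f (t0 + X n) x - f t0 x) / X n) \<longlonglongrightarrow> f' t0 x"
        unfolding tendsto_at_iff_sequentially comp_def by blast
      then show "(\<lambda>n. q n x) \<longlonglongrightarrow> f' t0 x"
        unfolding q_def by (rule LIMSEQ_ignore_initial_segment)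
    qed
    show "AE x in M. norm (q n x) \<le> w x" for n
    proof (rule AE_I2)
      fix x
      have h: "\<bar>X (n + N)\<bar> \<le> 1" "X (n + N) \<noteq> 0" using N X0 by auto
      have "norm (f (t0 + X (n + N)) x - f t0 x) \<le> w x * norm (t0 + X (n + N) - t0)"
      proof (rule field_differentiable_bound[of "cball t0 1" "\<lambda>t. f t x" "\<lambda>t. f' t x"])
        show "\<And>z. z \<in> cball t0 1 \<Longrightarrow> norm (f' z x) \<le> w x"
          using bound by (simp add: dist_real_def abs_minus_commute)
      qed (use deriv h in \<open>auto simp: dist_real_def intro: has_field_derivative_at_within\<close>)
      with h show "norm (q n x) \<le> w x" by (simp add: q_def field_simps)
    qed
  qed (simp_all add: q_def)
  moreover have "(LINT x|M. q n x) = ((LINT x|M. f (t0 + X (n + N)) x) - (LINT x|M. f t0 x)) / X (n + N)" for n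
    unfolding q_def using int by simp
  ultimately have "(\<lambda>n. ((LINT x|M. f (t0 + X (n + N)) x) - (LINT x|M. f t0 x)) / X (n + N)) \<longlonglongrightarrow> (LINT x|M. f' t0 x)"
    by simp
  then show "(\<lambda>n. ((LINT x|M. f (t0 + X n) x) - (LINT x|M. f t0 x)) / X n) \<longlonglongrightarrow> (LINT x|M. f' t0 x)"
    by (rule LIMSEQ_offset)
qed

section \<open>Gaussian smoothing and uniqueness\<close>

lemma lborel_shift:
  fixes g :: "'a::euclidean_space \<Rightarrow> real"
  assumes [measurable]: "g \<in> borel_measurable borel"
  shows "integrable lborel (\<lambda>y. g (y - x)) \<longleftrightarrow> integrable lborel g"
    and "(LINT y|lborel. g (y - x)) = (LINT y|lborel. g y)"
proof -
  have eq: "lborel = distr lborel borel ((+) (- x))" by (simp add: lborel_distr_plus)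
  show "integrable lborel (\<lambda>y. g (y - x)) \<longleftrightarrow> integrable lborel g"
    by (subst (2) eq, subst integrable_distr_eq) (auto simp: algebra_simps)
  show "(LINT y|lborel. g (y - x)) = (LINT y|lborel. g y)"
    by (subst (2) eq, subst integral_distr) (auto simp: algebra_simps)
qed

lemma integral_cos_shift_char:
  fixes M :: "'a::real_inner measure" and \<xi> :: 'a
  assumes "prob_space M" "(\<lambda>x. \<xi> \<bullet> x) \<in> borel_measurable M"
  shows "(LINT x|M. cos (\<xi> \<bullet> x + \<theta>)) = Re (cis \<theta> * (LINT x|M. iexp (\<xi> \<bullet> x)))"
proof -
  interpret prob_space M by fact
  note [measurable] = assms(2)
  have i: "integrable M (\<lambda>x. iexp (\<xi> \<bullet> x))"
    by (rule integrable_const_bound[where B=1]) auto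
  have "cos (\<xi> \<bullet> x + \<theta>) = Re (cis \<theta> * iexp (\<xi> \<bullet> x))" for x
    by (simp add: cis_conv_exp[symmetric] cis_mult add.commute)
  then have "(LINT x|M. cos (\<xi> \<bullet> x + \<theta>)) = (LINT x|M. Re (cis \<theta> * iexp (\<xi> \<bullet> x)))" by simp
  also have "\<dots> = Re (LINT x|M. cis \<theta> * iexp (\<xi> \<bullet> x))"
    using i by (intro integral_Re) simp
  finally show ?thesis by simp
qed

text \<open>A Gaussian kernel is itself a Gaussian average of cosines. By Fubini its integral
  against \<open>M\<close> then depends on \<open>M\<close> through the characteristic function
  alone.\<close>

lemma integral_gaussian_kernel_conv_cos:
  fixes M :: "'a::euclidean_space measure"
  assumes "borel_prob M" "0 < s"
  shows "(LINT x|M. exp (- s * (norm (y - x))\<^sup>2)) =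
    (4 * pi * s) powr (- (real DIM('a) / 2)) *
      (LINT w|lborel. (LINT x|M. cos (w \<bullet> x + - (w \<bullet> y))) * exp (- (1 / (4 * s)) * (norm w)\<^sup>2))"
proof -
  \<comment> \<open>The parameter of the dual Gaussian: the transform of
    \<open>exp (- r * (norm w)\<^sup>2)\<close> has exponent
    \<open>- 1 / (4 * r) = - s\<close>.\<close>
  define r where "r = 1 / (4 * s)"
  have r: "0 < r" using assms by (simp add: r_def)
  interpret M: prob_space M using assms by (simp add: borel_prob_def)
  have [measurable_cong]: "sets M = sets borel" using assms by (simp add: borel_prob_def)
  interpret P: pair_sigma_finite "lborel :: 'a measure" M ..
  let ?f = "\<lambda>w x. cos (w \<bullet> x + - (w \<bullet> y)) * exp (- r * (norm w)\<^sup>2)"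
  have c: "(pi / r) powr (real DIM('a) / 2) = (4 * pi * s) powr (real DIM('a) / 2)"
    using assms by (simp add: r_def mult_ac)
  have "exp (- s * (norm (y - x))\<^sup>2) = (4 * pi * s) powr (- (real DIM('a) / 2)) * (LINT w|lborel. ?f w x)" for x
  proof -
    have "(LINT w|lborel. ?f w x) = (LINT w|lborel. cos ((x - y) \<bullet> w) * exp (- r * (norm w)\<^sup>2))"
      by (simp add: inner_commute[of "x - y"] inner_diff_right)
    also have "\<dots> = (4 * pi * s) powr (real DIM('a) / 2) * exp (- (norm (y - x))\<^sup>2 / (4 * r))"
      using gaussian_cos_integral(2)[OF r, of "x - y"] c by (simp add: norm_minus_commute)
    also have "- (norm (y - x))\<^sup>2 / (4 * r) = - s * (norm (y - x))\<^sup>2"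
      by (simp add: r_def)
    finally show ?thesis using assms by (simp add: powr_minus)
  qed
  then have "(LINT x|M. exp (- s * (norm (y - x))\<^sup>2)) =
     (4 * pi * s) powr (- (real DIM('a) / 2)) * (LINT x|M. (LINT w|lborel. ?f w x))"
    by simp
  also have "(LINT x|M. (LINT w|lborel. ?f w x)) = (LINT w|lborel. (LINT x|M. ?f w x))"
  proof (rule P.Fubini_integral, rule P.Fubini_integrable)
    show "case_prod ?f \<in> borel_measurable (lborel \<Otimes>\<^sub>M M)" by measurable
    show "AE w in lborel. integrable M (\<lambda>x. case_prod ?f (w, x))"
      using r by (intro AE_I2 M.integrable_const_bound[where B=1]) (auto simp: abs_mult intro!: mult_le_one)
    have [measurable]: "(\<lambda>w. LINT x|M. norm (case_prod ?f (w, x))) \<in> borel_measurable lborel"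
      by measurable
    show "integrable lborel (\<lambda>w. LINT x|M. norm (case_prod ?f (w, x)))"
    proof (rule Bochner_Integration.integrable_bound[OF gaussian_integral(1)[OF r]], measurable, rule AE_I2)
      fix w :: 'a
      have "(LINT x|M. norm (case_prod ?f (w, x))) \<le> exp (- r * (norm w)\<^sup>2)"
        using r by (intro M.integral_le_const M.integrable_const_bound[where B=1] AE_I2)
           (auto simp: abs_mult intro!: mult_le_one mult_left_le_one_le)
      then show "norm (LINT x|M. norm (case_prod ?f (w, x))) \<le> norm (exp (- r * (norm w)\<^sup>2))"
        by (simp add: integral_nonneg_AE)
    qed
  qed
  finally show ?thesis by (simp add: r_def)
qed

lemma integral_gaussian_smoothing:
  fixes M :: "'a::euclidean_space measure"
  assumes M: "borel_prob M" and s: "0 < s"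
    and [measurable]: "h \<in> borel_measurable borel" and B: "\<And>x. \<bar>h x\<bar> \<le> B"
  shows "(LINT x|M. (LINT y|lborel. h y * exp (- s * (norm (y - x))\<^sup>2))) =
    (LINT y|lborel. h y * (LINT x|M. exp (- s * (norm (y - x))\<^sup>2)))"
proof -
  interpret M: prob_space M using M by (simp add: borel_prob_def)
  have [measurable_cong]: "sets M = sets borel" using M by (simp add: borel_prob_def)
  interpret P: pair_sigma_finite M "lborel :: 'a measure" ..
  let ?f = "\<lambda>x y. h y * exp (- s * (norm (y - x))\<^sup>2)"
  have g: "integrable lborel (\<lambda>y. exp (- s * (norm (y - x))\<^sup>2))"
    "(LINT y|lborel. exp (- s * (norm (y - x))\<^sup>2)) = (pi / s) powr (real DIM('a) / 2)" for x :: 'a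
    using lborel_shift[of "\<lambda>z. exp (- s * (norm z)\<^sup>2)" x] gaussian_integral[OF s, where 'a='a] by auto
  have B0: "0 \<le> B" using B[of 0] by linarith
  have i: "integrable lborel (\<lambda>y. ?f x y)" for x
    by (rule Bochner_Integration.integrable_bound[OF integrable_mult_right[OF g(1)[of x], of B]])
       (auto simp: abs_mult B0 intro!: mult_right_mono B)
  have "(LINT x|M. (LINT y|lborel. ?f x y)) = (LINT y|lborel. (LINT x|M. ?f x y))"
  proof (rule P.Fubini_integral[symmetric], rule P.Fubini_integrable)
    show "case_prod ?f \<in> borel_measurable (M \<Otimes>\<^sub>M lborel)" by measurable
    show "AE x in M. integrable lborel (\<lambda>y. case_prod ?f (x, y))" using i by simp
    have [measurable]: "(\<lambda>x. LINT y|lborel. norm (case_prod ?f (x, y))) \<in> borel_measurable M"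
      by measurable
    show "integrable M (\<lambda>x. LINT y|lborel. norm (case_prod ?f (x, y)))"
    proof (rule M.integrable_const_bound[where B="B * (pi / s) powr (real DIM('a) / 2)"], rule AE_I2)
      fix x
      have "(LINT y|lborel. norm (case_prod ?f (x, y))) \<le> (LINT y|lborel. B * exp (- s * (norm (y - x))\<^sup>2))"
        using integrable_abs[OF i[of x]] g(1)[of x] by (intro integral_mono) (auto simp: abs_mult intro!: mult_right_mono B)
      then show "norm (LINT y|lborel. norm (case_prod ?f (x, y))) \<le> B * (pi / s) powr (real DIM('a) / 2)"
        using g(2)[of x] by (simp add: integral_nonneg_AE)
    qed measurable
  qed
  then show ?thesis by simp
qed

text \<open>The normalized kernel has mass one, so the error is an average of
  \<open>h y - h x\<close>, at most \<open>K * norm (y - x)\<close>. Half of the Gaussian absorbs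
  that norm at the price \<open>s powr (- 1 / 2)\<close>; the integral of the wider Gaussian that
  remains accounts for the power of 2.\<close>

lemma gaussian_smoothing_error:
  fixes h :: "'a::euclidean_space \<Rightarrow> real"
  assumes s: "0 < s" and B: "\<And>x. \<bar>h x\<bar> \<le> B" and K: "\<And>x y. \<bar>h x - h y\<bar> \<le> K * norm (x - y)"
    and [measurable]: "h \<in> borel_measurable borel"
  shows "\<bar>(s / pi) powr (real DIM('a) / 2) * (LINT y|lborel. h y * exp (- s * (norm (y - x))\<^sup>2)) - h x\<bar>
    \<le> K * 2 powr (real DIM('a) / 2) * s powr (- 1 / 2)"
proof -
  let ?e = "\<lambda>y. exp (- s * (norm (y - x))\<^sup>2)" and ?d = "real DIM('a) / 2"
  have g: "integrable lborel ?e" "(LINT y|lborel. ?e y) = (pi / s) powr ?d"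
    using lborel_shift[of "\<lambda>z. exp (- s * (norm z)\<^sup>2)" x] gaussian_integral[OF s, where 'a='a] by auto
  have g2: "integrable lborel (\<lambda>y. exp (- (s / 2) * (norm (y - x))\<^sup>2))"
    "(LINT y|lborel. exp (- (s / 2) * (norm (y - x))\<^sup>2)) = (pi / (s / 2)) powr ?d"
    using lborel_shift[of "\<lambda>z. exp (- (s / 2) * (norm z)\<^sup>2)" x] gaussian_integral[of "s / 2", where 'a='a] s by auto
  have B0: "0 \<le> B" using B[of 0] by linarith
  have K0: "0 \<le> K"
  proof -
    obtain b :: 'a where "b \<in> Basis" by (meson SOME_Basis)
    with K[of b 0] show ?thesis by simp
  qed
  have i: "integrable lborel (\<lambda>y. h y * ?e y)"
    by (rule Bochner_Integration.integrable_bound[OF integrable_mult_right[OF g(1), of B]])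
       (auto simp: abs_mult B0 intro!: mult_right_mono B)
  have c: "(s / pi) powr ?d * (pi / s) powr ?d = 1"
    using s by (simp add: powr_mult[symmetric])
  have "(s / pi) powr ?d * (LINT y|lborel. h y * ?e y) - h x =
     (s / pi) powr ?d * ((LINT y|lborel. h y * ?e y) - (LINT y|lborel. h x * ?e y))"
    using c g(2) by (simp add: algebra_simps)
  also have "(LINT y|lborel. h y * ?e y) - (LINT y|lborel. h x * ?e y) = (LINT y|lborel. h y * ?e y - h x * ?e y)"
    using i g(1) by simp
  finally have "\<bar>(s / pi) powr ?d * (LINT y|lborel. h y * ?e y) - h x\<bar> =
     (s / pi) powr ?d * \<bar>LINT y|lborel. h y * ?e y - h x * ?e y\<bar>" by (simp add: abs_mult)
  also have "\<bar>LINT y|lborel. h y * ?e y - h x * ?e y\<bar> \<le> (LINT y|lborel. \<bar>h y * ?e y - h x * ?e y\<bar>)"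
    by (rule integral_abs_bound)
  also have "\<dots> \<le> (LINT y|lborel. K * s powr (- 1 / 2) * exp (- (s / 2) * (norm (y - x))\<^sup>2))"
  proof (rule integral_mono)
    show "integrable lborel (\<lambda>y. \<bar>h y * ?e y - h x * ?e y\<bar>)" using i g(1) by simp
    show "integrable lborel (\<lambda>y. K * s powr (- 1 / 2) * exp (- (s / 2) * (norm (y - x))\<^sup>2))" using g2 by simp
    fix y
    have "\<bar>h y * ?e y - h x * ?e y\<bar> = \<bar>h y - h x\<bar> * ?e y" by (simp add: left_diff_distrib[symmetric] abs_mult)
    also have "\<dots> \<le> K * norm (y - x) * ?e y" by (intro mult_right_mono K) auto
    also have "\<dots> = K * (norm (y - x) * ?e y)" by simp
    also have "\<dots> \<le> K * (s powr (- 1 / 2) * exp (- (s / 2) * (norm (y - x))\<^sup>2))"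
      by (intro mult_left_mono norm_gaussian_bound s K0)
    finally show "\<bar>h y * ?e y - h x * ?e y\<bar> \<le> K * s powr (- 1 / 2) * exp (- (s / 2) * (norm (y - x))\<^sup>2)"
      by simp
  qed
  also have "\<dots> = K * s powr (- 1 / 2) * (pi / (s / 2)) powr ?d" using g2 by simp
  finally have "\<bar>(s / pi) powr ?d * (LINT y|lborel. h y * ?e y) - h x\<bar> \<le>
     (s / pi) powr ?d * (K * s powr (- 1 / 2) * (pi / (s / 2)) powr ?d)"
    by (simp add: mult_left_mono)
  also have "(s / pi) powr ?d * (pi / (s / 2)) powr ?d = 2 powr ?d"
    using s by (simp add: powr_mult[symmetric])
  then have "(s / pi) powr ?d * (K * s powr (- 1 / 2) * (pi / (s / 2)) powr ?d) = K * 2 powr ?d * s powr (- 1 / 2)"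
    by (metis mult.assoc mult.commute)
  finally show ?thesis .
qed

text \<open>The smoothed functions \<open>H s\<close> have the same integral against both measures,
  by Fourier representation of the kernel, and converge to \<open>h\<close> uniformly as
  \<open>s\<close> grows.\<close>

lemma integral_eq_of_char_eq:
  fixes M N :: "'a::euclidean_space measure" and h :: "'a \<Rightarrow> real"
  assumes M: "borel_prob M" and N: "borel_prob N"
    and char: "\<And>\<xi>. (LINT x|M. iexp (\<xi> \<bullet> x)) = (LINT x|N. iexp (\<xi> \<bullet> x))"
    and B: "\<And>x. \<bar>h x\<bar> \<le> B" and K: "\<And>x y. \<bar>h x - h y\<bar> \<le> K * norm (x - y)"
    and [measurable]: "h \<in> borel_measurable borel"
  shows "(LINT x|M. h x) = (LINT x|N. h x)"
proof -
  define H where "H s x = (s / pi) powr (real DIM('a) / 2) * (LINT y|lborel. h y * exp (- s * (norm (y - x))\<^sup>2))" for s x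
  define c where "c = K * 2 powr (real DIM('a) / 2)"
  have err: "\<bar>H s x - h x\<bar> \<le> c * s powr (- 1 / 2)" if "0 < s" for s x
    unfolding H_def c_def by (rule gaussian_smoothing_error[OF that B K]) simp
  have [measurable]: "H s \<in> borel_measurable borel" for s unfolding H_def by measurable
  have lim: "((\<lambda>s. LINT x|P. H s x) \<longlongrightarrow> (LINT x|P. h x)) at_top" if P: "borel_prob P" for P
  proof -
    interpret P: prob_space P using P by (simp add: borel_prob_def)
    have [measurable_cong]: "sets P = sets borel" using P by (simp add: borel_prob_def)
    have ih: "integrable P h" by (rule P.integrable_const_bound[where B=B]) (auto simp: B)
    have iH: "integrable P (H s)" if "0 < s" for s
    proof (rule P.integrable_const_bound[where B="B + c * s powr (- 1 / 2)"], rule AE_I2)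
      show "norm (H s x) \<le> B + c * s powr (- 1 / 2)" for x
        using err[OF that, of x] B[of x] by simp
    qed simp
    have bd: "\<bar>(LINT x|P. H s x) - (LINT x|P. h x)\<bar> \<le> c * s powr (- 1 / 2)" if "0 < s" for s
    proof -
      have "\<bar>(LINT x|P. H s x) - (LINT x|P. h x)\<bar> = \<bar>LINT x|P. H s x - h x\<bar>"
        using ih iH[OF that] by simp
      also have "\<dots> \<le> (LINT x|P. \<bar>H s x - h x\<bar>)" by (rule integral_abs_bound)
      also have "\<dots> \<le> c * s powr (- 1 / 2)"
        using ih iH[OF that] err[OF that] by (intro P.integral_le_const) auto
      finally show ?thesis .
    qed
    have "((\<lambda>s. (LINT x|P. H s x) - (LINT x|P. h x)) \<longlongrightarrow> 0) at_top"
    proof (rule Lim_null_comparison)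
      show "\<forall>\<^sub>F s in at_top. norm ((LINT x|P. H s x) - (LINT x|P. h x)) \<le> c * s powr (- 1 / 2)"
        using eventually_gt_at_top[of 0] by eventually_elim (use bd in auto)
      have "((\<lambda>s. s powr (- 1 / 2)) \<longlongrightarrow> 0) (at_top :: real filter)"
        by (rule tendsto_neg_powr) (auto intro: filterlim_ident)
      then show "((\<lambda>s. c * s powr (- 1 / 2)) \<longlongrightarrow> 0) at_top"
        by (rule tendsto_mult_right_zero)
    qed
    then show ?thesis by (simp add: LIM_zero_iff)
  qed
  have "(LINT x|M. H s x) = (LINT x|N. H s x)" if s: "0 < s" for s
  proof -
    have meas: "(\<lambda>x. w \<bullet> x) \<in> borel_measurable M" "(\<lambda>x. w \<bullet> x) \<in> borel_measurable N" for w
    proof -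
      have [measurable_cong]: "sets M = sets borel" "sets N = sets borel" using M N by (auto simp: borel_prob_def)
      show "(\<lambda>x. w \<bullet> x) \<in> borel_measurable M" "(\<lambda>x. w \<bullet> x) \<in> borel_measurable N" by measurable
    qed
    have "(LINT x|M. exp (- s * (norm (y - x))\<^sup>2)) = (LINT x|N. exp (- s * (norm (y - x))\<^sup>2))" for y
      using M N
      by (simp only: integral_gaussian_kernel_conv_cos[OF _ s] char
           integral_cos_shift_char[OF _ meas(1)] integral_cos_shift_char[OF _ meas(2)] borel_prob_def)
    then show ?thesis
      unfolding H_def
      by (simp only: integral_mult_right_zero integral_gaussian_smoothing[OF M s _ B]
          integral_gaussian_smoothing[OF N s _ B] assms(6))
  qed
  then have "\<forall>\<^sub>F s in at_top. (LINT x|M. H s x) = (LINT x|N. H s x)"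
    by (rule eventually_mono[OF eventually_gt_at_top[of 0]])
  with lim[OF M] have "((\<lambda>s. LINT x|N. H s x) \<longlongrightarrow> (LINT x|M. h x)) at_top"
    by (rule Lim_transform_eventually)
  from tendsto_unique[OF _ this lim[OF N]] show ?thesis by simp
qed

section \<open>Schwartz functions\<close>

text \<open>Smoothness and decay of all iterated derivatives are proved at once for a class that is
  closed under partial derivatives. The phase in the base case is free because differentiating a
  cosine shifts it by a quarter period.\<close>

inductive_set gauss_trig :: "real^'n::finite \<Rightarrow> real \<Rightarrow> (real^'n \<Rightarrow> real) set" for \<xi> c where
  base: "(\<lambda>x. cos (\<xi> \<bullet> x + \<theta>) * exp (- c * (norm x)\<^sup>2)) \<in> gauss_trig \<xi> c"
| coord: "h \<in> gauss_trig \<xi> c \<Longrightarrow> (\<lambda>x. x $ i * h x) \<in> gauss_trig \<xi> c"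
| lincomb: "h \<in> gauss_trig \<xi> c \<Longrightarrow> k \<in> gauss_trig \<xi> c \<Longrightarrow> (\<lambda>x. a * h x + b * k x) \<in> gauss_trig \<xi> c"

lemma gauss_trig_has_derivative:
  assumes "h \<in> gauss_trig \<xi> c"
  shows "\<exists>D. (\<forall>x. (h has_derivative D x) (at x)) \<and> (\<forall>j. (\<lambda>x. D x (axis j 1)) \<in> gauss_trig \<xi> c)"
  using assms
proof induction
  case (base \<theta>)
  \<comment> \<open>The sine from the derivative appears as a cosine with phase
    \<open>\<theta> + pi / 2\<close>, which stays in the class.\<close>
  define D where "D x v = (\<xi> \<bullet> v) * (cos (\<xi> \<bullet> x + (\<theta> + pi / 2)) * exp (- c * (norm x)\<^sup>2)) +
      (- 2 * c) * ((x \<bullet> v) * (cos (\<xi> \<bullet> x + \<theta>) * exp (- c * (norm x)\<^sup>2)))" for x v :: "real^'a"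
  have "((\<lambda>x. cos (\<xi> \<bullet> x + \<theta>) * exp (- c * (norm x)\<^sup>2)) has_derivative D x) (at x)" for x
  proof -
    have "cos (\<xi> \<bullet> x + (\<theta> + pi / 2)) = - sin (\<xi> \<bullet> x + \<theta>)"
      by (simp add: add.assoc[symmetric] cos_add[of _ "pi / 2"])
    then show ?thesis
      unfolding power2_norm_eq_inner D_def
      by (auto intro!: derivative_eq_intros simp: inner_commute fun_eq_iff algebra_simps)
  qed
  moreover have "(\<lambda>x. D x (axis j 1)) \<in> gauss_trig \<xi> c" for j
    unfolding D_def inner_axis inner_real_def mult_1_right
    by (rule gauss_trig.lincomb[OF gauss_trig.base gauss_trig.coord[OF gauss_trig.base]])
  ultimately show ?case by blast
next
  case (coord h i)
  then obtain D where D: "\<And>x. (h has_derivative D x) (at x)" "\<And>j. (\<lambda>x. D x (axis j 1)) \<in> gauss_trig \<xi> c"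
    by blast
  \<comment> \<open>The factor \<open>1\<close> gives \<open>D'\<close> the shape that the rule
    \<open>lincomb\<close> produces.\<close>
  define D' where "D' x v = v $ i * h x + 1 * (x $ i * D x v)" for x v
  have "((\<lambda>x. x $ i * h x) has_derivative D' x) (at x)" for x
    unfolding D'_def
    by (auto intro!: derivative_eq_intros D bounded_linear.has_derivative[OF bounded_linear_vec_nth] simp: fun_eq_iff)
  moreover have "(\<lambda>x. D' x (axis j 1)) \<in> gauss_trig \<xi> c" for j
    unfolding D'_def by (intro gauss_trig.lincomb gauss_trig.coord D coord)
  ultimately show ?case by blast
next
  case (lincomb h k a b)
  then obtain D D' where D: "\<And>x. (h has_derivative D x) (at x)" "\<And>j. (\<lambda>x. D x (axis j 1)) \<in> gauss_trig \<xi> c"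
    "\<And>x. (k has_derivative D' x) (at x)" "\<And>j. (\<lambda>x. D' x (axis j 1)) \<in> gauss_trig \<xi> c"
    by blast
  have "((\<lambda>x. a * h x + b * k x) has_derivative (\<lambda>v. a * D x v + b * D' x v)) (at x)" for x
    by (auto intro!: derivative_eq_intros D)
  moreover have "(\<lambda>x. a * D x (axis j 1) + b * D' x (axis j 1)) \<in> gauss_trig \<xi> c" for j
    by (intro gauss_trig.lincomb D)
  ultimately show ?case by (intro exI[of _ "\<lambda>x v. a * D x v + b * D' x v"]) auto
qed

text \<open>The \<open>k\<close>-th power of \<open>z \<le> exp z\<close> at
  \<open>z = c * y\<^sup>2 / k\<close> controls \<open>y ^ (2 * k)\<close>. Passing from
  \<open>y ^ k\<close> to \<open>1 + y ^ (2 * k)\<close> avoids half-integer powers of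
  \<open>y\<^sup>2\<close>.\<close>

lemma power_mult_gaussian_bounded:
  assumes "0 < c"
  shows "\<exists>B. \<forall>y::real. 0 \<le> y \<longrightarrow> y ^ k * exp (- c * y\<^sup>2) \<le> B"
proof (intro exI allI impI)
  fix y :: real assume y: "0 \<le> y"
  have "c * y\<^sup>2 \<le> real k * exp (c * y\<^sup>2 / k)" if "0 < k"
    using exp_ge_add_one_self[of "c * y\<^sup>2 / k"] that by (simp add: field_simps)
  then have "(c * y\<^sup>2) ^ k \<le> (real k * exp (c * y\<^sup>2 / k)) ^ k"
    using assms by (cases "k = 0") (auto intro!: power_mono)
  also have "\<dots> \<le> real k ^ k * exp (c * y\<^sup>2)"
    using assms by (cases "k = 0") (auto simp: power_mult_distrib exp_of_nat_mult[symmetric])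
  also have "(c * y\<^sup>2) ^ k = c ^ k * y ^ (2 * k)" by (simp only: power_mult_distrib power_mult)
  finally have 1: "y ^ (2 * k) \<le> real k ^ k / c ^ k * exp (c * y\<^sup>2)"
    using assms by (simp add: field_simps)
  have "y ^ k \<le> 1 + y ^ (2 * k)"
  proof (cases "y \<le> 1")
    case True
    then show ?thesis using y power_le_one[of y k] by (simp add: add_increasing2)
  next
    case False
    then have "y ^ k \<le> y ^ (2 * k)" by (intro power_increasing) auto
    then show ?thesis by simp
  qed
  also have "\<dots> \<le> exp (c * y\<^sup>2) + real k ^ k / c ^ k * exp (c * y\<^sup>2)"
    using 1 assms by (intro add_mono) auto
  finally have "y ^ k * exp (- c * y\<^sup>2) \<le> (exp (c * y\<^sup>2) + real k ^ k / c ^ k * exp (c * y\<^sup>2)) * exp (- c * y\<^sup>2)"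
    by (intro mult_right_mono) auto
  also have "\<dots> = 1 + real k ^ k / c ^ k"
    by (simp add: exp_minus field_simps)
  finally show "y ^ k * exp (- c * y\<^sup>2) \<le> 1 + real k ^ k / c ^ k" .
qed

text \<open>A coordinate factor costs one power of the norm, so the induction is over all
  \<open>k\<close> simultaneously.\<close>

lemma gauss_trig_rapidly_decreasing:
  assumes "h \<in> gauss_trig \<xi> c" "0 < c"
  shows "\<exists>B. \<forall>x. norm x ^ k * \<bar>h x\<bar> \<le> B"
  using assms(1)
proof (induction arbitrary: k)
  case (base \<theta>)
  obtain B where B: "\<And>y::real. 0 \<le> y \<Longrightarrow> y ^ k * exp (- c * y\<^sup>2) \<le> B"
    using power_mult_gaussian_bounded[OF assms(2), of k] by blast
  have "norm x ^ k * \<bar>cos (\<xi> \<bullet> x + \<theta>) * exp (- c * (norm x)\<^sup>2)\<bar> \<le> B" for x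
  proof -
    have "\<bar>cos (\<xi> \<bullet> x + \<theta>)\<bar> * exp (- c * (norm x)\<^sup>2) \<le> 1 * exp (- c * (norm x)\<^sup>2)"
      by (intro mult_right_mono) auto
    then have "norm x ^ k * \<bar>cos (\<xi> \<bullet> x + \<theta>) * exp (- c * (norm x)\<^sup>2)\<bar> \<le> norm x ^ k * exp (- c * (norm x)\<^sup>2)"
      by (intro mult_left_mono) (auto simp: abs_mult)
    with B[of "norm x"] show ?thesis by simp
  qed
  then show ?case by blast
next
  case (coord h i)
  obtain B where B: "\<And>x. norm x ^ Suc k * \<bar>h x\<bar> \<le> B" using coord.IH[of "Suc k"] by blast
  have "norm x ^ k * \<bar>x $ i * h x\<bar> \<le> B" for x
  proof -
    have "norm x ^ k * \<bar>x $ i * h x\<bar> \<le> norm x ^ k * (norm x * \<bar>h x\<bar>)"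
      unfolding abs_mult by (intro mult_left_mono mult_right_mono) (auto simp: component_le_norm_cart)
    with B[of x] show ?thesis by (simp add: mult_ac)
  qed
  then show ?case by blast
next
  case (lincomb h1 h2 a b)
  obtain B1 B2 where B: "\<And>x. norm x ^ k * \<bar>h1 x\<bar> \<le> B1" "\<And>x. norm x ^ k * \<bar>h2 x\<bar> \<le> B2"
    using lincomb.IH by meson
  have "norm x ^ k * \<bar>a * h1 x + b * h2 x\<bar> \<le> \<bar>a\<bar> * B1 + \<bar>b\<bar> * B2" for x
  proof -
    have "norm x ^ k * \<bar>a * h1 x + b * h2 x\<bar> \<le> norm x ^ k * (\<bar>a\<bar> * \<bar>h1 x\<bar> + \<bar>b\<bar> * \<bar>h2 x\<bar>)"
      by (intro mult_left_mono) (auto simp: abs_mult[symmetric] abs_triangle_ineq)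
    also have "\<dots> = \<bar>a\<bar> * (norm x ^ k * \<bar>h1 x\<bar>) + \<bar>b\<bar> * (norm x ^ k * \<bar>h2 x\<bar>)" by (simp add: algebra_simps)
    also have "\<dots> \<le> \<bar>a\<bar> * B1 + \<bar>b\<bar> * B2" by (intro add_mono mult_left_mono B) auto
    finally show ?thesis .
  qed
  then show ?case by blast
qed

lemma partial_deriv_eq:
  assumes "(f has_derivative D) (at x)"
  shows "partial_deriv j f x = D (axis j 1)"
  unfolding partial_deriv_def frechet_derivative_at[OF assms, symmetric] ..

lemma gauss_trig_schwartz:
  assumes h: "h \<in> gauss_trig \<xi> c" and c: "0 < c"
  shows "h \<in> schwartz"
proof -
  have it: "iter_partial js h \<in> gauss_trig \<xi> c" for js
  proof (induction js)
    case (Cons j js)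
    obtain D where D: "\<And>x. (iter_partial js h has_derivative D x) (at x)"
      "(\<lambda>x. D x (axis j 1)) \<in> gauss_trig \<xi> c"
      using gauss_trig_has_derivative[OF Cons.IH] by blast
    have "iter_partial (j # js) h = (\<lambda>x. D x (axis j 1))"
      by (auto simp: partial_deriv_eq[OF D(1)])
    with D(2) show ?case by simp
  qed (simp add: h)
  have "iter_partial js h differentiable (at x)" for js x
    using gauss_trig_has_derivative[OF it[of js]] by (auto simp: differentiable_def)
  with gauss_trig_rapidly_decreasing[OF it c] show ?thesis by (simp add: schwartz_def)
qed

section \<open>General properties of Schwartz functions\<close>

lemma schwartz_differentiable:
  "f \<in> schwartz \<Longrightarrow> iter_partial js f differentiable (at x)"
  by (simp add: schwartz_def)

lemma schwartz_rapidly_decreasing: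
  "f \<in> schwartz \<Longrightarrow> \<exists>B. \<forall>x. norm x ^ k * \<bar>iter_partial js f x\<bar> \<le> B"
  by (simp add: schwartz_def)

lemma schwartz_lincomb:
  assumes f: "f \<in> schwartz" and g: "g \<in> schwartz"
  shows "(\<lambda>x. a * f x + b * g x) \<in> schwartz"
proof -
  have it: "iter_partial js (\<lambda>x. a * f x + b * g x) = (\<lambda>x. a * iter_partial js f x + b * iter_partial js g x)" for js
  proof (induction js)
    case (Cons j js)
    have "((\<lambda>x. a * iter_partial js f x + b * iter_partial js g x) has_derivative
       (\<lambda>v. a * frechet_derivative (iter_partial js f) (at x) v + b * frechet_derivative (iter_partial js g) (at x) v)) (at x)" for x
      using schwartz_differentiable[OF f, of js x] schwartz_differentiable[OF g, of js x]
      by (auto intro!: derivative_eq_intros simp: frechet_derivative_works)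
    from partial_deriv_eq[OF this] show ?case
      by (simp add: Cons.IH) (simp add: partial_deriv_def)
  qed simp
  have "(\<lambda>x. a * iter_partial js f x + b * iter_partial js g x) differentiable (at x)" for js x
    using schwartz_differentiable[OF f, of js x] schwartz_differentiable[OF g, of js x]
    by (intro differentiable_add differentiable_mult) auto
  moreover have "\<exists>B. \<forall>x. norm x ^ k * \<bar>a * iter_partial js f x + b * iter_partial js g x\<bar> \<le> B" for js k
  proof -
    obtain B1 B2 where B: "\<And>x. norm x ^ k * \<bar>iter_partial js f x\<bar> \<le> B1" "\<And>x. norm x ^ k * \<bar>iter_partial js g x\<bar> \<le> B2"
      using schwartz_rapidly_decreasing[OF f, of k js] schwartz_rapidly_decreasing[OF g, of k js] by meson
    have "norm x ^ k * \<bar>a * iter_partial js f x + b * iter_partial js g x\<bar> \<le> \<bar>a\<bar> * B1 + \<bar>b\<bar> * B2" for x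
    proof -
      have "norm x ^ k * \<bar>a * iter_partial js f x + b * iter_partial js g x\<bar> \<le>
         norm x ^ k * (\<bar>a\<bar> * \<bar>iter_partial js f x\<bar> + \<bar>b\<bar> * \<bar>iter_partial js g x\<bar>)"
        by (intro mult_left_mono) (auto simp: abs_mult[symmetric] abs_triangle_ineq)
      also have "\<dots> = \<bar>a\<bar> * (norm x ^ k * \<bar>iter_partial js f x\<bar>) + \<bar>b\<bar> * (norm x ^ k * \<bar>iter_partial js g x\<bar>)"
        by (simp add: algebra_simps)
      also have "\<dots> \<le> \<bar>a\<bar> * B1 + \<bar>b\<bar> * B2" by (intro add_mono mult_left_mono B) auto
      finally show ?thesis .
    qed
    then show ?thesis by blast
  qed
  ultimately show ?thesis by (simp add: schwartz_def it)
qed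

lemma schwartz_bounded:
  assumes "f \<in> schwartz"
  obtains A where "\<And>x. \<bar>f x\<bar> \<le> A"
  using schwartz_rapidly_decreasing[OF assms, of 0 "[]"] by auto

lemma schwartz_borel_measurable [measurable_dest]:
  assumes "f \<in> schwartz"
  shows "f \<in> borel_measurable borel"
  using schwartz_differentiable[OF assms, of "[]"]
  by (intro borel_measurable_continuous_onI continuous_at_imp_continuous_on) (auto intro: differentiable_imp_continuous_within)

text \<open>Decay of order 0 bounds every first partial derivative, and the sum of these bounds
  dominates the operator norm of the derivative.\<close>

lemma schwartz_lipschitz:
  fixes f :: "real^'n::finite \<Rightarrow> real"
  assumes "f \<in> schwartz"
  obtains B where "0 \<le> B" "\<And>x y. \<bar>f x - f y\<bar> \<le> B * norm (x - y)"
proof -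
  obtain b where b: "\<And>j x. \<bar>partial_deriv j f x\<bar> \<le> b j"
    using schwartz_rapidly_decreasing[OF assms, of 0 "[j]" for j] by simp metis
  have b0: "0 \<le> b j" for j using b[of j 0] by linarith
  have d: "(f has_derivative frechet_derivative f (at x)) (at x)" for x
    using schwartz_differentiable[OF assms, of "[]"] by (simp add: frechet_derivative_works)
  have "onorm (frechet_derivative f (at x)) \<le> sum b UNIV" for x
  proof (rule onorm_le)
    fix v :: "real^'n"
    interpret bounded_linear "frechet_derivative f (at x)" using d has_derivative_bounded_linear by blast
    have "v = (\<Sum>j\<in>UNIV. v $ j *\<^sub>R axis j 1)" by (simp add: basis_expansion scalar_mult_eq_scaleR[symmetric])
    then have "frechet_derivative f (at x) v = frechet_derivative f (at x) (\<Sum>j\<in>UNIV. v $ j *\<^sub>R axis j 1)"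
      by (rule arg_cong)
    also have "\<dots> = (\<Sum>j\<in>UNIV. v $ j * partial_deriv j f x)"
      by (simp add: partial_deriv_def sum scaleR)
    also have "norm \<dots> \<le> (\<Sum>j\<in>UNIV. norm v * b j)"
      by (intro sum_norm_le) (auto simp: abs_mult intro!: mult_mono component_le_norm_cart b)
    finally show "norm (frechet_derivative f (at x) v) \<le> sum b UNIV * norm v"
      by (simp add: sum_distrib_left mult.commute)
  qed
  then have "norm (f x - f y) \<le> sum b UNIV * norm (x - y)" for x y
    by (intro differentiable_bound[of UNIV f "\<lambda>x. frechet_derivative f (at x)"]) (auto intro: d)
  with b0 show ?thesis by (intro that[of "sum b UNIV"]) (auto intro: sum_nonneg)
qed

section \<open>The stable form and its closure\<close>

text \<open>The degenerate case \<open>c = 0\<close> is included because the forms in question are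
  only semidefinite.\<close>

lemma discriminant_le:
  fixes a b c :: real
  assumes "\<And>t. 0 \<le> a + 2 * t * b + t\<^sup>2 * c" and "0 \<le> c"
  shows "b\<^sup>2 \<le> a * c"
proof (cases "c = 0")
  case True
  have "b = 0"
  proof (rule ccontr)
    assume "b \<noteq> 0"
    \<comment> \<open>At this \<open>t\<close> the affine function \<open>a + 2 * t * b\<close>
      takes the value -1.\<close>
    with assms(1)[of "- (a + 1) / (2 * b)"] True show False by (simp add: field_simps)
  qed
  with True show ?thesis by simp
next
  case False
  have "0 \<le> (a + 2 * (- b / c) * b + (- b / c)\<^sup>2 * c) * c"
    by (intro mult_nonneg_nonneg assms)
  also have "\<dots> = a * c - b\<^sup>2" using False by (simp add: field_simps power2_eq_square)
  finally show ?thesis by simp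
qed

section \<open>Gaussian cutoffs at scale R\<close>

definition radial_cutoff :: "real \<Rightarrow> real^'n::finite \<Rightarrow> real" where
  "radial_cutoff R x = gauss_cutoff (x /\<^sub>R R)"

lemma radial_cutoff_eq: "radial_cutoff R x = exp (- (1 / R\<^sup>2) * (norm x)\<^sup>2)"
  by (simp add: radial_cutoff_def gauss_cutoff_def power_mult_distrib power_inverse divide_inverse mult.commute)

lemma radial_cutoff_bounds [simp]: "0 \<le> radial_cutoff R x" "radial_cutoff R x \<le> 1"
  by (auto simp: radial_cutoff_eq)

lemma radial_cutoff_abs [simp]: "\<bar>radial_cutoff R x\<bar> \<le> 1" "\<bar>radial_cutoff R x\<bar> = radial_cutoff R x"
  by auto

lemma borel_measurable_radial_cutoff [measurable]: "radial_cutoff R \<in> borel_measurable borel"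
  unfolding radial_cutoff_eq[abs_def] by measurable

lemma trig_radial_cutoff_schwartz:
  assumes "0 < R"
  shows "(\<lambda>x. cos (\<xi> \<bullet> x + \<theta>) * radial_cutoff R x) \<in> schwartz"
    and "(\<lambda>x. x $ j * radial_cutoff R x) \<in> schwartz"
    and "radial_cutoff R \<in> schwartz"
proof -
  have c: "0 < 1 / R\<^sup>2" using assms by simp
  show "(\<lambda>x. cos (\<xi> \<bullet> x + \<theta>) * radial_cutoff R x) \<in> schwartz"
    unfolding radial_cutoff_eq by (rule gauss_trig_schwartz[OF gauss_trig.base c])
  have b: "radial_cutoff R \<in> gauss_trig 0 (1 / R\<^sup>2)"
    using gauss_trig.base[of 0 0 "1 / R\<^sup>2"] by (simp add: radial_cutoff_eq[abs_def])
  then show "radial_cutoff R \<in> schwartz" "(\<lambda>x. x $ j * radial_cutoff R x) \<in> schwartz"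
    by (auto intro: gauss_trig_schwartz[OF _ c] gauss_trig.coord)
qed

text \<open>Scaling from \<open>R = 1\<close>. The decay of the slope like \<open>1 / R\<close> is
  what makes the energy of wide Gaussians vanish.\<close>

lemma radial_cutoff_lipschitz:
  obtains L where "0 \<le> L" "\<And>R x y. 0 < R \<Longrightarrow> \<bar>radial_cutoff R (x :: real^'n::finite) - radial_cutoff R y\<bar> \<le> L / R * norm (x - y)"
proof -
  obtain L where L: "0 \<le> L" "\<And>x y. \<bar>radial_cutoff 1 (x :: real^'n) - radial_cutoff 1 y\<bar> \<le> L * norm (x - y)"
    using schwartz_lipschitz[OF trig_radial_cutoff_schwartz(3)[of 1]] by auto
  have "\<bar>radial_cutoff R x - radial_cutoff R y\<bar> \<le> L / R * norm (x - y)" if "0 < R" for R and x y :: "real^'n"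
    using L(2)[of "x /\<^sub>R R" "y /\<^sub>R R"] that
    by (simp add: radial_cutoff_def scaleR_diff_right[symmetric] divide_inverse mult.assoc)
  with L(1) show ?thesis using that by blast
qed

text \<open>Scaling again: the coordinate contributes a factor \<open>R\<close> that cancels the
  \<open>1 / R\<close> of the slope, so one constant serves all \<open>R\<close>.\<close>

lemma coord_radial_cutoff_lipschitz:
  obtains L where "0 \<le> L"
    "\<And>R x y. 0 < R \<Longrightarrow> \<bar>x $ j * radial_cutoff R (x :: real^'n::finite) - y $ j * radial_cutoff R y\<bar> \<le> L * norm (x - y)"
proof -
  obtain L where L: "0 \<le> L" "\<And>x y. \<bar>x $ j * radial_cutoff 1 (x :: real^'n) - y $ j * radial_cutoff 1 y\<bar> \<le> L * norm (x - y)"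
    using schwartz_lipschitz[OF trig_radial_cutoff_schwartz(2)[of 1 j]] by auto
  have "\<bar>x $ j * radial_cutoff R x - y $ j * radial_cutoff R y\<bar> \<le> L * norm (x - y)" if "0 < R" for R and x y :: "real^'n"
  proof -
    have "\<bar>x $ j * radial_cutoff R x - y $ j * radial_cutoff R y\<bar> =
       R * \<bar>(x /\<^sub>R R) $ j * radial_cutoff 1 (x /\<^sub>R R) - (y /\<^sub>R R) $ j * radial_cutoff 1 (y /\<^sub>R R)\<bar>"
      using that by (simp add: radial_cutoff_def abs_mult_pos' right_diff_distrib field_simps)
    also have "\<dots> \<le> R * (L * norm (x /\<^sub>R R - y /\<^sub>R R))"
      using that by (intro mult_left_mono L) auto
    also have "\<dots> = L * norm (x - y)"
      using that by (simp add: scaleR_diff_right[symmetric])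
    finally show ?thesis .
  qed
  with L(1) show ?thesis using that by blast
qed

lemma radial_cutoff_tendsto: "((\<lambda>R. radial_cutoff R x) \<longlongrightarrow> 1) at_top"
proof -
  have "((\<lambda>R::real. 1 / R\<^sup>2) \<longlongrightarrow> 0) at_top" by real_asymp
  then have "((\<lambda>R. exp (- (1 / R\<^sup>2) * (norm x)\<^sup>2)) \<longlongrightarrow> exp (- 0 * (norm x)\<^sup>2)) at_top"
    by (intro tendsto_intros)
  then show ?thesis by (simp add: radial_cutoff_eq)
qed

lemma bounded_lipschitz_increment:
  fixes f :: "'a::real_normed_vector \<Rightarrow> real"
  assumes "\<And>x. \<bar>f x\<bar> \<le> a" "\<And>x y. \<bar>f x - f y\<bar> \<le> b * norm (x - y)" "0 \<le> b"
  shows "\<bar>f (x + u) - f x\<bar> \<le> (2 * a + b) * min 1 (norm u)"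
proof -
  have a: "0 \<le> a" using assms(1)[of x] by linarith
  show ?thesis
  proof (cases "norm u \<le> 1")
    case True
    have "\<bar>f (x + u) - f x\<bar> \<le> b * norm u" using assms(2)[of "x + u" x] by simp
    also have "\<dots> \<le> (2 * a + b) * norm u" using a by (intro mult_right_mono) auto
    finally show ?thesis using True by simp
  next
    case False
    then show ?thesis using assms(1)[of "x + u"] assms(1)[of x] assms(3) by (simp add: abs_le_iff)
  qed
qed

section \<open>Sigma-finiteness and symmetry of the Levy measure\<close>

lemma sets_levy_nu [simp, measurable_cong]: "sets (levy_nu \<alpha>) = sets borel"
  by (simp add: levy_nu_def)

text \<open>Sigma-finiteness makes an inner integral against \<open>levy_nu\<close> a measurable
  function of the outer variable.\<close>

lemma sigma_finite_levy_nu: "sigma_finite_measure (levy_nu \<alpha> :: (real^'n::finite) measure)"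
  unfolding levy_nu_def
  by (subst sigma_finite_measure.sigma_finite_iff_density_finite[OF sigma_finite_lborel]) auto

lemma distr_lborel_uminus: "distr lborel borel uminus = (lborel :: 'a::euclidean_space measure)"
  using lborel_affine[of "-1" "0::'a"] by (simp add: density_1)

lemma integral_levy_nu_uminus:
  fixes f :: "real^'n::finite \<Rightarrow> real"
  assumes [measurable]: "f \<in> borel_measurable borel" and "1 < \<alpha>" "\<alpha> < 2"
  shows "(LINT u|levy_nu \<alpha>. f (- u)) = (LINT u|levy_nu \<alpha>. f u)"
proof -
  let ?k = "\<lambda>u::real^'n. stable_const \<alpha> CARD('n) * norm u powr (- real CARD('n) - \<alpha>)"
  have k: "0 \<le> ?k u" for u using stable_const_pos[OF assms(2,3), of "CARD('n)"] by simp
  have "(LINT u|levy_nu \<alpha>. f u) = (LINT u|lborel. ?k u * f u)"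
    unfolding levy_nu_def using k by (subst integral_density) auto
  also have "\<dots> = (LINT u|distr lborel borel uminus. ?k u * f u)" by (simp only: distr_lborel_uminus)
  also have "\<dots> = (LINT u|lborel. ?k u * f (- u))" by (subst integral_distr) auto
  also have "\<dots> = (LINT u|levy_nu \<alpha>. f (- u))"
    unfolding levy_nu_def using k by (subst integral_density) auto
  finally show ?thesis ..
qed

section \<open>Bounds for the form on Lipschitz functions\<close>

locale stable_form_prob =
  fixes \<alpha> :: real and \<mu> :: "(real^'n::finite) measure"
  assumes \<alpha>: "1 < \<alpha>" "\<alpha> < 2" and \<mu>: "borel_prob \<mu>"
begin

abbreviation \<nu> :: "(real^'n) measure" where "\<nu> \<equiv> levy_nu \<alpha>"

sublocale prob_space \<mu> using \<mu> by (simp add: borel_prob_def)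

sublocale N: sigma_finite_measure \<nu> by (rule sigma_finite_levy_nu)

lemma sets_\<mu> [measurable_cong]: "sets \<mu> = sets borel" using \<mu> by (simp add: borel_prob_def)

definition levy_mass :: real where "levy_mass = (LINT u|\<nu>. levy_weight u)"

text \<open>The roles are asymmetric: \<open>f\<close> stands for a bounded test function,
  \<open>g\<close> for a truncated coordinate, whose increments are bounded uniformly in the
  truncation only by a multiple of \<open>norm u\<close>.\<close>

lemma increments_integrable:
  assumes [measurable]: "f \<in> borel_measurable borel" "g \<in> borel_measurable borel"
    and f: "\<And>u. \<bar>f (x + u) - f x\<bar> \<le> A * min 1 (norm u)" and g: "\<And>u. \<bar>g (x + u) - g x\<bar> \<le> B * norm u"
    and A: "0 \<le> A"
  shows "\<And>u. \<bar>(f (x + u) - f x) * (g (x + u) - g x)\<bar> \<le> A * B * levy_weight u"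
    and "integrable \<nu> (\<lambda>u. (f (x + u) - f x) * (g (x + u) - g x))"
    and "\<bar>LINT u|\<nu>. (f (x + u) - f x) * (g (x + u) - g x)\<bar> \<le> A * B * levy_mass"
proof -
  show b: "\<bar>(f (x + u) - f x) * (g (x + u) - g x)\<bar> \<le> A * B * levy_weight u" for u
  proof -
    have "\<bar>(f (x + u) - f x) * (g (x + u) - g x)\<bar> \<le> (A * min 1 (norm u)) * (B * norm u)"
      unfolding abs_mult using A by (intro mult_mono f g) auto
    then show ?thesis by (simp add: levy_weight_def mult_ac)
  qed
  have iw: "integrable \<nu> (\<lambda>u. A * B * levy_weight u)"
    by (intro integrable_mult_right integrable_levy_weight \<alpha>)
  show i: "integrable \<nu> (\<lambda>u. (f (x + u) - f x) * (g (x + u) - g x))"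
    by (rule Bochner_Integration.integrable_bound[OF iw]) (auto intro!: AE_I2 order_trans[OF b])
  have "\<bar>LINT u|\<nu>. (f (x + u) - f x) * (g (x + u) - g x)\<bar> \<le> (LINT u|\<nu>. \<bar>(f (x + u) - f x) * (g (x + u) - g x)\<bar>)"
    by (rule integral_abs_bound)
  also have "\<dots> \<le> (LINT u|\<nu>. A * B * levy_weight u)"
    by (intro integral_mono integrable_abs i iw b)
  finally show "\<bar>LINT u|\<nu>. (f (x + u) - f x) * (g (x + u) - g x)\<bar> \<le> A * B * levy_mass"
    by (simp add: levy_mass_def)
qed

lemma measurable_increments_integral [measurable]:
  fixes f g :: "real^'n \<Rightarrow> real"
  assumes [measurable]: "f \<in> borel_measurable borel" "g \<in> borel_measurable borel"
  shows "(\<lambda>x. LINT u|\<nu>. (f (x + u) - f x) * (g (x + u) - g x)) \<in> borel_measurable borel"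
  by measurable

lemma stable_form_bound:
  assumes [measurable]: "f \<in> borel_measurable borel" "g \<in> borel_measurable borel"
    and f: "\<And>x u. \<bar>f (x + u) - f x\<bar> \<le> A * min 1 (norm u)" and g: "\<And>x u. \<bar>g (x + u) - g x\<bar> \<le> B * norm u"
    and A: "0 \<le> A"
  shows "\<bar>stable_form \<alpha> \<mu> f g\<bar> \<le> A * B * levy_mass"
proof -
  note b = increments_integrable(3)[OF assms(1,2) f g A]
  have [measurable]: "(\<lambda>x. LINT u|\<nu>. (f (x + u) - f x) * (g (x + u) - g x)) \<in> borel_measurable \<mu>"
    by measurable
  have i: "integrable \<mu> (\<lambda>x. LINT u|\<nu>. (f (x + u) - f x) * (g (x + u) - g x))"
    by (rule integrable_const_bound[where B="A * B * levy_mass"]) (use b in auto)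
  have "\<bar>stable_form \<alpha> \<mu> f g\<bar> \<le> (LINT x|\<mu>. \<bar>LINT u|\<nu>. (f (x + u) - f x) * (g (x + u) - g x)\<bar>)"
    unfolding stable_form_def by (rule integral_abs_bound)
  also have "\<dots> \<le> A * B * levy_mass"
    by (rule integral_le_const) (use i b in auto)
  finally show ?thesis .
qed

text \<open>The Poincare inequality speaks of extended nonnegative integrals, the form of Bochner
  integrals; for these functions the two agree.\<close>

lemma nn_integral_stable_form:
  assumes [measurable]: "f \<in> borel_measurable borel"
    and f: "\<And>x u. \<bar>f (x + u) - f x\<bar> \<le> A * min 1 (norm u)" and A: "0 \<le> A"
  shows "(\<integral>\<^sup>+x. (\<integral>\<^sup>+u. ennreal (\<bar>f (x + u) - f x\<bar>\<^sup>2) \<partial>\<nu>) \<partial>\<mu>) = ennreal (stable_form \<alpha> \<mu> f f)"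
proof -
  have f2: "\<bar>f (x + u) - f x\<bar> \<le> A * norm u" for x u
    using f[of x u] mult_left_mono[OF min.cobounded2 A, of 1 "norm u"] by linarith
  note i = increments_integrable(2,3)[OF assms(1,1) f f2 A]
  have [measurable]: "(\<lambda>x. LINT u|\<nu>. (f (x + u) - f x) * (f (x + u) - f x)) \<in> borel_measurable \<mu>"
    by measurable
  have "(\<integral>\<^sup>+u. ennreal (\<bar>f (x + u) - f x\<bar>\<^sup>2) \<partial>\<nu>) = ennreal (LINT u|\<nu>. (f (x + u) - f x) * (f (x + u) - f x))" for x
    using nn_integral_eq_integral[OF i(1)[of x]] by (simp add: power2_eq_square)
  moreover have "integrable \<mu> (\<lambda>x. LINT u|\<nu>. (f (x + u) - f x) * (f (x + u) - f x))"
    by (rule integrable_const_bound[where B="A * A * levy_mass"]) (use i(2) in auto)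
  ultimately show ?thesis
    unfolding stable_form_def by (simp add: nn_integral_eq_integral)
qed

lemma schwartz_increment:
  fixes f :: "real^'n \<Rightarrow> real"
  assumes "f \<in> schwartz"
  obtains A where "0 \<le> A" "\<And>x u. \<bar>f (x + u) - f x\<bar> \<le> A * min 1 (norm u)"
proof -
  obtain a where a: "\<And>x. \<bar>f x\<bar> \<le> a" using schwartz_bounded[OF assms] by blast
  obtain b where b: "0 \<le> b" "\<And>x y. \<bar>f x - f y\<bar> \<le> b * norm (x - y)" using schwartz_lipschitz[OF assms] by blast
  have "0 \<le> a" using a[of 0] by linarith
  then show ?thesis
    using bounded_lipschitz_increment[OF a b(2,1)] b(1) by (intro that[of "2 * a + b"]) auto
qed

lemma integrable_schwartz:
  assumes "f \<in> schwartz"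
  shows "integrable \<mu> f"
proof -
  note [measurable] = schwartz_borel_measurable[OF assms]
  obtain a where a: "\<And>x. \<bar>f x\<bar> \<le> a" using schwartz_bounded[OF assms] by blast
  show ?thesis by (rule integrable_const_bound[where B=a]) (use a in auto)
qed

lemma integrable_schwartz_mult:
  assumes "f \<in> schwartz" "g \<in> schwartz"
  shows "integrable \<mu> (\<lambda>x. f x * g x)"
proof -
  note [measurable] = assms[THEN schwartz_borel_measurable]
  obtain a where a: "\<And>x. \<bar>f x\<bar> \<le> a" using schwartz_bounded[OF assms(1)] by blast
  obtain b where b: "\<And>x. \<bar>g x\<bar> \<le> b" using schwartz_bounded[OF assms(2)] by blast
  have "\<bar>f x * g x\<bar> \<le> a * b" for x
    unfolding abs_mult using a[of x] b[of x] by (intro mult_mono) auto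
  then show ?thesis by (intro integrable_const_bound[where B="a * b"]) auto
qed

end

section \<open>The closed extension and the constant functions\<close>

locale stable_form_closure = stable_form_prob \<alpha> \<mu> for \<alpha> and \<mu> :: "(real^'n::finite) measure" +
  fixes D :: "(real^'n \<Rightarrow> real) set" and E :: "(real^'n) form"
  assumes closure: "smallest_closed_extension \<mu> schwartz (stable_form \<alpha> \<mu>) D E"
begin

lemma closed: "closed_form \<mu> D E" and schwartz_subset: "schwartz \<subseteq> D"
  and E_schwartz: "\<And>f g. f \<in> schwartz \<Longrightarrow> g \<in> schwartz \<Longrightarrow> E f g = stable_form \<alpha> \<mu> f g"
  using closure by (auto simp: smallest_closed_extension_def form_extends_def)

lemma symmetric: "symmetric_form \<mu> D E" using closed by (simp add: closed_form_def)

lemma D_L2: "f \<in> D \<Longrightarrow> f \<in> L2 \<mu>"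
  and E_cong: "f \<in> D \<Longrightarrow> g \<in> L2 \<mu> \<Longrightarrow> AE x in \<mu>. f x = g x \<Longrightarrow> g \<in> D \<and> (\<forall>h\<in>D. E f h = E g h)"
  and D_lincomb: "f \<in> D \<Longrightarrow> g \<in> D \<Longrightarrow> (\<lambda>x. a * f x + b * g x) \<in> D"
  and E_commute: "f \<in> D \<Longrightarrow> g \<in> D \<Longrightarrow> E f g = E g f"
  and E_lincomb: "f \<in> D \<Longrightarrow> g \<in> D \<Longrightarrow> h \<in> D \<Longrightarrow> E (\<lambda>x. a * f x + b * g x) h = a * E f h + b * E g h"
  and E_nonneg: "f \<in> D \<Longrightarrow> 0 \<le> E f f"
  using symmetric unfolding symmetric_form_def by blast+

lemma E_quadratic:
  assumes "f \<in> D" "g \<in> D"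
  shows "E (\<lambda>x. a * f x + b * g x) (\<lambda>x. a * f x + b * g x) = a\<^sup>2 * E f f + 2 * a * b * E f g + b\<^sup>2 * E g g"
proof -
  let ?h = "\<lambda>x. a * f x + b * g x"
  have "E ?h ?h = a * E f ?h + b * E g ?h" by (intro E_lincomb D_lincomb assms)
  also have "E f ?h = a * E f f + b * E g f"
    using E_commute[OF assms(1) D_lincomb[OF assms]] E_lincomb[OF assms assms(1)] by simp
  also have "E g ?h = a * E f g + b * E g g"
    using E_commute[OF assms(2) D_lincomb[OF assms]] E_lincomb[OF assms assms(2)] by simp
  finally show ?thesis using E_commute[OF assms] by (simp add: algebra_simps power2_eq_square)
qed

text \<open>The parallelogram identity, with the energy of the sum dropped.\<close>

lemma E_diff_le:
  assumes "f \<in> D" "g \<in> D"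
  shows "E (\<lambda>x. f x - g x) (\<lambda>x. f x - g x) \<le> 2 * E f f + 2 * E g g"
  using E_quadratic[OF assms, of 1 1] E_quadratic[OF assms, of 1 "-1"]
    E_nonneg[OF D_lincomb[OF assms, of 1 1]] by simp

lemma E_cauchy_schwarz:
  assumes "f \<in> D" "g \<in> D"
  shows "(E f g)\<^sup>2 \<le> E f f * E g g"
proof (rule discriminant_le)
  show "0 \<le> E f f + 2 * t * E f g + t\<^sup>2 * E g g" for t
    using E_quadratic[OF assms, of 1 t] E_nonneg[OF D_lincomb[OF assms, of 1 t]] by simp
qed (rule E_nonneg[OF assms(2)])

lemma D_diff: "f \<in> D \<Longrightarrow> g \<in> D \<Longrightarrow> (\<lambda>x. f x - g x) \<in> D"
  using D_lincomb[of f g 1 "-1"] by simp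

lemma L2_inner_tendsto_radial_cutoff:
  "(\<lambda>n. L2_inner \<mu> (\<lambda>x. radial_cutoff (real (Suc n)) x - 1) (\<lambda>x. radial_cutoff (real (Suc n)) x - 1)) \<longlonglongrightarrow> 0"
proof -
  have "(\<lambda>n. LINT x|\<mu>. (radial_cutoff (real (Suc n)) x - 1) * (radial_cutoff (real (Suc n)) x - 1)) \<longlonglongrightarrow> (LINT x|\<mu>. 0)"
  proof (rule integral_dominated_convergence[where w="\<lambda>_. 1"])
    show "AE x in \<mu>. (\<lambda>n. (radial_cutoff (real (Suc n)) x - 1) * (radial_cutoff (real (Suc n)) x - 1)) \<longlonglongrightarrow> 0"
    proof (rule AE_I2)
      fix x :: "real^'n"
      have "filterlim (\<lambda>n. real (Suc n)) at_top sequentially"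
        by (rule filterlim_compose[OF filterlim_real_sequentially filterlim_Suc])
      from filterlim_compose[OF radial_cutoff_tendsto this]
      have "(\<lambda>n. radial_cutoff (real (Suc n)) x - 1) \<longlonglongrightarrow> 1 - 1" by (intro tendsto_intros)
      from tendsto_mult[OF this this]
      show "(\<lambda>n. (radial_cutoff (real (Suc n)) x - 1) * (radial_cutoff (real (Suc n)) x - 1)) \<longlonglongrightarrow> 0" by simp
    qed
    show "AE x in \<mu>. norm ((radial_cutoff (real (Suc n)) x - 1) * (radial_cutoff (real (Suc n)) x - 1)) \<le> 1" for n
    proof (rule AE_I2)
      fix x :: "real^'n"
      have "\<bar>radial_cutoff (real (Suc n)) x - 1\<bar> \<le> 1"
        using radial_cutoff_bounds[of "real (Suc n)" x] by (simp add: abs_le_iff del: radial_cutoff_bounds)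
      then show "norm ((radial_cutoff (real (Suc n)) x - 1) * (radial_cutoff (real (Suc n)) x - 1)) \<le> 1"
        unfolding real_norm_def abs_mult by (intro mult_le_one) auto
    qed
  qed simp_all
  then show ?thesis by (simp add: L2_inner_def)
qed

text \<open>One increment is estimated uniformly by \<open>(2 + L) * min 1 (norm u)\<close>, the
  other by the slope \<open>L / R\<close> times \<open>norm u\<close>, so the energy is of order
  \<open>1 / R\<close>.\<close>

lemma E_tendsto_radial_cutoff:
  "(\<lambda>n. E (radial_cutoff (real (Suc n))) (radial_cutoff (real (Suc n)))) \<longlonglongrightarrow> 0"
proof -
  obtain L where L: "0 \<le> L" "\<And>R x y. 0 < R \<Longrightarrow> \<bar>radial_cutoff R (x :: real^'n) - radial_cutoff R y\<bar> \<le> L / R * norm (x - y)"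
    using radial_cutoff_lipschitz by blast
  have b: "\<bar>E (radial_cutoff (real (Suc n))) (radial_cutoff (real (Suc n)))\<bar> \<le> (2 + L) * L * levy_mass * (1 / real (Suc n))" for n
  proof -
    let ?R = "real (Suc n)"
    have R: "0 < ?R" by simp
    have le: "L / ?R \<le> L / 1" using L(1) by (intro divide_left_mono) auto
    have "\<bar>radial_cutoff ?R (x + u) - radial_cutoff ?R x\<bar> \<le> (2 * 1 + L) * min 1 (norm u)" for x u :: "real^'n"
    proof (rule bounded_lipschitz_increment[OF _ _ L(1)])
      fix x y :: "real^'n"
      have "L / ?R * norm (x - y) \<le> L * norm (x - y)"
        using le by (intro mult_right_mono) auto
      with L(2)[OF R, of x y] show "\<bar>radial_cutoff ?R x - radial_cutoff ?R y\<bar> \<le> L * norm (x - y)" by linarith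
    qed simp
    moreover have "\<bar>radial_cutoff ?R (x + u) - radial_cutoff ?R x\<bar> \<le> (L / ?R) * norm u" for x u :: "real^'n"
      using L(2)[OF R, of "x + u" x] by simp
    ultimately have "\<bar>stable_form \<alpha> \<mu> (radial_cutoff ?R) (radial_cutoff ?R)\<bar> \<le> (2 * 1 + L) * (L / ?R) * levy_mass"
      using L(1) by (intro stable_form_bound) auto
    then show ?thesis
      using R by (simp only: E_schwartz trig_radial_cutoff_schwartz) (simp add: mult_ac)
  qed
  show ?thesis
  proof (rule Lim_null_comparison)
    show "\<forall>\<^sub>F n in sequentially. norm (E (radial_cutoff (real (Suc n))) (radial_cutoff (real (Suc n)))) \<le>
        (2 + L) * L * levy_mass * (1 / real (Suc n))"
      using b by simp
    show "(\<lambda>n. (2 + L) * L * levy_mass * (1 / real (Suc n))) \<longlonglongrightarrow> 0"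
      by (intro tendsto_mult_right_zero LIMSEQ_Suc[OF lim_1_over_n])
  qed
qed

lemma D_L2_inner_integrable: "f \<in> D \<Longrightarrow> integrable \<mu> (\<lambda>x. f x * f x)"
  using D_L2[of f] by (simp add: L2_def power2_eq_square)

lemma L2_inner_nonneg: "0 \<le> L2_inner \<mu> f f"
  unfolding L2_inner_def by (rule Bochner_Integration.integral_nonneg) simp

lemma L2_inner_diff_le:
  assumes "integrable \<mu> (\<lambda>x. f x * f x)" "integrable \<mu> (\<lambda>x. g x * g x)"
    "f \<in> borel_measurable \<mu>" "g \<in> borel_measurable \<mu>"
  shows "L2_inner \<mu> (\<lambda>x. f x - g x) (\<lambda>x. f x - g x) \<le> 2 * L2_inner \<mu> f f + 2 * L2_inner \<mu> g g"
    and "integrable \<mu> (\<lambda>x. (f x - g x) * (f x - g x))"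
proof -
  have p: "(a - b) * (a - b) \<le> 2 * (a * a) + 2 * (b * b)" for a b :: real
    using zero_le_power2[of "a + b"] by (simp add: power2_eq_square algebra_simps)
  have i: "integrable \<mu> (\<lambda>x. 2 * (f x * f x) + 2 * (g x * g x))" using assms by simp
  show j: "integrable \<mu> (\<lambda>x. (f x - g x) * (f x - g x))"
    by (rule Bochner_Integration.integrable_bound[OF i]) (use assms(3,4) p in auto)
  have "(LINT x|\<mu>. (f x - g x) * (f x - g x)) \<le> (LINT x|\<mu>. 2 * (f x * f x) + 2 * (g x * g x))"
    by (intro integral_mono i j p)
  then show "L2_inner \<mu> (\<lambda>x. f x - g x) (\<lambda>x. f x - g x) \<le> 2 * L2_inner \<mu> f f + 2 * L2_inner \<mu> g g"
    using assms by (simp add: L2_inner_def)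
qed

text \<open>Truncated coordinates are only Schwartz up to a constant, so the constants have to be placed
  in the domain: they are limits of wide Gaussians, whose energy tends to zero.\<close>

lemma const_1_in_D: "(\<lambda>_. 1) \<in> D" and E_const_1: "h \<in> D \<Longrightarrow> E (\<lambda>_. 1) h = 0"
proof -
  define F :: "nat \<Rightarrow> real^'n \<Rightarrow> real" where "F n = radial_cutoff (real (Suc n))" for n
  have FD: "F n \<in> D" for n
    using trig_radial_cutoff_schwartz(3)[of "real (Suc n)"] schwartz_subset by (auto simp: F_def)
  \<comment> \<open>This acts as a squared form distance of \<open>F n\<close> to 1 while 1 is not
    yet known to lie in \<open>D\<close>. Since the energies themselves tend to 0, the energy of
    \<open>F m - F n\<close> is bounded without any cancellation.\<close>
  define a where "a n = E (F n) (F n) + L2_inner \<mu> (\<lambda>x. F n x - 1) (\<lambda>x. F n x - 1)" for n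
  have EF: "(\<lambda>n. E (F n) (F n)) \<longlonglongrightarrow> 0" and LF: "(\<lambda>n. L2_inner \<mu> (\<lambda>x. F n x - 1) (\<lambda>x. F n x - 1)) \<longlonglongrightarrow> 0"
    unfolding F_def by (rule E_tendsto_radial_cutoff L2_inner_tendsto_radial_cutoff)+
  have a: "a \<longlonglongrightarrow> 0" using tendsto_add[OF EF LF] by (simp add: a_def[abs_def])
  have Fm: "F n \<in> borel_measurable \<mu>" for n unfolding F_def by measurable
  have F1: "integrable \<mu> (\<lambda>x. (F n x - 1) * (F n x - 1))" for n
    using D_L2_inner_integrable[OF FD] Fm by (intro L2_inner_diff_le) auto
  have cau: "form_sq1 \<mu> E (\<lambda>x. F m x - F n x) \<le> 2 * a m + 2 * a n" for m n
  proof -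
    have "L2_inner \<mu> (\<lambda>x. F m x - F n x) (\<lambda>x. F m x - F n x) \<le>
       2 * L2_inner \<mu> (\<lambda>x. F m x - 1) (\<lambda>x. F m x - 1) + 2 * L2_inner \<mu> (\<lambda>x. F n x - 1) (\<lambda>x. F n x - 1)"
      using L2_inner_diff_le(1)[of "\<lambda>x. F m x - 1" "\<lambda>x. F n x - 1"] F1 Fm by simp
    with E_diff_le[OF FD FD, of m n] show ?thesis by (simp add: form_sq1_def a_def)
  qed
  have cauchy: "\<exists>N. \<forall>m\<ge>N. \<forall>n\<ge>N. form_sq1 \<mu> E (\<lambda>x. F m x - F n x) < e" if "0 < e" for e
  proof -
    from LIMSEQ_D[OF a, of "e / 4"] that obtain N where N: "\<And>n. N \<le> n \<Longrightarrow> \<bar>a n\<bar> < e / 4" by auto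
    have "form_sq1 \<mu> E (\<lambda>x. F m x - F n x) < e" if "N \<le> m" "N \<le> n" for m n
      using cau[of m n] N[OF that(1)] N[OF that(2)] by linarith
    then show ?thesis by blast
  qed
  \<comment> \<open>Closedness provides some limit \<open>f\<close>; the estimate \<open>le\<close>
    then shows that it is 1 almost everywhere and has no energy.\<close>
  have "\<exists>f\<in>D. (\<lambda>n. form_sq1 \<mu> E (\<lambda>x. F n x - f x)) \<longlonglongrightarrow> 0"
    using closed FD cauchy by (intro closed_form_def[THEN iffD1, THEN conjunct2, rule_format]) auto
  then obtain f where f: "f \<in> D" and lim: "(\<lambda>n. form_sq1 \<mu> E (\<lambda>x. F n x - f x)) \<longlonglongrightarrow> 0"
    by blast
  have fm[measurable]: "f \<in> borel_measurable \<mu>" using D_L2[OF f] by (simp add: L2_def)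
  have le: "L2_inner \<mu> (\<lambda>x. f x - 1) (\<lambda>x. f x - 1) + E f f \<le>
     2 * form_sq1 \<mu> E (\<lambda>x. F n x - f x) + 2 * a n" for n
  proof -
    have "L2_inner \<mu> (\<lambda>x. f x - 1) (\<lambda>x. f x - 1) \<le>
       2 * L2_inner \<mu> (\<lambda>x. F n x - 1) (\<lambda>x. F n x - 1) + 2 * L2_inner \<mu> (\<lambda>x. F n x - f x) (\<lambda>x. F n x - f x)"
      using L2_inner_diff_le(1)[of "\<lambda>x. F n x - 1" "\<lambda>x. F n x - f x"] F1[of n]
        D_L2_inner_integrable[OF D_diff[OF FD f]] Fm[of n] by simp
    moreover have "E f f \<le> 2 * E (F n) (F n) + 2 * E (\<lambda>x. F n x - f x) (\<lambda>x. F n x - f x)"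
      using E_diff_le[OF FD D_diff[OF FD f], of n n] by simp
    ultimately show ?thesis by (simp add: form_sq1_def a_def)
  qed
  have "(\<lambda>n. 2 * form_sq1 \<mu> E (\<lambda>x. F n x - f x) + 2 * a n) \<longlonglongrightarrow> 2 * 0 + 2 * 0"
    by (intro tendsto_intros lim a)
  then have "L2_inner \<mu> (\<lambda>x. f x - 1) (\<lambda>x. f x - 1) + E f f \<le> 2 * 0 + 2 * 0"
    by (rule LIMSEQ_le_const) (use le in blast)
  then have z: "L2_inner \<mu> (\<lambda>x. f x - 1) (\<lambda>x. f x - 1) = 0" "E f f = 0"
    using L2_inner_nonneg[of "\<lambda>x. f x - 1"] E_nonneg[OF f] by auto
  have "integrable \<mu> (\<lambda>x. (f x - 1) * (f x - 1))"
    using D_L2_inner_integrable[OF f] by (intro L2_inner_diff_le) auto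
  then have "AE x in \<mu>. (f x - 1) * (f x - 1) = 0"
    using z(1) by (subst (asm) L2_inner_def, subst (asm) integral_nonneg_eq_0_iff_AE) auto
  then have ae: "AE x in \<mu>. f x = 1" by simp
  \<comment> \<open>Invariance under modification on null sets passes from \<open>f\<close> to the
    constant itself.\<close>
  have "(\<lambda>_. 1) \<in> L2 \<mu>" by (simp add: L2_def)
  from E_cong[OF f this ae] have 1: "(\<lambda>_. 1) \<in> D" "\<And>h. h \<in> D \<Longrightarrow> E (\<lambda>_. 1) h = E f h" by auto
  show "(\<lambda>_. 1) \<in> D" by fact
  assume h: "h \<in> D"
  from E_cauchy_schwarz[OF f h] z(2) have "E f h = 0" by simp
  with 1(2)[OF h] show "E (\<lambda>_. 1) h = 0" by simp
qed

lemma E_add_const: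
  assumes "f \<in> D"
  shows "(\<lambda>x. f x - c) \<in> D" "E (\<lambda>x. f x - c) (\<lambda>x. f x - c) = E f f"
proof -
  show "(\<lambda>x. f x - c) \<in> D" using D_lincomb[OF assms const_1_in_D, of 1 "-c"] by simp
  show "E (\<lambda>x. f x - c) (\<lambda>x. f x - c) = E f f"
    using E_quadratic[OF assms const_1_in_D, of 1 "-c"] E_const_1[OF assms] E_const_1[OF const_1_in_D]
      E_commute[OF assms const_1_in_D] by simp
qed

end

section \<open>The Stein identity\<close>

lemma cos_lipschitz: "\<bar>cos a - cos b\<bar> \<le> \<bar>a - b\<bar>" for a b :: real
  using field_differentiable_bound[of UNIV cos "\<lambda>x. - sin x" 1 a b]
  by (auto intro!: derivative_eq_intros)

lemma cos_inner_lipschitz: "\<bar>cos (\<xi> \<bullet> x + \<theta>) - cos (\<xi> \<bullet> y + \<theta>)\<bar> \<le> norm \<xi> * norm (x - y)"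
proof -
  have "\<bar>cos (\<xi> \<bullet> x + \<theta>) - cos (\<xi> \<bullet> y + \<theta>)\<bar> \<le> \<bar>\<xi> \<bullet> (x - y)\<bar>"
    using cos_lipschitz[of "\<xi> \<bullet> x + \<theta>" "\<xi> \<bullet> y + \<theta>"] by (simp add: inner_diff_right)
  also have "\<dots> \<le> norm \<xi> * norm (x - y)" by (rule Cauchy_Schwarz_ineq2)
  finally show ?thesis .
qed

lemma cos_inner_increment: "\<bar>cos (\<xi> \<bullet> (x + u) + \<theta>) - cos (\<xi> \<bullet> x + \<theta>)\<bar> \<le> (2 + norm \<xi>) * min 1 (norm u)"
  using bounded_lipschitz_increment[of "\<lambda>x. cos (\<xi> \<bullet> x + \<theta>)" 1 "norm \<xi>", OF _ cos_inner_lipschitz] by simp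

context stable_form_prob
begin

text \<open>The \<open>j\<close>-th component of the gradient of the Levy exponent
  \<open>norm \<xi> powr \<alpha> / 2\<close>, as obtained by differentiating the integral of
  \<open>1 - cos (\<xi> \<bullet> u)\<close> formally.\<close>

definition drift :: "'n \<Rightarrow> real^'n \<Rightarrow> real" where
  "drift j \<xi> = (LINT u|\<nu>. u $ j * sin (\<xi> \<bullet> u))"

lemma coord_cos_increment_integrable:
  "integrable \<nu> (\<lambda>u. u $ j * (cos (\<xi> \<bullet> (x + u) + \<theta>) - cos (\<xi> \<bullet> x + \<theta>)))"
proof -
  have "\<bar>(x + u) $ j - x $ j\<bar> \<le> 1 * norm u" for u :: "real^'n" by (simp add: component_le_norm_cart)
  from increments_integrable(2)[of "\<lambda>x. cos (\<xi> \<bullet> x + \<theta>)" "\<lambda>x. x $ j", OF _ _ cos_inner_increment this]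
  show ?thesis by (simp add: mult.commute)
qed

lemma coord_sin_integrable: "integrable \<nu> (\<lambda>u. u $ j * sin (\<xi> \<bullet> u))"
  using coord_cos_increment_integrable[of j \<xi> 0 "- pi / 2"] by (simp add: cos_diff)

lemma coord_cos_minus_1_integrable: "integrable \<nu> (\<lambda>u. u $ j * (cos (\<xi> \<bullet> u) - 1))"
  using coord_cos_increment_integrable[of j \<xi> 0 0] by simp

text \<open>The integrand is odd and the Levy measure is symmetric.\<close>

lemma coord_cos_minus_1_integral: "(LINT u|\<nu>. u $ j * (cos (\<xi> \<bullet> u) - 1)) = 0"
  using integral_levy_nu_uminus[OF _ \<alpha>, of "\<lambda>u::real^'n. u $ j * (cos (\<xi> \<bullet> u) - 1)"] by simp

text \<open>The addition formula separates \<open>x\<close> from \<open>u\<close>. The part with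
  \<open>cos (\<xi> \<bullet> u) - 1\<close> integrates to zero, and the drift times a function of
  \<open>x\<close> remains. This separation is what later turns the Stein identity into an equation
  for the characteristic function.\<close>

lemma coord_cos_increment_integral:
  "(LINT u|\<nu>. u $ j * (cos (\<xi> \<bullet> (x + u) + \<theta>) - cos (\<xi> \<bullet> x + \<theta>))) = - drift j \<xi> * sin (\<xi> \<bullet> x + \<theta>)"
proof -
  have "u $ j * (cos (\<xi> \<bullet> (x + u) + \<theta>) - cos (\<xi> \<bullet> x + \<theta>)) =
     cos (\<xi> \<bullet> x + \<theta>) * (u $ j * (cos (\<xi> \<bullet> u) - 1)) - sin (\<xi> \<bullet> x + \<theta>) * (u $ j * sin (\<xi> \<bullet> u))" for u
  proof -
    have "\<xi> \<bullet> (x + u) + \<theta> = (\<xi> \<bullet> x + \<theta>) + \<xi> \<bullet> u" by (simp add: inner_add_right)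
    then show ?thesis by (simp only: cos_add) (simp add: algebra_simps)
  qed
  then have "(LINT u|\<nu>. u $ j * (cos (\<xi> \<bullet> (x + u) + \<theta>) - cos (\<xi> \<bullet> x + \<theta>))) =
     cos (\<xi> \<bullet> x + \<theta>) * (LINT u|\<nu>. u $ j * (cos (\<xi> \<bullet> u) - 1)) - sin (\<xi> \<bullet> x + \<theta>) * (LINT u|\<nu>. u $ j * sin (\<xi> \<bullet> u))"
    using coord_sin_integrable coord_cos_minus_1_integrable by simp
  then show ?thesis by (simp add: coord_cos_minus_1_integral drift_def)
qed

lemma levy_exponent:
  "integrable \<nu> (\<lambda>u. 1 - cos (\<xi> \<bullet> u))" "(LINT u|\<nu>. 1 - cos (\<xi> \<bullet> u)) = norm \<xi> powr \<alpha> / 2"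
proof -
  have "has_bochner_integral \<nu> (\<lambda>u. 1 - cos (\<xi> \<bullet> u)) (norm \<xi> powr \<alpha> / 2)"
    using nn_integral_levy_nu_one_minus_cos[OF \<alpha>, of \<xi>] by (intro has_bochner_integral_nn_integral) auto
  then show "integrable \<nu> (\<lambda>u. 1 - cos (\<xi> \<bullet> u))" "(LINT u|\<nu>. 1 - cos (\<xi> \<bullet> u)) = norm \<xi> powr \<alpha> / 2"
    by (auto simp: has_bochner_integral_iff)
qed

lemma drift_sum: "(\<Sum>j\<in>UNIV. \<xi> $ j * drift j \<zeta>) = (LINT u|\<nu>. (\<xi> \<bullet> u) * sin (\<zeta> \<bullet> u))"
proof -
  have "(LINT u|\<nu>. (\<xi> \<bullet> u) * sin (\<zeta> \<bullet> u)) = (LINT u|\<nu>. (\<Sum>j\<in>UNIV. \<xi> $ j * (u $ j * sin (\<zeta> \<bullet> u))))"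
    by (simp add: inner_vec_def sum_distrib_right mult_ac)
  also have "\<dots> = (\<Sum>j\<in>UNIV. (LINT u|\<nu>. \<xi> $ j * (u $ j * sin (\<zeta> \<bullet> u))))"
    by (intro Bochner_Integration.integral_sum integrable_mult_right coord_sin_integrable)
  finally show ?thesis by (simp add: drift_def)
qed

lemma levy_exponent_has_derivative:
  "((\<lambda>t. norm (t *\<^sub>R \<xi>) powr \<alpha> / 2) has_real_derivative (\<Sum>j\<in>UNIV. \<xi> $ j * drift j (t *\<^sub>R \<xi>))) (at t)"
proof -
  \<comment> \<open>The inner product supplies \<open>norm u\<close> and the sine supplies
    \<open>min 1 (norm u)\<close>; \<open>\<bar>t\<bar> + 1\<close> bounds the parameter within
    distance 1 of \<open>t\<close>.\<close>
  let ?w = "\<lambda>u. norm \<xi> * (1 + (\<bar>t\<bar> + 1) * norm \<xi>) * levy_weight u"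
  have "((\<lambda>t. LINT u|\<nu>. 1 - cos (t * (\<xi> \<bullet> u))) has_real_derivative (LINT u|\<nu>. (\<xi> \<bullet> u) * sin (t * (\<xi> \<bullet> u)))) (at t)"
  proof (rule has_real_derivative_integral[where w="?w"])
    show "integrable \<nu> (\<lambda>u. 1 - cos (s * (\<xi> \<bullet> u)))" for s
      using levy_exponent(1)[of "s *\<^sub>R \<xi>"] by simp
    show "((\<lambda>t. 1 - cos (t * (\<xi> \<bullet> u))) has_real_derivative (\<xi> \<bullet> u) * sin (s * (\<xi> \<bullet> u))) (at s)" for s u
      by (auto intro!: derivative_eq_intros)
    show "\<bar>(\<xi> \<bullet> u) * sin (s * (\<xi> \<bullet> u))\<bar> \<le> ?w u" if s: "\<bar>s - t\<bar> \<le> 1" for s and u :: "real^'n"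
    proof -
      have i: "\<bar>\<xi> \<bullet> u\<bar> \<le> norm \<xi> * norm u" by (rule Cauchy_Schwarz_ineq2)
      have "\<bar>sin (s * (\<xi> \<bullet> u))\<bar> \<le> \<bar>s\<bar> * \<bar>\<xi> \<bullet> u\<bar>" using abs_sin_x_le_abs_x[of "s * (\<xi> \<bullet> u)"] by (simp add: abs_mult)
      also have "\<dots> \<le> (\<bar>t\<bar> + 1) * (norm \<xi> * norm u)" using s by (intro mult_mono i) auto
      finally have 1: "\<bar>sin (s * (\<xi> \<bullet> u))\<bar> \<le> (\<bar>t\<bar> + 1) * norm \<xi> * norm u" by simp
      have "\<bar>sin (s * (\<xi> \<bullet> u))\<bar> \<le> (1 + (\<bar>t\<bar> + 1) * norm \<xi>) * min 1 (norm u)"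
      proof (cases "norm u \<le> 1")
        case True
        with 1 show ?thesis by (simp add: algebra_simps) (use norm_ge_zero[of u] in linarith)
      next
        case False
        have "0 \<le> (\<bar>t\<bar> + 1) * norm \<xi>" by simp
        with abs_sin_le_one[of "s * (\<xi> \<bullet> u)"] have "\<bar>sin (s * (\<xi> \<bullet> u))\<bar> \<le> 1 + (\<bar>t\<bar> + 1) * norm \<xi>" by linarith
        with False show ?thesis by simp
      qed
      with i have "\<bar>\<xi> \<bullet> u\<bar> * \<bar>sin (s * (\<xi> \<bullet> u))\<bar> \<le> (norm \<xi> * norm u) * ((1 + (\<bar>t\<bar> + 1) * norm \<xi>) * min 1 (norm u))"
        by (intro mult_mono) auto
      then show ?thesis by (simp add: abs_mult levy_weight_def mult_ac)
    qed
    show "integrable \<nu> ?w" by (intro integrable_mult_right integrable_levy_weight \<alpha>)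
  qed simp
  moreover have "norm (s *\<^sub>R \<xi>) powr \<alpha> / 2 = (LINT u|\<nu>. 1 - cos (s * (\<xi> \<bullet> u)))" for s
    using levy_exponent(2)[of "s *\<^sub>R \<xi>"] by (simp only: inner_scaleR_left)
  ultimately show ?thesis by (simp only: drift_sum inner_scaleR_left)
qed

end

section \<open>The defect in the Poincare inequality\<close>

locale stable_form_extremal = stable_form_closure \<alpha> \<mu> D E for \<alpha> and \<mu> :: "(real^'n::finite) measure" and D E +
  fixes U :: real
  assumes U: "0 < U"
    and moment: "integrable \<mu> norm"
    and centered: "(LINT x|\<mu>. x) = 0"
    and poincare: "\<And>f. f \<in> D \<Longrightarrow> (LINT x|\<mu>. f x) = 0 \<Longrightarrow>
       (\<integral>\<^sup>+x. ennreal (\<bar>f x\<bar>\<^sup>2) \<partial>\<mu>) \<le>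
         ennreal U * (\<integral>\<^sup>+x. (\<integral>\<^sup>+u. ennreal (\<bar>f (x + u) - f x\<bar>\<^sup>2) \<partial>levy_nu \<alpha>) \<partial>\<mu>)"
    and extremal: "\<And>j. ((\<lambda>R. E (\<lambda>x. U * trunc_coord \<mu> R j x) (trunc_coord \<mu> R j)
                 - L2_inner \<mu> (trunc_coord \<mu> R j) (trunc_coord \<mu> R j)) \<longlongrightarrow> 0) at_top"
begin

text \<open>The polarization of the quadratic form \<open>Q\<close>. With the product of means
  subtracted, adding constants to functions in \<open>D\<close> does not change it, so it can be
  evaluated on Schwartz functions that are not centered.\<close>

definition defect :: "(real^'n \<Rightarrow> real) \<Rightarrow> (real^'n \<Rightarrow> real) \<Rightarrow> real" where
  "defect f g = U * E f g - ((LINT x|\<mu>. f x * g x) - (LINT x|\<mu>. f x) * (LINT x|\<mu>. g x))"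

lemma schwartz_in_D: "f \<in> schwartz \<Longrightarrow> f \<in> D" using schwartz_subset by blast

lemma integral_centered_square:
  assumes "f \<in> schwartz"
  defines "m \<equiv> (LINT x|\<mu>. f x)"
  shows "integrable \<mu> (\<lambda>x. (f x - m) * (f x - m))"
    and "(LINT x|\<mu>. (f x - m) * (f x - m)) = (LINT x|\<mu>. f x * f x) - m * m"
proof -
  note i = integrable_schwartz[OF assms(1)] integrable_schwartz_mult[OF assms(1,1)]
  have eq: "(f x - m) * (f x - m) = f x * f x - (2 * m) * f x + m * m" for x by (simp add: algebra_simps)
  show "integrable \<mu> (\<lambda>x. (f x - m) * (f x - m))" unfolding eq using i by simp
  show "(LINT x|\<mu>. (f x - m) * (f x - m)) = (LINT x|\<mu>. f x * f x) - m * m"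
    unfolding eq using i by (simp add: m_def[symmetric] prob_space)
qed

text \<open>The Poincare inequality is applied to \<open>f\<close> minus its mean, which lies in
  \<open>D\<close> because constants do; increments do not see the mean.\<close>

lemma defect_nonneg:
  assumes f: "f \<in> schwartz"
  shows "0 \<le> defect f f"
proof -
  define m where "m = (LINT x|\<mu>. f x)"
  note [measurable] = schwartz_borel_measurable[OF f]
  note sq = integral_centered_square[OF f, folded m_def]
  obtain A where A: "0 \<le> A" "\<And>x u. \<bar>f (x + u) - f x\<bar> \<le> A * min 1 (norm u)"
    using schwartz_increment[OF f] by blast
  have "(LINT x|\<mu>. f x - m) = 0"
    using integrable_schwartz[OF f] by (simp add: m_def prob_space)
  from poincare[OF E_add_const(1)[OF schwartz_in_D[OF f]] this]
  have "(\<integral>\<^sup>+x. ennreal ((f x - m) * (f x - m)) \<partial>\<mu>) \<le>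
     ennreal U * (\<integral>\<^sup>+x. (\<integral>\<^sup>+u. ennreal (\<bar>f (x + u) - f x\<bar>\<^sup>2) \<partial>\<nu>) \<partial>\<mu>)"
    by (simp add: power2_eq_square)
  also have "\<dots> = ennreal (U * E f f)"
    using nn_integral_stable_form[OF _ A(2,1)] U E_nonneg[OF schwartz_in_D[OF f]]
    by (simp add: E_schwartz f ennreal_mult)
  also have "(\<integral>\<^sup>+x. ennreal ((f x - m) * (f x - m)) \<partial>\<mu>) = ennreal ((LINT x|\<mu>. f x * f x) - m * m)"
    using sq by (subst nn_integral_eq_integral) auto
  finally have "(LINT x|\<mu>. f x * f x) - m * m \<le> U * E f f"
    using U E_nonneg[OF schwartz_in_D[OF f]] by (subst (asm) ennreal_le_iff) auto
  then show ?thesis by (simp add: defect_def m_def)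
qed

lemma defect_quadratic:
  assumes f: "f \<in> schwartz" and g: "g \<in> schwartz"
  shows "defect (\<lambda>x. f x + t * g x) (\<lambda>x. f x + t * g x) = defect f f + 2 * t * defect f g + t\<^sup>2 * defect g g"
proof -
  note i = integrable_schwartz[OF f] integrable_schwartz[OF g] integrable_schwartz_mult[OF f f]
    integrable_schwartz_mult[OF f g] integrable_schwartz_mult[OF g g]
  have eq: "(f x + t * g x) * (f x + t * g x) = f x * f x + 2 * t * (f x * g x) + t\<^sup>2 * (g x * g x)" for x
    by (simp add: algebra_simps power2_eq_square)
  have "(LINT x|\<mu>. (f x + t * g x) * (f x + t * g x)) =
     (LINT x|\<mu>. f x * f x) + 2 * t * (LINT x|\<mu>. f x * g x) + t\<^sup>2 * (LINT x|\<mu>. g x * g x)"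
    unfolding eq using i by simp
  moreover have "(LINT x|\<mu>. f x + t * g x) = (LINT x|\<mu>. f x) + t * (LINT x|\<mu>. g x)"
    using i by simp
  moreover have "E (\<lambda>x. f x + t * g x) (\<lambda>x. f x + t * g x) = E f f + 2 * t * E f g + t\<^sup>2 * E g g"
    using E_quadratic[OF schwartz_in_D[OF f] schwartz_in_D[OF g], of 1 t] by simp
  ultimately show ?thesis by (simp add: defect_def algebra_simps power2_eq_square)
qed

lemma defect_cauchy_schwarz:
  assumes f: "f \<in> schwartz" and g: "g \<in> schwartz"
  shows "(defect f g)\<^sup>2 \<le> defect f f * defect g g"
proof (rule discriminant_le)
  show "0 \<le> defect f f + 2 * t * defect f g + t\<^sup>2 * defect g g" for t
    using defect_quadratic[OF f g, of t] defect_nonneg[OF schwartz_lincomb[OF f g, of 1 t]] by simp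
qed (rule defect_nonneg[OF g])

text \<open>Translates the extremality assumption, which concerns centered functions, into a
  statement on the defect of an uncentered Schwartz function.\<close>

lemma defect_coord_radial_cutoff:
  fixes j :: 'n
  assumes "0 < R"
  defines "g \<equiv> \<lambda>x. x $ j * radial_cutoff R x"
  shows "E (\<lambda>x. U * trunc_coord \<mu> R j x) (trunc_coord \<mu> R j) - L2_inner \<mu> (trunc_coord \<mu> R j) (trunc_coord \<mu> R j) =
    defect g g"
proof -
  have g: "g \<in> schwartz" unfolding g_def by (rule trig_radial_cutoff_schwartz[OF assms(1)])
  define m where "m = (LINT x|\<mu>. g x)"
  have tr: "trunc_coord \<mu> R j = (\<lambda>x. g x - m)"
    by (simp add: trunc_coord_def[abs_def] g_def m_def radial_cutoff_def)
  have "E (\<lambda>x. U * (g x - m)) (\<lambda>x. g x - m) = U * E g g"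
    using E_lincomb[OF E_add_const(1) E_add_const(1) E_add_const(1), OF schwartz_in_D[OF g] schwartz_in_D[OF g] schwartz_in_D[OF g], of U m 0 m m]
      E_add_const(2)[OF schwartz_in_D[OF g], of m] by simp
  then show ?thesis
    unfolding tr defect_def L2_inner_def
    using integral_centered_square(2)[OF g, folded m_def] by (simp add: m_def)
qed

text \<open>For \<open>1 \<le> R\<close> the slope \<open>L / R\<close> of the cutoff is at most
  \<open>L\<close>. The uniform constant serves both as a dominating bound and as a bound on the
  energies of the test functions.\<close>

lemma cos_radial_cutoff_uniform_increment:
  obtains A where "0 \<le> A"
    "\<And>R x u. 1 \<le> R \<Longrightarrow> \<bar>cos (\<xi> \<bullet> (x + u) + \<theta>) * radial_cutoff R (x + u) - cos (\<xi> \<bullet> x + \<theta>) * radial_cutoff R (x::real^'n)\<bar>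
       \<le> A * min 1 (norm u)"
proof -
  obtain L where L: "0 \<le> L" "\<And>R x y. 0 < R \<Longrightarrow> \<bar>radial_cutoff R (x :: real^'n) - radial_cutoff R y\<bar> \<le> L / R * norm (x - y)"
    using radial_cutoff_lipschitz by blast
  let ?f = "\<lambda>R x. cos (\<xi> \<bullet> x + \<theta>) * radial_cutoff R (x::real^'n)"
  have "\<bar>?f R (x + u) - ?f R x\<bar> \<le> (2 * 1 + (norm \<xi> + L)) * min 1 (norm u)" if R: "1 \<le> R" for R x u
  proof (rule bounded_lipschitz_increment)
    show "\<bar>?f R x\<bar> \<le> 1" for x unfolding abs_mult by (intro mult_le_one) auto
    show "0 \<le> norm \<xi> + L" using L(1) by simp
    fix x y :: "real^'n"
    have "?f R x - ?f R y = (cos (\<xi> \<bullet> x + \<theta>) - cos (\<xi> \<bullet> y + \<theta>)) * radial_cutoff R x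
       + cos (\<xi> \<bullet> y + \<theta>) * (radial_cutoff R x - radial_cutoff R y)" by (simp add: algebra_simps)
    also have "\<bar>\<dots>\<bar> \<le> \<bar>cos (\<xi> \<bullet> x + \<theta>) - cos (\<xi> \<bullet> y + \<theta>)\<bar> * \<bar>radial_cutoff R x\<bar>
       + \<bar>cos (\<xi> \<bullet> y + \<theta>)\<bar> * \<bar>radial_cutoff R x - radial_cutoff R y\<bar>"
      unfolding abs_mult[symmetric] by (rule abs_triangle_ineq)
    also have "\<dots> \<le> (norm \<xi> * norm (x - y)) * 1 + 1 * (L * norm (x - y))"
    proof (intro add_mono mult_mono cos_inner_lipschitz)
      have "L / R \<le> L / 1" using L(1) R by (intro divide_left_mono) auto
      then have "L / R * norm (x - y) \<le> L * norm (x - y)" by (intro mult_right_mono) auto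
      then show "\<bar>radial_cutoff R x - radial_cutoff R y\<bar> \<le> L * norm (x - y)"
        using L(2)[of R x y] R by linarith
    qed auto
    finally show "\<bar>?f R x - ?f R y\<bar> \<le> (norm \<xi> + L) * norm (x - y)" by (simp add: algebra_simps)
  qed
  with L(1) show ?thesis by (intro that[of "2 * 1 + (norm \<xi> + L)"]) auto
qed

lemma stein_identity:
  "(LINT x|\<mu>. x $ j * sin (\<xi> \<bullet> x + \<theta>)) = U * drift j \<xi> * (LINT x|\<mu>. cos (\<xi> \<bullet> x + \<theta>))"
proof -
  \<comment> \<open>The form turns the cosine of the test function into a sine; shifting by a
    quarter period beforehand puts the sine on the left of the result and the cosine on the
    right.\<close>
  define \<theta>' where "\<theta>' = \<theta> - pi / 2"
  define f where "f R x = cos (\<xi> \<bullet> x + \<theta>') * radial_cutoff R x" for R and x :: "real^'n"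
  define g where "g R x = x $ j * radial_cutoff R x" for R and x :: "real^'n"
  have [measurable]: "f R \<in> borel_measurable borel" "g R \<in> borel_measurable borel" for R
    unfolding f_def g_def by measurable
  obtain A where A: "0 \<le> A" "\<And>R x u. 1 \<le> R \<Longrightarrow> \<bar>f R (x + u) - f R x\<bar> \<le> A * min 1 (norm u)"
    unfolding f_def using cos_radial_cutoff_uniform_increment[of \<xi> \<theta>'] by blast
  obtain B where B: "0 \<le> B" "\<And>R x y. 0 < R \<Longrightarrow> \<bar>g R x - g R y\<bar> \<le> B * norm (x - y)"
    unfolding g_def using coord_radial_cutoff_lipschitz[of j] by blast
  have B': "\<bar>g R (x + u) - g R x\<bar> \<le> B * norm u" if "1 \<le> R" for R x u
    using B(2)[of R "x + u" x] that by simp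
  have fS: "f R \<in> schwartz" and gS: "g R \<in> schwartz" if "1 \<le> R" for R
    using trig_radial_cutoff_schwartz[of R] that by (auto simp: f_def[abs_def] g_def[abs_def])
  have R1: "\<forall>\<^sub>F R in at_top. (1::real) \<le> R" by (rule eventually_ge_at_top)

  have f_lim: "((\<lambda>R. f R x) \<longlongrightarrow> cos (\<xi> \<bullet> x + \<theta>')) at_top" for x
    using tendsto_mult[OF tendsto_const radial_cutoff_tendsto[of x], of "cos (\<xi> \<bullet> x + \<theta>')"] by (simp add: f_def)
  have g_lim: "((\<lambda>R. g R x) \<longlongrightarrow> x $ j) at_top" for x
    using tendsto_mult[OF tendsto_const radial_cutoff_tendsto[of x], of "x $ j"] by (simp add: g_def)
  have f_bd: "\<bar>f R x\<bar> \<le> 1" for R x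
    unfolding f_def abs_mult by (intro mult_le_one) auto
  have g_bd: "\<bar>g R x\<bar> \<le> norm x" for R x
    using mult_mono[OF component_le_norm_cart[of x j] radial_cutoff_abs(1)[of R x]] by (simp add: g_def abs_mult)

  have int_f: "((\<lambda>R. LINT x|\<mu>. f R x) \<longlongrightarrow> (LINT x|\<mu>. cos (\<xi> \<bullet> x + \<theta>'))) at_top"
    by (rule integral_dominated_convergence_at_top[where w="\<lambda>_. 1"]) (auto simp: f_lim f_bd)
  have "((\<lambda>R. LINT x|\<mu>. g R x) \<longlongrightarrow> (LINT x|\<mu>. x $ j)) at_top"
    by (rule integral_dominated_convergence_at_top[where w=norm]) (auto simp: g_lim g_bd moment)
  also have "(LINT x|\<mu>. x $ j) = (LINT x|\<mu>. x) $ j"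
  proof -
    have "integrable \<mu> (\<lambda>x::real^'n. x)"
      by (rule Bochner_Integration.integrable_bound[OF moment]) auto
    from integral_bounded_linear[OF bounded_linear_vec_nth this] show ?thesis by simp
  qed
  finally have int_g: "((\<lambda>R. LINT x|\<mu>. g R x) \<longlongrightarrow> 0) at_top" by (simp add: centered)
  have int_fg: "((\<lambda>R. LINT x|\<mu>. f R x * g R x) \<longlongrightarrow> (LINT x|\<mu>. cos (\<xi> \<bullet> x + \<theta>') * x $ j)) at_top"
  proof (rule integral_dominated_convergence_at_top[where w=norm])
    show "\<forall>\<^sub>F R in at_top. AE x in \<mu>. norm (f R x * g R x) \<le> norm x"
      using mult_mono[OF f_bd g_bd] by (auto simp: abs_mult)
  qed (auto intro!: tendsto_mult f_lim g_lim simp: moment)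

  \<comment> \<open>The cutoff is removed by dominated convergence twice: here in \<open>u\<close>,
    with the Levy weight as bound, and then in \<open>x\<close>, with a constant.\<close>
  have inner: "((\<lambda>R. LINT u|\<nu>. (f R (x + u) - f R x) * (g R (x + u) - g R x)) \<longlongrightarrow> - drift j \<xi> * sin (\<xi> \<bullet> x + \<theta>')) at_top" for x
  proof -
    have "((\<lambda>R. LINT u|\<nu>. (f R (x + u) - f R x) * (g R (x + u) - g R x)) \<longlongrightarrow>
       (LINT u|\<nu>. (cos (\<xi> \<bullet> (x + u) + \<theta>') - cos (\<xi> \<bullet> x + \<theta>')) * ((x + u) $ j - x $ j))) at_top"
    proof (rule integral_dominated_convergence_at_top[where w="\<lambda>u. A * B * levy_weight u"])
      show "integrable \<nu> (\<lambda>u. A * B * levy_weight u)"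
        by (intro integrable_mult_right integrable_levy_weight \<alpha>)
      show "\<forall>\<^sub>F R in at_top. AE u in \<nu>. norm ((f R (x + u) - f R x) * (g R (x + u) - g R x)) \<le> A * B * levy_weight u"
        using R1
      proof eventually_elim
        case (elim R)
        from increments_integrable(1)[OF _ _ A(2)[OF elim] B'[OF elim] A(1)] show ?case by simp
      qed
      show "AE u in \<nu>. ((\<lambda>R. (f R (x + u) - f R x) * (g R (x + u) - g R x)) \<longlongrightarrow>
         (cos (\<xi> \<bullet> (x + u) + \<theta>') - cos (\<xi> \<bullet> x + \<theta>')) * ((x + u) $ j - x $ j)) at_top"
        by (intro AE_I2 tendsto_mult tendsto_diff f_lim g_lim)
    qed simp_all
    then show ?thesis using coord_cos_increment_integral[of j \<xi> x \<theta>'] by (simp add: mult.commute)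
  qed
  have "((\<lambda>R. LINT x|\<mu>. LINT u|\<nu>. (f R (x + u) - f R x) * (g R (x + u) - g R x)) \<longlongrightarrow>
     (LINT x|\<mu>. - drift j \<xi> * sin (\<xi> \<bullet> x + \<theta>'))) at_top"
  proof (rule integral_dominated_convergence_at_top[where w="\<lambda>_. A * B * levy_mass"])
    show "\<forall>\<^sub>F R in at_top. AE x in \<mu>. norm (LINT u|\<nu>. (f R (x + u) - f R x) * (g R (x + u) - g R x)) \<le> A * B * levy_mass"
      using R1
    proof eventually_elim
      case (elim R)
      from increments_integrable(3)[OF _ _ A(2)[OF elim] B'[OF elim] A(1)] show ?case by simp
    qed
  qed (use inner in auto)
  then have "((\<lambda>R. stable_form \<alpha> \<mu> (f R) (g R)) \<longlongrightarrow> - drift j \<xi> * (LINT x|\<mu>. sin (\<xi> \<bullet> x + \<theta>'))) at_top"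
    by (simp add: stable_form_def)
  then have "((\<lambda>R. E (f R) (g R)) \<longlongrightarrow> - drift j \<xi> * (LINT x|\<mu>. sin (\<xi> \<bullet> x + \<theta>'))) at_top"
    by (rule Lim_transform_eventually) (use R1 in \<open>eventually_elim, simp add: E_schwartz fS gS\<close>)
  \<comment> \<open>The last factor 0 is the limit of the means of \<open>g R\<close>, by
    centering.\<close>
  then have lim1: "((\<lambda>R. defect (f R) (g R)) \<longlongrightarrow> U * (- drift j \<xi> * (LINT x|\<mu>. sin (\<xi> \<bullet> x + \<theta>'))) -
     ((LINT x|\<mu>. cos (\<xi> \<bullet> x + \<theta>') * x $ j) - (LINT x|\<mu>. cos (\<xi> \<bullet> x + \<theta>')) * 0)) at_top"
    unfolding defect_def by (intro tendsto_intros int_f int_g int_fg)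

  \<comment> \<open>In the Cauchy-Schwarz bound the defect of \<open>f R\<close> stays below this
    constant, while the defect of \<open>g R\<close> vanishes by extremality.\<close>
  have "((\<lambda>R. (U * (A * A * levy_mass)) * defect (g R) (g R)) \<longlongrightarrow> (U * (A * A * levy_mass)) * 0) at_top"
  proof (intro tendsto_mult tendsto_const Lim_transform_eventually[OF extremal[of j]])
    show "\<forall>\<^sub>F R in at_top. E (\<lambda>x. U * trunc_coord \<mu> R j x) (trunc_coord \<mu> R j)
        - L2_inner \<mu> (trunc_coord \<mu> R j) (trunc_coord \<mu> R j) = defect (g R) (g R)"
      using eventually_gt_at_top[of 0]
      by eventually_elim (simp add: defect_coord_radial_cutoff g_def[abs_def])
  qed
  then have "((\<lambda>R. (defect (f R) (g R))\<^sup>2) \<longlongrightarrow> 0) at_top"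
  proof (rule Lim_null_comparison[rotated, OF tendsto_eq_rhs])
    show "\<forall>\<^sub>F R in at_top. norm ((defect (f R) (g R))\<^sup>2) \<le> (U * (A * A * levy_mass)) * defect (g R) (g R)"
      using R1
    proof eventually_elim
      case (elim R)
      have "\<bar>f R (x + u) - f R x\<bar> \<le> A * norm u" for x u
        using A(2)[OF elim, of x u] mult_left_mono[OF min.cobounded2 A(1), of 1 "norm u"] by linarith
      from stable_form_bound[OF _ _ A(2)[OF elim] this A(1)]
      have "stable_form \<alpha> \<mu> (f R) (f R) \<le> A * A * levy_mass" by simp
      then have "U * E (f R) (f R) \<le> U * (A * A * levy_mass)"
        using U by (intro mult_left_mono) (auto simp: E_schwartz fS elim)
      \<comment> \<open>The variance is nonnegative, so the energy alone bounds the defect of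
        \<open>f R\<close>.\<close>
      moreover have "0 \<le> (LINT x|\<mu>. f R x * f R x) - (LINT x|\<mu>. f R x) * (LINT x|\<mu>. f R x)"
        unfolding integral_centered_square(2)[OF fS[OF elim], symmetric]
        by (rule Bochner_Integration.integral_nonneg) simp
      ultimately have "defect (f R) (f R) \<le> U * (A * A * levy_mass)"
        by (simp add: defect_def)
      then have "defect (f R) (f R) * defect (g R) (g R) \<le> (U * (A * A * levy_mass)) * defect (g R) (g R)"
        using defect_nonneg[OF gS[OF elim]] by (rule mult_right_mono)
      with defect_cauchy_schwarz[OF fS[OF elim] gS[OF elim]] show ?case by simp
    qed
  qed simp
  then have "((\<lambda>R. defect (f R) (g R)) \<longlongrightarrow> 0) at_top"
    using tendsto_real_sqrt[of "\<lambda>R. (defect (f R) (g R))\<^sup>2" 0] by (simp add: tendsto_rabs_zero_iff)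
  from tendsto_unique[OF _ this lim1]
  have "(LINT x|\<mu>. cos (\<xi> \<bullet> x + \<theta>') * x $ j) = - U * drift j \<xi> * (LINT x|\<mu>. sin (\<xi> \<bullet> x + \<theta>'))"
    by simp
  moreover have "cos (\<xi> \<bullet> x + \<theta>') = sin (\<xi> \<bullet> x + \<theta>)" "sin (\<xi> \<bullet> x + \<theta>') = - cos (\<xi> \<bullet> x + \<theta>)" for x
    unfolding \<theta>'_def add_diff_eq by (simp_all add: cos_diff sin_diff)
  ultimately show ?thesis by (simp add: mult.commute)
qed

section \<open>The characteristic function of the extremal measure\<close>

lemma integral_cos_eq: "(LINT x|\<mu>. cos (\<xi> \<bullet> x + \<theta>)) = exp (- U * norm \<xi> powr \<alpha> / 2) * cos \<theta>"
proof -
  define Y where "Y t = (LINT x|\<mu>. cos (t * (\<xi> \<bullet> x) + \<theta>))" for t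
  define G where "G t = (\<Sum>j\<in>UNIV. \<xi> $ j * drift j (t *\<^sub>R \<xi>))" for t
  have Y': "(Y has_real_derivative - U * G t * Y t) (at t)" for t
  proof -
    have ix: "integrable \<mu> (\<lambda>x. x $ j * sin (t * (\<xi> \<bullet> x) + \<theta>))" for j
    proof (rule Bochner_Integration.integrable_bound[OF moment])
      have "\<bar>x $ j\<bar> * \<bar>sin (t * (\<xi> \<bullet> x) + \<theta>)\<bar> \<le> norm x * 1" for x :: "real^'n"
        by (intro mult_mono component_le_norm_cart) auto
      then show "AE x in \<mu>. norm (x $ j * sin (t * (\<xi> \<bullet> x) + \<theta>)) \<le> norm (norm x)"
        by (simp add: abs_mult)
    qed simp
    have "(Y has_real_derivative (LINT x|\<mu>. - ((\<xi> \<bullet> x) * sin (t * (\<xi> \<bullet> x) + \<theta>)))) (at t)"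
      unfolding Y_def
    proof (rule has_real_derivative_integral[where w="\<lambda>x. norm \<xi> * norm x"])
      show "integrable \<mu> (\<lambda>x. cos (s * (\<xi> \<bullet> x) + \<theta>))" for s
        by (rule integrable_const_bound[where B=1]) auto
      show "((\<lambda>t. cos (t * (\<xi> \<bullet> x) + \<theta>)) has_real_derivative - ((\<xi> \<bullet> x) * sin (s * (\<xi> \<bullet> x) + \<theta>))) (at s)" for s x
        by (auto intro!: derivative_eq_intros)
      show "\<bar>- ((\<xi> \<bullet> x) * sin (s * (\<xi> \<bullet> x) + \<theta>))\<bar> \<le> norm \<xi> * norm x" for s and x :: "real^'n"
        using mult_mono[OF Cauchy_Schwarz_ineq2[of \<xi> x] abs_sin_le_one[of "s * (\<xi> \<bullet> x) + \<theta>"]]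
        by (simp add: abs_mult)
    qed (use moment in auto)
    also have "(LINT x|\<mu>. - ((\<xi> \<bullet> x) * sin (t * (\<xi> \<bullet> x) + \<theta>))) =
       - (LINT x|\<mu>. (\<Sum>j\<in>UNIV. \<xi> $ j * (x $ j * sin (t * (\<xi> \<bullet> x) + \<theta>))))"
      by (simp add: inner_vec_def[of \<xi>] sum_distrib_right mult_ac)
    also have "(LINT x|\<mu>. (\<Sum>j\<in>UNIV. \<xi> $ j * (x $ j * sin (t * (\<xi> \<bullet> x) + \<theta>)))) =
       (\<Sum>j\<in>UNIV. LINT x|\<mu>. \<xi> $ j * (x $ j * sin (t * (\<xi> \<bullet> x) + \<theta>)))"
      by (intro Bochner_Integration.integral_sum integrable_mult_right ix)
    also have "\<dots> = (\<Sum>j\<in>UNIV. \<xi> $ j * (U * drift j (t *\<^sub>R \<xi>) * Y t))"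
      using stein_identity[of _ "t *\<^sub>R \<xi>" \<theta>] by (simp add: Y_def)
    also have "\<dots> = U * G t * Y t"
      by (simp add: G_def sum_distrib_left sum_distrib_right mult_ac)
    finally show ?thesis by simp
  qed
  define L where "L t = norm (t *\<^sub>R \<xi>) powr \<alpha> / 2" for t
  have L': "(L has_real_derivative G t) (at t)" for t
    unfolding L_def G_def by (rule levy_exponent_has_derivative)
  \<comment> \<open>\<open>exp (U * L t)\<close> is the integrating factor of
    \<open>Y' = - U * G * Y\<close>, since \<open>G\<close> is the derivative of \<open>L\<close>.
    Comparing \<open>t = 0\<close> with \<open>t = 1\<close> solves the equation.\<close>
  have "((\<lambda>t. Y t * exp (U * L t)) has_real_derivative 0) (at t)" for t
    by (auto intro!: derivative_eq_intros Y' L' simp: algebra_simps)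
  then have "Y 1 * exp (U * L 1) = Y 0 * exp (U * L 0)"
    by (intro DERIV_isconst_all) auto
  then have "Y 1 * exp (U * L 1) = cos \<theta>"
    by (simp add: Y_def L_def prob_space)
  then have "Y 1 = exp (- (U * L 1)) * cos \<theta>"
    by (simp add: exp_minus field_simps)
  then show ?thesis by (simp add: Y_def L_def)
qed

text \<open>The phases 0 and \<open>pi / 2\<close> yield the real and the imaginary part.\<close>

lemma char_eq: "(LINT x|\<mu>. iexp (\<xi> \<bullet> x)) = complex_of_real (exp (- U * norm \<xi> powr \<alpha> / 2))"
proof -
  have m: "(\<lambda>x. \<xi> \<bullet> x) \<in> borel_measurable \<mu>" by measurable
  have "Re (cis \<theta> * (LINT x|\<mu>. iexp (\<xi> \<bullet> x))) = exp (- U * norm \<xi> powr \<alpha> / 2) * cos \<theta>" for \<theta>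
    using integral_cos_shift_char[OF prob_space_axioms m, of \<theta>] integral_cos_eq[of \<xi> \<theta>] by simp
  from this[of 0] this[of "pi / 2"] show ?thesis by (simp add: complex_eq_iff)
qed

end

section \<open>Comparison of the laws\<close>

lemma one_minus_cos_le_levy_weight:
  assumes "norm \<xi> = 1"
  shows "1 - cos (\<xi> \<bullet> u) \<le> 2 * levy_weight u"
proof (cases "norm u \<le> 1")
  case True
  have "\<bar>sin ((\<xi> \<bullet> u) / 2)\<bar> \<le> \<bar>\<xi> \<bullet> u\<bar>" using abs_sin_x_le_abs_x[of "(\<xi> \<bullet> u) / 2"] by simp
  also have "\<dots> \<le> norm u" using Cauchy_Schwarz_ineq2[of \<xi> u] assms by simp
  finally have "\<bar>sin ((\<xi> \<bullet> u) / 2)\<bar>\<^sup>2 \<le> (norm u)\<^sup>2" by (intro power_mono) auto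
  moreover have "1 - cos (\<xi> \<bullet> u) = 2 * (sin ((\<xi> \<bullet> u) / 2))\<^sup>2"
    using cos_double_sin[of "(\<xi> \<bullet> u) / 2"] by simp
  ultimately show ?thesis using True by (simp add: levy_weight_def power2_eq_square)
next
  case False
  then have "levy_weight u = norm u" by (simp add: levy_weight_def)
  with False cos_ge_minus_one[of "\<xi> \<bullet> u"] show ?thesis by linarith
qed

text \<open>Positivity permits division by this sum in the choice of the constant. The Levy exponent
  at a unit vector is \<open>1 / 2\<close> and at most twice the integral of the weight, which the
  sum dominates.\<close>

lemma levy_nu_truncated_moments_pos:
  fixes \<alpha> :: real
  assumes \<alpha>: "1 < \<alpha>" "\<alpha> < 2"
  shows "0 < (LINT u:{u. norm u \<le> 1}|(levy_nu \<alpha> :: (real^'n::finite) measure). (norm u)\<^sup>2) +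
           (LINT u:{u. norm u \<ge> 1}|(levy_nu \<alpha> :: (real^'n) measure). norm u)"
proof -
  let ?\<nu> = "levy_nu \<alpha> :: (real^'n) measure"
  obtain j :: 'n where True by blast
  define \<xi> :: "real^'n" where "\<xi> = axis j 1"
  have \<xi>: "norm \<xi> = 1" by (simp add: \<xi>_def)
  have w: "integrable ?\<nu> levy_weight" by (rule integrable_levy_weight[OF \<alpha>])
  \<comment> \<open>Integrability matters for positivity too: a Bochner integral of a function that
    is not integrable is 0 by convention.\<close>
  have i1: "integrable ?\<nu> (\<lambda>u. indicator {u. norm u \<le> 1} u * (norm u)\<^sup>2)"
    by (rule Bochner_Integration.integrable_bound[OF w])
       (auto simp: indicator_def levy_weight_def power2_eq_square)
  have i2: "integrable ?\<nu> (\<lambda>u. indicator {u. 1 \<le> norm u} u * norm u)"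
    by (rule Bochner_Integration.integrable_bound[OF w])
       (auto simp: indicator_def levy_weight_def)
  have "(\<integral>\<^sup>+u. ennreal (1 - cos (\<xi> \<bullet> u)) \<partial>?\<nu>) \<le> (\<integral>\<^sup>+u. ennreal (2 * levy_weight u) \<partial>?\<nu>)"
    using one_minus_cos_le_levy_weight[OF \<xi>] by (intro nn_integral_mono ennreal_leI)
  also have "\<dots> = ennreal (LINT u|?\<nu>. 2 * levy_weight u)"
    using w by (intro nn_integral_eq_integral) auto
  finally have "1 / 2 \<le> (LINT u|?\<nu>. 2 * levy_weight u)"
    unfolding nn_integral_levy_nu_one_minus_cos[OF \<alpha>] \<xi>
    by (subst (asm) ennreal_le_iff) (auto intro!: Bochner_Integration.integral_nonneg)
  also have "\<dots> = 2 * (LINT u|?\<nu>. levy_weight u)" by simp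
  \<comment> \<open>Only an inequality pointwise: on the unit sphere both indicators are 1.\<close>
  also have "(LINT u|?\<nu>. levy_weight u) \<le>
      (LINT u|?\<nu>. indicator {u. norm u \<le> 1} u * (norm u)\<^sup>2 + indicator {u. 1 \<le> norm u} u * norm u)"
    by (rule integral_mono[OF w Bochner_Integration.integrable_add[OF i1 i2]])
       (auto simp: indicator_def levy_weight_def power2_eq_square)
  also have "\<dots> = (LINT u|?\<nu>. indicator {u. norm u \<le> 1} u * (norm u)\<^sup>2) + (LINT u|?\<nu>. indicator {u. 1 \<le> norm u} u * norm u)"
    by (rule Bochner_Integration.integral_add[OF i1 i2])
  finally show ?thesis by (simp add: set_lebesgue_integral_def)
qed

section \<open>Scaling of measures and the test functions of the distance\<close>

lemma integral_distr_scaleR: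
  fixes f :: "'a::real_normed_vector \<Rightarrow> 'b::{banach, second_countable_topology}"
  assumes "sets M = sets borel" "f \<in> borel_measurable borel"
  shows "(LINT x|distr M borel (\<lambda>x. c *\<^sub>R x). f x) = (LINT x|M. f (c *\<^sub>R x))"
    and "integrable (distr M borel (\<lambda>x. c *\<^sub>R x)) f \<longleftrightarrow> integrable M (\<lambda>x. f (c *\<^sub>R x))"
proof -
  have m: "(\<lambda>x. c *\<^sub>R x) \<in> measurable M borel"
    unfolding measurable_cong_sets[OF assms(1) refl]
    by (intro borel_measurable_continuous_onI continuous_intros)
  show "(LINT x|distr M borel (\<lambda>x. c *\<^sub>R x). f x) = (LINT x|M. f (c *\<^sub>R x))"
    by (rule integral_distr[OF m assms(2)])
  show "integrable (distr M borel (\<lambda>x. c *\<^sub>R x)) f \<longleftrightarrow> integrable M (\<lambda>x. f (c *\<^sub>R x))"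
    by (rule integrable_distr_eq[OF m assms(2)])
qed

lemma borel_prob_distr_scaleR:
  fixes M :: "'a::real_normed_vector measure"
  assumes "borel_prob M"
  shows "borel_prob (distr M borel (\<lambda>x. c *\<^sub>R x))"
proof -
  interpret prob_space M using assms by (simp add: borel_prob_def)
  have "sets M = sets borel" using assms by (simp add: borel_prob_def)
  then have "(\<lambda>x. c *\<^sub>R x) \<in> measurable M borel"
    by (subst measurable_cong_sets[OF _ refl]) (auto intro!: borel_measurable_continuous_onI continuous_intros)
  then show ?thesis by (simp add: borel_prob_def prob_space_distr)
qed

text \<open>Used in both directions: to normalize \<open>\<mu>\<close> to a stable law, with
  \<open>V = 1\<close>, and to recover the characteristic function of \<open>\<mu>\<close> from that
  law.\<close>

lemma char_distr_scaleR:
  fixes M :: "(real^'n::finite) measure"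
  assumes M: "borel_prob M" and char: "\<And>\<xi>. (LINT x|M. iexp (\<xi> \<bullet> x)) = complex_of_real (exp (- U * norm \<xi> powr \<alpha> / 2))"
    and c: "0 < c" and V: "U * c powr \<alpha> = V"
  shows "(LINT x|distr M borel (\<lambda>x. c *\<^sub>R x). iexp (\<xi> \<bullet> x)) = complex_of_real (exp (- V * norm \<xi> powr \<alpha> / 2))"
proof -
  have "(LINT x|distr M borel (\<lambda>x. c *\<^sub>R x). iexp (\<xi> \<bullet> x)) = (LINT x|M. iexp ((c *\<^sub>R \<xi>) \<bullet> x))"
    using M by (subst integral_distr_scaleR) (auto simp: borel_prob_def)
  also have "\<dots> = complex_of_real (exp (- U * norm (c *\<^sub>R \<xi>) powr \<alpha> / 2))" by (rule char)
  also have "- U * norm (c *\<^sub>R \<xi>) powr \<alpha> / 2 = - V * norm \<xi> powr \<alpha> / 2"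
    using c by (simp add: powr_mult V[symmetric])
  finally show ?thesis .
qed

text \<open>The shape that \<open>integral_eq_of_char_eq\<close> expects, with
  \<open>B = K = 1\<close>; the Lipschitz bound comes from the gradient bound.\<close>

lemma H1_props:
  fixes h :: "'a::euclidean_space \<Rightarrow> real"
  assumes "h \<in> H1"
  shows "\<bar>h x\<bar> \<le> 1" "\<bar>h x - h y\<bar> \<le> 1 * norm (x - y)" "h \<in> borel_measurable borel"
proof -
  from assms obtain g where g: "\<And>x. GDERIV h x :> g x" "\<And>x. norm (g x) \<le> 1" and h: "\<And>x. \<bar>h x\<bar> \<le> 1"
    by (auto simp: H1_def)
  have d: "(h has_derivative (\<lambda>v. v \<bullet> g x)) (at x)" for x
    using g(1)[of x] by (simp add: gderiv_def)
  show "\<bar>h x\<bar> \<le> 1" by (rule h)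
  have "onorm (\<lambda>v. v \<bullet> g x) \<le> 1" for x
  proof (rule onorm_le)
    fix v
    have "norm (v \<bullet> g x) \<le> norm v * norm (g x)" by (simp add: Cauchy_Schwarz_ineq2)
    also have "\<dots> \<le> norm v * 1" by (intro mult_left_mono g) auto
    finally show "norm (v \<bullet> g x) \<le> 1 * norm v" by simp
  qed
  with d show "\<bar>h x - h y\<bar> \<le> 1 * norm (x - y)"
    using differentiable_bound[of UNIV h "\<lambda>x v. v \<bullet> g x" 1 x y] by simp
  show "h \<in> borel_measurable borel"
    using d by (intro borel_measurable_continuous_onI continuous_at_imp_continuous_on)
      (auto intro: has_derivative_continuous)
qed

text \<open>\<open>U powr p\<close> lies between 1 and \<open>U\<close>.\<close>

lemma abs_powr_minus_1_le:
  fixes U p :: real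
  assumes "0 < U" "0 < p" "p < 1"
  shows "\<bar>U powr p - 1\<bar> \<le> \<bar>U - 1\<bar>"
proof (cases "1 \<le> U")
  case True
  then have "1 \<le> U powr p" "U powr p \<le> U"
    using assms powr_mono[of p 1 U] by (auto intro!: ge_one_powr_ge_zero)
  with True show ?thesis by simp
next
  case False
  then have "U powr p \<le> 1" "U \<le> U powr p"
    using assms powr_mono'[of p 1 U] by (auto intro!: powr_le1)
  with False assms show ?thesis by simp
qed

theorem theorem5p3:
  fixes \<alpha> :: real
  assumes "1 < \<alpha>" and "\<alpha> < 2"
  shows "\<exists>C>0. \<forall>(\<beta>::real) (\<mu>::(real^'n::finite) measure) \<mu>\<^sub>\<alpha> D E (U::real).
    1 < \<beta> \<longrightarrow> \<beta> < \<alpha> \<longrightarrow>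
    rot_stable \<alpha> \<mu>\<^sub>\<alpha> \<longrightarrow>
    borel_prob \<mu> \<longrightarrow>
    integrable \<mu> (\<lambda>x. norm x powr \<beta>) \<longrightarrow>
    (LINT x|\<mu>. x) = 0 \<longrightarrow>
    conv_abs_cont \<mu> (levy_nu \<alpha>) \<longrightarrow>
    smallest_closed_extension \<mu> schwartz (stable_form \<alpha> \<mu>) D E \<longrightarrow>
    markovian_form \<mu> D E \<longrightarrow>
    0 < U \<longrightarrow>
    (\<forall>f\<in>D. (LINT x|\<mu>. f x) = 0 \<longrightarrow>
       (\<integral>\<^sup>+x. ennreal (\<bar>f x\<bar>\<^sup>2) \<partial>\<mu>) \<le>
         ennreal U * (\<integral>\<^sup>+x. (\<integral>\<^sup>+u. ennreal (\<bar>f (x + u) - f x\<bar>\<^sup>2) \<partial>levy_nu \<alpha>) \<partial>\<mu>)) \<longrightarrow>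
    (\<forall>j::'n. ((\<lambda>R. E (\<lambda>x. U * trunc_coord \<mu> R j x) (trunc_coord \<mu> R j)
                 - L2_inner \<mu> (trunc_coord \<mu> R j) (trunc_coord \<mu> R j)) \<longlongrightarrow> 0) at_top) \<longrightarrow>
    d_W1 \<mu> \<mu>\<^sub>\<alpha> \<le>
      C * ((LINT u:{u. norm u \<le> 1}|(levy_nu \<alpha> :: (real^'n) measure). (norm u)\<^sup>2) +
           (LINT u:{u. norm u \<ge> 1}|(levy_nu \<alpha> :: (real^'n) measure). norm u)) * \<bar>U - 1\<bar>"
proof -
  define K where "K = (LINT u:{u. norm u \<le> 1}|(levy_nu \<alpha> :: (real^'n) measure). (norm u)\<^sup>2) +
           (LINT u:{u. norm u \<ge> 1}|(levy_nu \<alpha> :: (real^'n) measure). norm u)"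
  have K: "0 < K" unfolding K_def by (rule levy_nu_truncated_moments_pos[OF assms])
  define P where "P M \<longleftrightarrow> rot_stable \<alpha> M \<and> integrable M norm" for M :: "(real^'n) measure"
  \<comment> \<open>\<open>C\<close> must not depend on \<open>\<mu>\<close>, but the existence of \<open>M\<^sub>0\<close> comes from \<open>\<mu>\<close>, a rescaling of
     which satisfies \<open>P\<close>; if nothing satisfies \<open>P\<close>, there is no \<open>\<mu>\<close> to consider.\<close>
  define M\<^sub>0 where "M\<^sub>0 = (SOME M. P M)"
  define m where "m = (LINT x|M\<^sub>0. norm x)"
  have m: "0 \<le> m" unfolding m_def by (rule Bochner_Integration.integral_nonneg) simp
  \<comment> \<open>Dividing by \<open>K\<close> compensates for the truncated moments in the bound,
    and the added 1 makes \<open>C\<close> positive even if \<open>m\<close> were 0. Both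
    \<open>m\<close> and \<open>K\<close> depend on \<open>\<alpha>\<close> and the dimension
    alone.\<close>
  define C where "C = (m + 1) / K"
  have C: "0 < C" "m \<le> C * K" using K m by (auto simp: C_def)
  have main: "d_W1 \<mu> \<mu>\<^sub>\<alpha> \<le> C * K * \<bar>U - 1\<bar>"
    if \<beta>: "1 < \<beta>" and stab: "rot_stable \<alpha> \<mu>\<^sub>\<alpha>" and \<mu>: "borel_prob \<mu>"
      and mom: "integrable \<mu> (\<lambda>x. norm x powr \<beta>)" and cent: "(LINT x|\<mu>. x) = 0"
      and clos: "smallest_closed_extension \<mu> schwartz (stable_form \<alpha> \<mu>) D E" and U: "0 < U"
      and poin: "\<forall>f\<in>D. (LINT x|\<mu>. f x) = 0 \<longrightarrow>
       (\<integral>\<^sup>+x. ennreal (\<bar>f x\<bar>\<^sup>2) \<partial>\<mu>) \<le>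
         ennreal U * (\<integral>\<^sup>+x. (\<integral>\<^sup>+u. ennreal (\<bar>f (x + u) - f x\<bar>\<^sup>2) \<partial>levy_nu \<alpha>) \<partial>\<mu>)"
      and extr: "\<forall>j::'n. ((\<lambda>R. E (\<lambda>x. U * trunc_coord \<mu> R j x) (trunc_coord \<mu> R j)
                 - L2_inner \<mu> (trunc_coord \<mu> R j) (trunc_coord \<mu> R j)) \<longlongrightarrow> 0) at_top"
    for \<beta> U :: real and \<mu> \<mu>\<^sub>\<alpha> :: "(real^'n) measure" and D E
  proof -
    interpret mu: prob_space \<mu> using \<mu> by (simp add: borel_prob_def)
    have s\<mu>: "sets \<mu> = sets borel" using \<mu> by (simp add: borel_prob_def)
    have mom1: "integrable \<mu> norm"
    proof (rule Bochner_Integration.integrable_bound)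
      show "integrable \<mu> (\<lambda>x. 1 + norm x powr \<beta>)" using mom by simp
      have "norm x \<le> 1 + norm x powr \<beta>" for x :: "real^'n"
      proof (cases "1 \<le> norm x")
        case True
        then have "norm x powr 1 \<le> norm x powr \<beta>" using \<beta> by (intro powr_mono) auto
        then show ?thesis by simp
      qed (simp add: add_increasing2)
      then show "AE x in \<mu>. norm (norm x) \<le> norm (1 + norm x powr \<beta>)" by simp
    qed (use s\<mu> in \<open>simp add: measurable_cong_sets[OF s\<mu> refl]\<close>)
    interpret stable_form_extremal \<alpha> \<mu> D E U
      using assms \<mu> clos U mom1 cent poin extr by unfold_locales auto
    \<comment> \<open>Scaling by \<open>c\<close> multiplies the exponent of the characteristic
      function by \<open>c powr \<alpha> = U\<close>.\<close>
    define c where "c = U powr (1 / \<alpha>)"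
    have c: "0 < c" "c powr \<alpha> = U" using U assms by (auto simp: c_def powr_powr)
    have "P (distr \<mu> borel (\<lambda>x. (1 / c) *\<^sub>R x))"
    proof -
      have "U * (1 / c) powr \<alpha> = 1" using c U by (simp add: powr_divide)
      from char_distr_scaleR[OF \<mu> char_eq _ this] c
      have "rot_stable \<alpha> (distr \<mu> borel (\<lambda>x. (1 / c) *\<^sub>R x))"
        by (simp add: rot_stable_def borel_prob_distr_scaleR[OF \<mu>])
      moreover have "integrable (distr \<mu> borel (\<lambda>x. (1 / c) *\<^sub>R x)) norm"
        using mom1 by (subst integral_distr_scaleR(2)[OF s\<mu>]) auto
      ultimately show ?thesis by (simp add: P_def)
    qed
    then have "P M\<^sub>0" unfolding M\<^sub>0_def by (rule someI)
    then have M0: "borel_prob M\<^sub>0" "integrable M\<^sub>0 norm"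
      "\<And>\<xi>. (LINT x|M\<^sub>0. iexp (\<xi> \<bullet> x)) = complex_of_real (exp (- 1 * norm \<xi> powr \<alpha> / 2))"
      by (auto simp: P_def rot_stable_def)
    interpret M0: prob_space M\<^sub>0 using M0 by (simp add: borel_prob_def)
    have sM: "sets M\<^sub>0 = sets borel" using M0 by (simp add: borel_prob_def)
    have "\<bar>(LINT x|\<mu>. h x) - (LINT x|\<mu>\<^sub>\<alpha>. h x)\<bar> \<le> C * K * \<bar>U - 1\<bar>" if h: "h \<in> H1" for h
    proof -
      note [measurable] = H1_props(3)[OF h]
      have [measurable_cong]: "sets M\<^sub>0 = sets borel" by (rule sM)
      have hc: "(LINT x|\<mu>. h x) = (LINT x|M\<^sub>0. h (c *\<^sub>R x))"
      proof -
        have "(LINT x|\<mu>. h x) = (LINT x|distr M\<^sub>0 borel (\<lambda>x. c *\<^sub>R x). h x)"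
        proof (rule integral_eq_of_char_eq[OF \<mu> borel_prob_distr_scaleR[OF M0(1)] _ H1_props[OF h]])
          show "(LINT x|\<mu>. iexp (\<xi> \<bullet> x)) = (LINT x|distr M\<^sub>0 borel (\<lambda>x. c *\<^sub>R x). iexp (\<xi> \<bullet> x))" for \<xi>
            using char_distr_scaleR[OF M0(1,3) c(1), of U] c(2) char_eq[of \<xi>] by simp
        qed
        also have "\<dots> = (LINT x|M\<^sub>0. h (c *\<^sub>R x))" by (rule integral_distr_scaleR(1)[OF sM]) simp
        finally show ?thesis .
      qed
      \<comment> \<open>\<open>M\<^sub>0\<close> and \<open>\<mu>\<^sub>\<alpha>\<close> have the
        same characteristic function. Exchanging them gives access to a law whose first moment is
        known to be finite, and realizes both integrals on one space.\<close>
      have h0: "(LINT x|\<mu>\<^sub>\<alpha>. h x) = (LINT x|M\<^sub>0. h x)"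
      proof (rule integral_eq_of_char_eq[OF _ M0(1) _ H1_props[OF h]])
        show "borel_prob \<mu>\<^sub>\<alpha>" using stab by (simp add: rot_stable_def)
        show "(LINT x|\<mu>\<^sub>\<alpha>. iexp (\<xi> \<bullet> x)) = (LINT x|M\<^sub>0. iexp (\<xi> \<bullet> x))" for \<xi>
          using stab M0(3)[of \<xi>] by (simp add: rot_stable_def)
      qed
      have i: "integrable M\<^sub>0 h" "integrable M\<^sub>0 (\<lambda>x. h (c *\<^sub>R x))"
        using H1_props(1)[OF h] by (auto intro!: M0.integrable_const_bound[where B=1])
      have "\<bar>(LINT x|\<mu>. h x) - (LINT x|\<mu>\<^sub>\<alpha>. h x)\<bar> = \<bar>LINT x|M\<^sub>0. h (c *\<^sub>R x) - h x\<bar>"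
        unfolding hc h0 using i by simp
      also have "\<dots> \<le> (LINT x|M\<^sub>0. \<bar>h (c *\<^sub>R x) - h x\<bar>)" by (rule integral_abs_bound)
      also have "\<dots> \<le> (LINT x|M\<^sub>0. \<bar>c - 1\<bar> * norm x)"
      proof (rule integral_mono)
        show "\<bar>h (c *\<^sub>R x) - h x\<bar> \<le> \<bar>c - 1\<bar> * norm x" for x
        proof -
          have "c *\<^sub>R x - x = (c - 1) *\<^sub>R x" by (simp add: scaleR_left_diff_distrib)
          with H1_props(2)[OF h, of "c *\<^sub>R x" x] show ?thesis by simp
        qed
      qed (use i M0(2) in auto)
      also have "\<dots> = \<bar>c - 1\<bar> * m" by (simp add: m_def)
      also have "\<dots> \<le> \<bar>U - 1\<bar> * (C * K)"
        unfolding c_def using assms U C(2) m by (intro mult_mono abs_powr_minus_1_le) auto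
      finally show ?thesis by (simp add: mult.commute)
    qed
    \<comment> \<open>A bound on the supremum requires that it is taken over a nonempty set.\<close>
    moreover have "(\<lambda>_. 0) \<in> (H1 :: (real^'n \<Rightarrow> real) set)"
      by (auto simp: H1_def intro!: exI[of _ "\<lambda>_. 0"] GDERIV_const)
    ultimately show ?thesis
      unfolding d_W1_def by (intro cSUP_least) auto
  qed
  show ?thesis
    unfolding K_def[symmetric] using C(1) main by (intro exI[of _ C] conjI allI impI) blast+
qed

end
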